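(* An Erdős algebraic $\mathcal{B}$-free system $(\mathbb{X}_{\mathcal{B}},\Gamma)$ satisfies $\mathbb{X}_{\mathcal{B}}=\mathbb{A}$ and is hereditary. Moreover, it has minimal symmetry group, which means $\mathcal{S}=\mathcal{S}(\mathbb{X}_{\mathcal{B}})=\Gamma\simeq\mathbb{Z}^d$. Moreover, its extended symmetry group is of the form $\mathcal{R}(\mathbb{X}_{\mathcal{B}})=\mathcal{S}\rtimes\mathcal{H}$, where $\mathcal{H}$ is isomorphic to a non-trivial subgroup of $\mathrm{GL}(d,\mathbb{Z})$.
   Context: Let $\mathbb{K}$ be an algebraic number field of degree $d$ with ring of integers $\mathcal{O}$. Let $\rho_1,\dots,\rho_r$ be the real embeddings of $\mathbb{K}$ and $\sigma_1,\dots,\sigma_s$ a choice of one complex embedding from each complex conjugate pair ($d=r+2s$). The Minkowski embedding is $\iota:\mathcal{O}\to\mathbb{R}^r\times\mathbb{C}^s\simeq\mathbb{R}^d$, $z\mapsto(\rho_1(z),\dots,\rho_r(z),\sigma_1(z),\dots,\sigma_s(z))$; $\Gamma=\iota(\mathcal{O})$ is a lattice in $\mathbb{R}^d$. The absolute norm of a non-zero ideal $\mathfrak{b}$ is $\mathrm{N}(\mathfrak{b})=[\mathcal{O}:\mathfrak{b}]$. Let $\mathcal{B}=\{\mathfrak{b}_i : i\in\mathbb{N}\}$ be an infinite set of non-trivial ideals of $\mathcal{O}$ that is primitive: $\mathfrak{b}_i\supseteq\mathfrak{b}_j$ implies $i=j$. Put $V_{\mathcal{B}}=\Gamma\setminus\bigcup_{i\in\mathbb{N}}\iota(\mathfrak{b}_i)$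 and let $\mathbb{X}_{\mathcal{B}}=\overline{\Gamma+V_{\mathcal{B}}}$ be the closure of $\{t+V_{\mathcal{B}} : t\in\Gamma\}$ in the power set of $\Gamma$, identified with $\{0,1\}^{\Gamma}$ with the product topology. $(\mathbb{X}_{\mathcal{B}},\Gamma)$, with the shift action $T_t(U)=U-t$, is called an algebraic $\mathcal{B}$-free system. It is Erdős when the $\mathfrak{b}_i$ are pairwise coprime ($\mathfrak{b}_i+\mathfrak{b}_j=\mathcal{O}$ for $i\neq j$) and $\sum_{i}1/\mathrm{N}(\mathfrak{b}_i)<\infty$. A set $U\subset\Gamma$ is admissible for $\mathcal{B}$ if, for every $\mathfrak{b}\in\mathcal{B}$, it misses at least one coset of $\iota(\mathfrak{b})$ in $\Gamma$; $\mathbb{A}$ is the set of all admissible subsets of $\Gamma$. Hereditary means closed under the formation of subsets. $\mathrm{Aut}(\mathbb{X})$ is the group of all homeomorphisms of $\mathbb{X}$, $\mathcal{G}=\{T_t|_{\mathbb{X}} : t\in\Gamma\}$, $\mathcal{S}(\mathbb{X})$ is the centraliser and $\mathcal{R}(\mathbb{X})$ the normaliser of $\mathcal{G}$ in $\mathrm{Aut}(\mathbb{X})$. $\mathcal{S}(\mathbb{X})=\Gamma$ means $\mathcal{S}(\mathbb{X})=\mathcal{G}$, with $\mathcal{G}\simeq\Gamma$. *)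

theory Defs
  imports
    "HOL-Analysis.Analysis"
    "HOL-Algebra.Bij"
    "HOL-Algebra.Group_Action"
    "HOL-Algebra.Ideal"
    "Jordan_Normal_Form.Matrix"
begin

section \<open>Number fields and the Minkowski embedding\<close>

text \<open>
  An algebraic number field is a type \<open>'k\<close> of sort \<open>field_char_0\<close> that is finite-dimensional
  over the rational numbers; the free type variable ranges over all of them.
\<close>

definition rat_scale :: "rat \<Rightarrow> 'k::field_char_0 \<Rightarrow> 'k" where
  "rat_scale q x = of_rat q * x"

lemma vector_space_rat_scale: "vector_space (rat_scale :: rat \<Rightarrow> 'k::field_char_0 \<Rightarrow> 'k)"
  by unfold_locales (simp_all add: rat_scale_def algebra_simps of_rat_add of_rat_mult)

definition number_field :: "'k::field_char_0 itself \<Rightarrow> bool" where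
  "number_field _ \<longleftrightarrow> (\<exists>B :: 'k set. finite B \<and> module.span rat_scale B = UNIV)"

definition field_degree :: "'k::field_char_0 itself \<Rightarrow> nat" where
  "field_degree _ = vector_space.dim rat_scale (UNIV :: 'k set)"

definition ring_of_integers :: "'k::field_char_0 ring" where
  "ring_of_integers =
     \<lparr>carrier = {x. algebraic_int x}, mult = (*), one = 1, zero = 0, add = (+)\<rparr>"

definition absolute_norm :: "'k::field_char_0 set \<Rightarrow> nat" where
  "absolute_norm I = card (a_rcosets\<^bsub>ring_of_integers\<^esub> I)"

definition real_embeddings :: "('k::field_char_0 \<Rightarrow> real) set" where
  "real_embeddings = {\<tau>. field_hom \<tau>}"

definition complex_embeddings :: "('k::field_char_0 \<Rightarrow> complex) set" where
  "complex_embeddings = {\<tau>. field_hom \<tau> \<and> \<not> range \<tau> \<subseteq> \<real>}"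

text \<open>
  \<open>\<rho> 0, \<dots>, \<rho> (r - 1)\<close> enumerates the real embeddings without repetition, and
  \<open>\<sigma> 0, \<dots>, \<sigma> (s - 1)\<close> contains exactly one member of each complex conjugate pair of
  non-real embeddings; values at larger indices are irrelevant.
\<close>

definition embedding_choice ::
    "nat \<Rightarrow> (nat \<Rightarrow> 'k::field_char_0 \<Rightarrow> real) \<Rightarrow> nat \<Rightarrow> (nat \<Rightarrow> 'k \<Rightarrow> complex) \<Rightarrow> bool" where
  "embedding_choice r \<rho> s \<sigma> \<longleftrightarrow>
     bij_betw \<rho> {..<r} real_embeddings \<and>
     (\<forall>j<s. \<sigma> j \<in> complex_embeddings) \<and>
     (\<forall>\<tau>\<in>complex_embeddings. \<exists>!j. j < s \<and> (\<sigma> j = \<tau> \<or> \<sigma> j = cnj \<circ> \<tau>))"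

definition minkowski ::
    "nat \<Rightarrow> (nat \<Rightarrow> 'k \<Rightarrow> real) \<Rightarrow> nat \<Rightarrow> (nat \<Rightarrow> 'k \<Rightarrow> complex) \<Rightarrow>
     'k::field_char_0 \<Rightarrow> real vec \<times> complex vec" where
  "minkowski r \<rho> s \<sigma> z = (vec r (\<lambda>i. \<rho> i z), vec s (\<lambda>j. \<sigma> j z))"

text \<open>The lattice \<open>\<Gamma>\<close>, as an additive subgroup of \<open>\<real>\<^sup>r \<times> \<complex>\<^sup>s\<close>.\<close>

definition minkowski_lattice ::
    "nat \<Rightarrow> (nat \<Rightarrow> 'k::field_char_0 \<Rightarrow> real) \<Rightarrow> nat \<Rightarrow> (nat \<Rightarrow> 'k \<Rightarrow> complex) \<Rightarrow>
     (real vec \<times> complex vec) monoid" where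
  "minkowski_lattice r \<rho> s \<sigma> =
     (monoid_vec TYPE(real) r \<times>\<times> monoid_vec TYPE(complex) s)
       \<lparr>carrier := minkowski r \<rho> s \<sigma> ` carrier ring_of_integers\<rparr>"

section \<open>Families of ideals\<close>

definition primitive_ideal_family :: "(nat \<Rightarrow> 'k::field_char_0 set) \<Rightarrow> bool" where
  "primitive_ideal_family \<bb> \<longleftrightarrow>
     infinite (range \<bb>) \<and>
     (\<forall>i. ideal (\<bb> i) ring_of_integers \<and> \<bb> i \<noteq> {0} \<and> \<bb> i \<noteq> carrier ring_of_integers) \<and>
     (\<forall>i j. \<bb> j \<subseteq> \<bb> i \<longrightarrow> i = j)"

definition erdos_family :: "(nat \<Rightarrow> 'k::field_char_0 set) \<Rightarrow> bool" where
  "erdos_family \<bb> \<longleftrightarrow>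
     (\<forall>i j. i \<noteq> j \<longrightarrow> \<bb> i <+>\<^bsub>ring_of_integers\<^esub> \<bb> j = carrier ring_of_integers) \<and>
     summable (\<lambda>i. 1 / real (absolute_norm (\<bb> i)))"

section \<open>Shift spaces of subsets of a group\<close>

text \<open>
  In this section \<open>G\<close> plays the role of \<open>\<Gamma>\<close> (written multiplicatively by HOL-Algebra) and
  \<open>L i\<close> that of \<open>\<iota>(\<bb>\<^sub>i)\<close>.  The power set of \<open>A\<close> carries the topology of \<open>{0,1}\<^sup>A\<close>,
  transported along characteristic functions.
\<close>

definition powerset_topology :: "'v set \<Rightarrow> 'v set topology" where
  "powerset_topology A =
     pullback_topology (Pow A) (\<lambda>U. \<lambda>x\<in>A. x \<in> U)
       (product_topology (\<lambda>_. discrete_topology (UNIV :: bool set)) A)"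

definition free_points :: "('v, 'm) monoid_scheme \<Rightarrow> (nat \<Rightarrow> 'v set) \<Rightarrow> 'v set" where
  "free_points G L = carrier G - (\<Union>i. L i)"

definition free_space :: "('v, 'm) monoid_scheme \<Rightarrow> (nat \<Rightarrow> 'v set) \<Rightarrow> 'v set set" where
  "free_space G L =
     powerset_topology (carrier G) closure_of {t <#\<^bsub>G\<^esub> free_points G L | t. t \<in> carrier G}"

definition admissible_sets :: "('v, 'm) monoid_scheme \<Rightarrow> (nat \<Rightarrow> 'v set) \<Rightarrow> 'v set set" where
  "admissible_sets G L =
     {U. U \<subseteq> carrier G \<and> (\<forall>i. \<exists>C \<in> rcosets\<^bsub>G\<^esub> (L i). U \<inter> C = {})}"

definition hereditary :: "'v set set \<Rightarrow> bool" where
  "hereditary X \<longleftrightarrow> (\<forall>U\<in>X. \<forall>W. W \<subseteq> U \<longrightarrow> W \<in> X)"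

definition homeo_group :: "'a topology \<Rightarrow> ('a \<Rightarrow> 'a) monoid" where
  "homeo_group T =
     BijGroup (topspace T) \<lparr>carrier := {f \<in> Bij (topspace T). homeomorphic_map T T f}\<rparr>"

definition Aut_space :: "('v, 'm) monoid_scheme \<Rightarrow> 'v set set \<Rightarrow> ('v set \<Rightarrow> 'v set) monoid" where
  "Aut_space G X = homeo_group (subtopology (powerset_topology (carrier G)) X)"

text \<open>\<open>T\<^sub>t(U) = U - t\<close>, restricted to \<open>X\<close>.\<close>

definition shift_map :: "('v, 'm) monoid_scheme \<Rightarrow> 'v set set \<Rightarrow> 'v \<Rightarrow> 'v set \<Rightarrow> 'v set" where
  "shift_map G X t = (\<lambda>U\<in>X. U #>\<^bsub>G\<^esub> (inv\<^bsub>G\<^esub> t))"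

definition shift_group :: "('v, 'm) monoid_scheme \<Rightarrow> 'v set set \<Rightarrow> ('v set \<Rightarrow> 'v set) set" where
  "shift_group G X = shift_map G X ` carrier G"

definition centralizer :: "('a, 'm) monoid_scheme \<Rightarrow> 'a set \<Rightarrow> 'a set" where
  "centralizer A H = {g \<in> carrier A. \<forall>h\<in>H. g \<otimes>\<^bsub>A\<^esub> h = h \<otimes>\<^bsub>A\<^esub> g}"

definition symmetry_group :: "('v, 'm) monoid_scheme \<Rightarrow> 'v set set \<Rightarrow> ('v set \<Rightarrow> 'v set) set" where
  "symmetry_group G X = centralizer (Aut_space G X) (shift_group G X)"

definition extended_symmetry_group ::
    "('v, 'm) monoid_scheme \<Rightarrow> 'v set set \<Rightarrow> ('v set \<Rightarrow> 'v set) set" where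
  "extended_symmetry_group G X = normalizer (Aut_space G X) (shift_group G X)"

section \<open>Group-theoretic notions\<close>

text \<open>\<open>A = N \<rtimes> H\<close> as an internal semidirect product.\<close>

definition internal_semidirect :: "('a, 'm) monoid_scheme \<Rightarrow> 'a set \<Rightarrow> 'a set \<Rightarrow> bool" where
  "internal_semidirect A N H \<longleftrightarrow>
     N \<lhd> A \<and> subgroup H A \<and> N \<inter> H = {\<one>\<^bsub>A\<^esub>} \<and> N <#>\<^bsub>A\<^esub> H = carrier A"

definition GL_int :: "nat \<Rightarrow> int mat monoid" where
  "GL_int d = units_of (ring_mat TYPE(int) d ())"

end

theory Submission
  imports
    Defs
    "HOL-Computational_Algebra.Fundamental_Theorem_Algebra"
begin

text \<open>
  The arithmetic of the ring of integers \<open>\<O>\<close> enters through the group structure of \<open>\<O>\<close>, the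
  Chinese remainder theorem and a sieve for coprime ideals; the dynamics is then a
  combinatorial argument about cosets, carried out in an abstract abelian group.

  \<^emph>\<open>Arithmetic.\<close> Fix coordinates of the number field with respect to a rational basis. If
  \<open>x\<close> is an algebraic integer, the powers of \<open>x\<close> lie in a finitely generated group, so their
  coordinates have a common denominator; if the coordinates of \<open>x\<close> are very small, they also
  tend to \<open>0\<close>. Hence \<open>x = 0\<close>: the algebraic integers form a discrete set
  (\<open>small_algebraic_int_eq_zero\<close>). The pigeonhole principle and a triangular choice of
  minimal elements turn this into an integral basis (\<open>integral_basis_exists\<close>), so \<open>\<O>\<close> is
  \<open>\<int>\<^sup>d\<close>. Complex embeddings are common eigenvalues: \<open>K\<close> acts by commuting operators on the
  additive maps \<open>K \<Rightarrow> \<complex>\<close>, and a common eigenvector yields an embedding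
  (\<open>complex_embedding_exists\<close>); this makes the Minkowski map injective.

  \<^emph>\<open>Sieve.\<close> A nonzero element of an ideal with coordinates of size \<open>m\<close> bounds the norm of
  the ideal by \<open>C m\<^sup>d\<close>. Thus distinct elements of a coset of an ideal \<open>J\<close> are separated by
  about \<open>N(J)\<close> to the power \<open>1/d\<close>, and a box of size \<open>n\<close> contains \<open>O(1 + n\<^sup>d / N(J))\<close> of
  them (\<open>packing_bound\<close>) with a constant that depends only on the basis. Since the
  reciprocal norms are summable, all but finitely many of the coprime ideals together remove
  only a small proportion of any residue class modulo the intersection of the others
  (\<open>sieve\<close>).

  \<^emph>\<open>Orbit closure.\<close> To copy a finite piece of an admissible set, let each unwanted point
  fall into its own ideal, use the Chinese remainder theorem for the finitely many ideals
  involved, and the sieve for the others (\<open>free_space_eq_admissible\<close>).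

  \<^emph>\<open>Rigidity.\<close> Let a homeomorphism \<open>\<Phi>\<close> satisfy \<open>\<Phi> (U t) = \<Phi> U \<cdot> \<alpha> t\<close> for an automorphism \<open>\<alpha>\<close>
  of the lattice. It fixes the empty set, so \<open>\<Phi> {1}\<close> contains some \<open>f\<close>, and by continuity
  \<open>\<alpha> y \<cdot> f\<close> belongs to \<open>\<Phi> Y\<close> whenever \<open>y\<close> is isolated in \<open>Y\<close>. If \<open>\<alpha>\<close> is the identity and
  \<open>\<Phi> U\<close> had a point outside \<open>U f\<close>, then adding to \<open>U\<close> isolated points in all cosets but one
  of a suitable ideal would give an admissible set with an inadmissible image
  (\<open>image_subset_translate_finite\<close>). So symmetries are translations. For general \<open>\<alpha>\<close> the
  same isolated points show that \<open>\<alpha>\<close> itself preserves admissibility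
  (\<open>automorphism_preserves_admissible\<close>); composing \<open>\<Phi>\<close> with the inverse of the map induced
  by \<open>\<alpha>\<close> then leaves a symmetry. Therefore the normaliser is the semidirect product of the
  translations with the automorphisms that preserve admissibility (\<open>normalizer_semidirect\<close>),
  a subgroup of \<open>GL(d, \<int>)\<close> that contains \<open>-1\<close>.
\<close>

section \<open>Coordinates in a number field\<close>

locale rational_basis =
  fixes d :: nat and \<omega> :: "nat \<Rightarrow> 'k::field_char_0"
  assumes spanning: "\<exists>q :: nat \<Rightarrow> rat. x = (\<Sum>i<d. of_rat (q i) * \<omega> i)"
    and independent: "(\<Sum>i<d. of_rat (q i) * \<omega> i) = 0 \<Longrightarrow> i < d \<Longrightarrow> q i = 0"
begin

definition coord :: "'k \<Rightarrow> nat \<Rightarrow> rat" where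
  "coord x = (SOME q. x = (\<Sum>i<d. of_rat (q i) * \<omega> i))"

lemma coord_expansion: "x = (\<Sum>i<d. of_rat (coord x i) * \<omega> i)"
  unfolding coord_def using someI_ex[OF spanning[of x]] .

lemma coord_unique:
  assumes "x = (\<Sum>i<d. of_rat (q i) * \<omega> i)" "i < d"
  shows "coord x i = q i"
proof -
  have "(\<Sum>i<d. of_rat (coord x i - q i) * \<omega> i) = x - x"
    by (subst (2) assms(1), subst coord_expansion)
      (simp add: of_rat_diff algebra_simps sum_subtractf)
  then show ?thesis using independent[of "\<lambda>i. coord x i - q i" i] assms(2) by simp
qed

lemma coord_add: "i < d \<Longrightarrow> coord (x + y) i = coord x i + coord y i"
  by (rule coord_unique, subst (1) coord_expansion[of x], subst (1) coord_expansion[of y])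
    (simp_all add: of_rat_add algebra_simps sum.distrib)

lemma coord_scale: "i < d \<Longrightarrow> coord (of_rat q * x) i = q * coord x i"
  by (rule coord_unique, subst (1) coord_expansion[of x])
    (simp_all add: of_rat_mult algebra_simps sum_distrib_left)

lemma coord_zero [simp]: "i < d \<Longrightarrow> coord 0 i = 0"
  using coord_scale[of i 0 0] by simp

lemma coord_uminus: "i < d \<Longrightarrow> coord (- x) i = - coord x i"
  using coord_scale[of i "-1" x] by (simp add: of_rat_minus)

lemma coord_diff: "i < d \<Longrightarrow> coord (x - y) i = coord x i - coord y i"
  using coord_add[of i x "- y"] by (simp add: coord_uminus)

lemma coord_sum: "i < d \<Longrightarrow> coord (\<Sum>j\<in>S. f j) i = (\<Sum>j\<in>S. coord (f j) i)"
  by (induction S rule: infinite_finite_induct) (simp_all add: coord_add)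

lemma coord_scale_int: "i < d \<Longrightarrow> coord (of_int n * x) i = of_int n * coord x i"
  using coord_scale[of i "of_int n" x] by simp

lemma coord_scale_nat: "i < d \<Longrightarrow> coord (of_nat n * x) i = of_nat n * coord x i"
  using coord_scale[of i "of_nat n" x] by simp

lemma coord_basis: "i < d \<Longrightarrow> j < d \<Longrightarrow> coord (\<omega> i) j = (if j = i then 1 else 0)"
  by (rule coord_unique) (simp_all add: if_distrib[of of_rat] if_distrib[of "\<lambda>z. z * _"] cong: if_cong)

lemma eq_zero_iff_coord: "x = 0 \<longleftrightarrow> (\<forall>i<d. coord x i = 0)"
proof
  assume "\<forall>i<d. coord x i = 0"
  then have "(\<Sum>i<d. of_rat (coord x i) * \<omega> i) = 0" by simp
  then show "x = 0" by (subst coord_expansion)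
qed simp

lemma coord_eq_iff: "x = y \<longleftrightarrow> (\<forall>i<d. coord x i = coord y i)"
  using eq_zero_iff_coord[of "x - y"] by (simp add: coord_diff)

text \<open>
  A constant bounding the coordinates of a product; the summand \<open>1\<close> keeps it positive, so
  that one may divide by it.
\<close>
definition mult_const :: nat where
  "mult_const = nat \<lceil>\<Sum>i<d. \<Sum>j<d. \<Sum>k<d. \<bar>coord (\<omega> i * \<omega> j) k\<bar>\<rceil> + 1"

lemma coord_mult_bound:
  assumes X: "\<And>i. i < d \<Longrightarrow> \<bar>coord x i\<bar> \<le> X" and Y: "\<And>i. i < d \<Longrightarrow> \<bar>coord y i\<bar> \<le> Y" and k: "k < d"
  shows "\<bar>coord (x * y) k\<bar> \<le> of_nat mult_const * X * Y"
proof -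
  have X0: "0 \<le> X" and Y0: "0 \<le> Y" using X[OF k] Y[OF k] by linarith+
  have eq: "x * y = (\<Sum>i<d. \<Sum>j<d. of_rat (coord x i * coord y j) * (\<omega> i * \<omega> j))"
    by (subst (1) coord_expansion[of x], subst (1) coord_expansion[of y])
      (simp add: sum_product of_rat_mult algebra_simps)
  have "coord (x * y) k = (\<Sum>i<d. \<Sum>j<d. coord x i * coord y j * coord (\<omega> i * \<omega> j) k)"
    by (subst eq) (simp add: coord_sum k coord_scale)
  also have "\<bar>\<dots>\<bar> \<le> (\<Sum>i<d. \<Sum>j<d. X * Y * \<bar>coord (\<omega> i * \<omega> j) k\<bar>)"
    by (intro order_trans[OF sum_abs] sum_mono)
      (auto simp: abs_mult intro!: mult_right_mono mult_mono X Y X0)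
  also have "\<dots> \<le> (\<Sum>i<d. \<Sum>j<d. X * Y * (\<Sum>k<d. \<bar>coord (\<omega> i * \<omega> j) k\<bar>))"
    by (intro sum_mono mult_left_mono member_le_sum[of k]) (auto simp: k X0 Y0)
  also have "\<dots> = (\<Sum>i<d. \<Sum>j<d. \<Sum>k<d. \<bar>coord (\<omega> i * \<omega> j) k\<bar>) * (X * Y)"
    by (simp add: sum_distrib_left sum_distrib_right mult.commute)
  also have "\<dots> \<le> of_nat mult_const * (X * Y)"
  proof (rule mult_right_mono)
    let ?S = "\<Sum>i<d. \<Sum>j<d. \<Sum>k<d. \<bar>coord (\<omega> i * \<omega> j) k\<bar>"
    have "0 \<le> ?S" by (intro sum_nonneg) auto
    then have "of_int \<lceil>?S\<rceil> = (of_nat (nat \<lceil>?S\<rceil>) :: rat)"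
      by (subst of_nat_nat) simp_all
    then show "?S \<le> of_nat mult_const"
      using le_of_int_ceiling[of ?S] unfolding mult_const_def by simp
  qed (simp add: X0 Y0)
  finally show ?thesis by (simp add: mult.assoc)
qed

lemma mult_const_pos: "mult_const > 0" by (simp add: mult_const_def)

text \<open>
  The \<open>d + 1\<close> powers \<open>x\<^sup>0, \<dots>, x\<^sup>d\<close> are linearly dependent over the rationals, unless two of
  them coincide.
\<close>
lemma algebraic: "algebraic (x :: 'k)"
proof -
  interpret V: vector_space "rat_scale :: rat \<Rightarrow> 'k \<Rightarrow> 'k" by (rule vector_space_rat_scale)
  show ?thesis
  proof (cases "inj_on (\<lambda>i. x ^ i) {..d}")
    case False
    then obtain i j where ij: "i < j" "x ^ i = x ^ j"
      unfolding inj_on_def by (metis linorder_neqE_nat)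
    have c: "coeff (monom 1 j - monom 1 i :: 'k poly) j = 1" using ij by simp
    show ?thesis
    proof (rule algebraicI)
      show "coeff (monom 1 j - monom 1 i :: 'k poly) n \<in> \<int>" for n by (auto simp: coeff_diff)
      show "monom 1 j - monom 1 i \<noteq> (0 :: 'k poly)" using c by (metis coeff_0 zero_neq_one)
      show "poly (monom 1 j - monom 1 i) x = 0" using ij by (simp add: poly_monom)
    qed
  next
    case True
    let ?P = "(\<lambda>i. x ^ i) ` {..d}"
    have "?P \<subseteq> V.span (\<omega> ` {..<d})"
    proof safe
      fix i
      have "x ^ i = (\<Sum>j<d. rat_scale (coord (x ^ i) j) (\<omega> j))"
        unfolding rat_scale_def by (rule coord_expansion)
      also have "\<dots> \<in> V.span (\<omega> ` {..<d})"
        by (intro V.span_sum V.span_scale V.span_base) auto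
      finally show "x ^ i \<in> V.span (\<omega> ` {..<d})" .
    qed
    moreover have "card ?P = Suc d" using True by (simp add: card_image)
    moreover have "card (\<omega> ` {..<d}) \<le> d" using card_image_le[of "{..<d}" \<omega>] by simp
    ultimately have "V.dependent ?P"
      using V.independent_span_bound[of "\<omega> ` {..<d}" ?P] by auto
    then obtain u where u: "(\<Sum>v\<in>?P. rat_scale (u v) v) = 0" "\<exists>v\<in>?P. u v \<noteq> 0"
      using V.dependent_finite[of ?P] by auto
    define p where "p = (\<Sum>i\<le>d. monom (of_rat (u (x ^ i)) :: 'k) i)"
    have cp: "coeff p n = (if n \<le> d then of_rat (u (x ^ n)) else 0)" for n
      by (simp add: p_def coeff_sum)
    show ?thesis
    proof (rule algebraicI')
      show "coeff p n \<in> \<rat>" for n by (simp add: cp)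
      show "p \<noteq> 0"
      proof
        assume "p = 0"
        then have "\<And>n. n \<le> d \<Longrightarrow> of_rat (u (x ^ n)) = (0::'k)" using cp by (metis coeff_0)
        then show False using u(2) by auto
      qed
      have "poly p x = (\<Sum>i\<le>d. rat_scale (u (x ^ i)) (x ^ i))"
        by (simp add: p_def poly_sum poly_monom rat_scale_def)
      also have "\<dots> = (\<Sum>v\<in>?P. rat_scale (u v) v)" using True by (simp add: sum.reindex)
      finally show "poly p x = 0" using u(1) by simp
    qed
  qed
qed

end

text \<open>
  If \<open>a\<close> is the leading coefficient of an integral polynomial of degree \<open>n\<close> with root \<open>x\<close>,
  then multiplying the equation by \<open>a\<close> to the power \<open>n - 1\<close> gives a monic equation for
  \<open>a x\<close>.
\<close>
lemma algebraic_imp_multiple_algebraic_int: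
  fixes x :: "'a::field_char_0"
  assumes "algebraic x"
  obtains D :: int where "D > 0" "algebraic_int (of_int D * x)"
proof -
  obtain p where p: "\<And>i. coeff p i \<in> \<int>" "p \<noteq> 0" "poly p x = 0"
    using assms by (auto simp: algebraic_def)
  define n where "n = degree p"
  have n: "n > 0" using p by (intro Nat.gr0I) (auto simp: n_def elim!: degree_eq_zeroE)
  obtain a :: int where a: "lead_coeff p = of_int a" using p(1) by (auto elim: Ints_cases)
  have a0: "a \<noteq> 0" using a p(2) by auto
  define q where "q = (\<Sum>i<n. monom (coeff p i * of_int (a ^ (n - 1 - i))) i) + monom 1 n"
  have cq: "coeff q i = (if i < n then coeff p i * of_int (a ^ (n - 1 - i)) else if i = n then 1 else 0)" for i
    by (simp add: q_def coeff_sum)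
  have dq: "degree q = n"
    by (rule antisym) (auto intro!: degree_le le_degree simp: cq)
  have ax: "algebraic_int (of_int a * x)"
  proof (rule algebraic_int.intros)
    show "lead_coeff q = 1" by (simp add: dq cq)
    show "\<forall>i. coeff q i \<in> \<int>" using p(1) by (auto simp: cq intro!: Ints_mult Ints_of_int simp del: of_int_power)
    have "poly q (of_int a * x) = (\<Sum>i<n. coeff p i * of_int (a ^ (n - 1 - i)) * (of_int a * x) ^ i) + (of_int a * x) ^ n"
      by (simp add: q_def poly_sum poly_monom)
    also have "(\<Sum>i<n. coeff p i * of_int (a ^ (n - 1 - i)) * (of_int a * x) ^ i)
        = (\<Sum>i<n. of_int a ^ (n - 1) * (coeff p i * x ^ i))"
    proof (rule sum.cong)
      fix i assume "i \<in> {..<n}"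
      then have e: "n - 1 = (n - 1 - i) + i" by auto
      show "coeff p i * of_int (a ^ (n - 1 - i)) * (of_int a * x) ^ i = of_int a ^ (n - 1) * (coeff p i * x ^ i)"
        by (subst (2) e, subst power_add) (simp add: power_mult_distrib)
    qed simp
    also have "(of_int a * x) ^ n = of_int a ^ (n - 1) * (coeff p n * x ^ n)"
    proof -
      have e: "n = Suc (n - 1)" using n by simp
      have "(of_int a * x) ^ n = of_int a ^ n * x ^ n" by (simp add: power_mult_distrib)
      also have "of_int a ^ n = of_int a ^ (n - 1) * (of_int a :: 'a)" by (subst e) simp
      finally show ?thesis using a by (simp add: n_def)
    qed
    also have "(\<Sum>i<n. of_int a ^ (n - 1) * (coeff p i * x ^ i)) + of_int a ^ (n - 1) * (coeff p n * x ^ n)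
        = of_int a ^ (n - 1) * poly p x"
      by (simp add: poly_altdef n_def[symmetric] sum_distrib_left distrib_left flip: lessThan_Suc_atMost)
    finally show "poly q (of_int a * x) = 0" using p(3) by simp
  qed
  have "algebraic_int (of_int \<bar>a\<bar> * x)"
    using ax algebraic_int_minus[OF ax] by (cases "a \<ge> 0") auto
  then show ?thesis using that[of "\<bar>a\<bar>"] a0 by auto
qed

lemma common_denominator:
  assumes "finite (Q :: rat set)"
  obtains D :: int where "D > 0" "\<And>q. q \<in> Q \<Longrightarrow> of_int D * q \<in> \<int>"
  using assms
proof (induction Q arbitrary: thesis rule: finite_induct)
  case empty
  then show ?case using empty[of 1] by auto
next
  case (insert q Q)
  then obtain D where D: "D > 0" "\<And>q. q \<in> Q \<Longrightarrow> of_int D * q \<in> \<int>" by blast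
  obtain a b where ab: "b > 0" "q = of_int a / of_int b"
    by (metis Fract_of_int_quotient Rat_cases)
  show ?case
  proof (rule insert.prems)
    show "D * b > 0" using D ab by simp
    fix q' assume "q' \<in> insert q Q"
    then consider "q' = q" | "q' \<in> Q" by blast
    then show "of_int (D * b) * q' \<in> \<int>"
    proof cases
      case 1
      have "of_int (D * b) * q = of_int (D * a)" using ab by simp
      then show ?thesis using 1 by (metis Ints_of_int)
    next
      case 2
      have "of_int (D * b) * q' = of_int b * (of_int D * q')" by simp
      then show ?thesis using D(2)[OF 2] by (metis Ints_mult Ints_of_int)
    qed
  qed
qed

lemma number_field_has_rational_basis:
  assumes "number_field TYPE('k::field_char_0)"
  obtains b :: "nat \<Rightarrow> 'k::field_char_0" where "rational_basis (field_degree TYPE('k)) b"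
proof -
  interpret V: vector_space "rat_scale :: rat \<Rightarrow> 'k \<Rightarrow> 'k" by (rule vector_space_rat_scale)
  obtain B0 :: "'k set" where B0: "finite B0" "V.span B0 = UNIV"
    using assms unfolding number_field_def by blast
  obtain B where B: "V.independent B" "V.span B = UNIV" "card B = V.dim UNIV"
  proof -
    obtain B where "B \<subseteq> UNIV" "V.independent B" "UNIV \<subseteq> V.span B" "card B = V.dim UNIV"
      using V.basis_exists[of UNIV] by blast
    then show ?thesis using that by blast
  qed
  have finB: "finite B" using V.independent_span_bound[OF B0(1) B(1)] B0(2) by auto
  define n where "n = card B"
  obtain b where b: "bij_betw b {..<n} B"
    using ex_bij_betw_nat_finite[OF finB] unfolding n_def by (auto simp: atLeast0LessThan)
  have n: "n = field_degree TYPE('k)" using B(3) by (simp add: n_def field_degree_def)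
  have "rational_basis n b"
  proof
    fix x :: 'k
    have "x \<in> V.span B" using B by simp
    then obtain u where "x = (\<Sum>v\<in>B. rat_scale (u v) v)"
      using V.span_finite[OF finB] by auto
    also have "\<dots> = (\<Sum>i<n. rat_scale (u (b i)) (b i))"
      by (rule sum.reindex_bij_betw[OF b, symmetric])
    finally show "\<exists>q. x = (\<Sum>i<n. of_rat (q i) * b i)" unfolding rat_scale_def
      by (rule exI[of _ "\<lambda>i. u (b i)"])
  next
    fix q :: "nat \<Rightarrow> rat" and i
    assume s: "(\<Sum>i<n. of_rat (q i) * b i) = 0" and i: "i < n"
    have inj: "inj_on b {..<n}" using b by (simp add: bij_betw_def)
    have "0 = (\<Sum>i<n. rat_scale (q (inv_into {..<n} b (b i))) (b i))"
      unfolding s[symmetric] rat_scale_def by (rule sum.cong) (simp_all add: inv_into_f_f[OF inj])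
    also have "\<dots> = (\<Sum>v\<in>B. rat_scale (q (inv_into {..<n} b v)) v)"
      by (rule sum.reindex_bij_betw[OF b])
    finally have "\<forall>v\<in>B. q (inv_into {..<n} b v) = 0"
      using B(1) V.dependent_finite[OF finB] by force
    then have "q (inv_into {..<n} b (b i)) = 0" using b i by (auto simp: bij_betw_def)
    then show "q i = 0" using i by (simp add: inv_into_f_f[OF inj])
  qed
  then show ?thesis using that n by simp
qed

lemma rational_basis_scale:
  assumes "rational_basis d b" "\<And>i. c i \<noteq> (0::int)"
  shows "rational_basis d (\<lambda>i. of_int (c i) * b i)"
proof -
  interpret rational_basis d b by fact
  show ?thesis
  proof
    fix x
    show "\<exists>q. x = (\<Sum>i<d. of_rat (q i) * (of_int (c i) * b i))"
      using assms(2) coord_expansion[of x]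
      by (intro exI[of _ "\<lambda>i. coord x i / of_int (c i)"]) (simp add: of_rat_divide)
  next
    fix q :: "nat \<Rightarrow> rat" and i
    assume "(\<Sum>i<d. of_rat (q i) * (of_int (c i) * b i)) = 0" "i < d"
    then show "q i = 0"
      using independent[of "\<lambda>i. q i * of_int (c i)" i] assms(2)[of i] by (simp add: of_rat_mult algebra_simps)
  qed
qed

lemma number_field_has_integral_rational_basis:
  assumes "number_field TYPE('k::field_char_0)"
  obtains b :: "nat \<Rightarrow> 'k::field_char_0" where "rational_basis (field_degree TYPE('k)) b" "\<And>i. algebraic_int (b i)"
proof -
  obtain b :: "nat \<Rightarrow> 'k" where b: "rational_basis (field_degree TYPE('k)) b"
    by (rule number_field_has_rational_basis[OF assms])
  interpret rational_basis "field_degree TYPE('k)" b by fact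
  have "\<forall>i. \<exists>D::int. D > 0 \<and> algebraic_int (of_int D * b i)"
    using algebraic_imp_multiple_algebraic_int[OF algebraic] by blast
  then have "\<exists>c. \<forall>i. (c i :: int) > 0 \<and> algebraic_int (of_int (c i) * b i)"
    by (rule choice)
  then obtain c :: "nat \<Rightarrow> int" where c: "\<And>i. c i > 0" "\<And>i. algebraic_int (of_int (c i) * b i)" by blast
  have "c i \<noteq> 0" for i using c(1)[of i] by simp
  from rational_basis_scale[OF b this] c(2) show ?thesis by (rule that)
qed

section \<open>The algebraic integers form a lattice\<close>

context rational_basis
begin

text \<open>
  A monic equation of degree \<open>m\<close> expresses all powers of \<open>x\<close> as integral combinations of the
  first \<open>m\<close>, and the finitely many coordinates of these have a common denominator.
\<close>
lemma bounded_denominator_powers: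
  assumes "algebraic_int x"
  obtains D :: int where "D > 0" "\<And>n i. i < d \<Longrightarrow> of_int D * coord (x ^ n) i \<in> \<int>"
proof -
  obtain p :: "int poly" where p: "poly (map_poly of_int p) x = 0" "lead_coeff p = 1"
    using assms by (auto simp: algebraic_int_altdef_ipoly)
  define m where "m = degree p"
  define a where "a = coeff p"
  have rel: "x ^ m = - (\<Sum>k<m. of_int (a k) * x ^ k)"
  proof -
    have "0 = (\<Sum>k\<le>m. of_int (a k) * x ^ k)"
      using p(1) by (simp add: poly_altdef m_def a_def degree_map_poly coeff_map_poly)
    also have "\<dots> = (\<Sum>k<m. of_int (a k) * x ^ k) + x ^ m"
      using p(2) by (simp add: a_def m_def flip: lessThan_Suc_atMost)
    finally show ?thesis by (simp add: eq_neg_iff_add_eq_0 add.commute)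
  qed
  obtain D :: int where D: "D > 0" "\<And>q. q \<in> (\<lambda>(n, i). coord (x ^ n) i) ` ({..<m} \<times> {..<d}) \<Longrightarrow> of_int D * q \<in> \<int>"
    by (rule common_denominator[of "(\<lambda>(n, i). coord (x ^ n) i) ` ({..<m} \<times> {..<d})"]) auto
  have "of_int D * coord (x ^ n) i \<in> \<int>" if i: "i < d" for n i
  proof (induction n rule: less_induct)
    case (less n)
    show ?case
    proof (cases "n < m")
      case True
      then show ?thesis using D(2) i by auto
    next
      case False
      then have "x ^ n = x ^ (n - m) * x ^ m" by (simp flip: power_add)
      also have "\<dots> = - (\<Sum>k<m. of_int (a k) * x ^ (n - m + k))"
        by (simp add: rel sum_distrib_left power_add algebra_simps)
      finally have "of_int D * coord (x ^ n) i = - (\<Sum>k<m. of_int (a k) * (of_int D * coord (x ^ (n - m + k)) i))"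
        by (simp add: coord_uminus coord_sum coord_scale_int i sum_distrib_left algebra_simps)
      also have "\<dots> \<in> \<int>"
        by (intro Ints_minus Ints_sum Ints_mult less) (use False in auto)
      finally show ?thesis .
    qed
  qed
  with D(1) that show ?thesis by blast
qed

text \<open>
  With this radius \<open>\<epsilon>\<close> one has \<open>mult_const \<cdot> \<epsilon> = 1/2\<close>, so multiplying by an element whose
  coordinates are at most \<open>\<epsilon>\<close> at least halves the bound on the coordinates.
\<close>
definition discreteness_radius :: rat where
  "discreteness_radius = 1 / (2 * of_nat mult_const)"

lemma discreteness_radius_pos: "discreteness_radius > 0"
  using mult_const_pos by (simp add: discreteness_radius_def)

text \<open>
  The coordinates of \<open>x\<^sup>n\<close> tend to \<open>0\<close> while their denominators stay bounded, so some power
  of \<open>x\<close> vanishes.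
\<close>
lemma small_algebraic_int_eq_zero:
  assumes "algebraic_int x" "\<And>i. i < d \<Longrightarrow> \<bar>coord x i\<bar> \<le> discreteness_radius"
  shows "x = 0"
proof -
  let ?e = discreteness_radius
  have C: "mult_const > 0" by (rule mult_const_pos)
  have small: "\<bar>coord (x ^ Suc n) i\<bar> \<le> ?e * (1/2) ^ n" if "i < d" for n i
    using that
  proof (induction n arbitrary: i)
    case 0
    then show ?case using assms(2) by simp
  next
    case (Suc n)
    have "\<bar>coord (x ^ Suc n * x) i\<bar> \<le> of_nat mult_const * (?e * (1/2) ^ n) * ?e"
      by (rule coord_mult_bound[OF Suc.IH assms(2) Suc.prems])
    also have "\<dots> = ?e * (1/2) ^ Suc n" using C by (simp add: discreteness_radius_def)
    finally show ?case by (simp add: mult.commute)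
  qed
  obtain D :: int where D: "D > 0" "\<And>n i. i < d \<Longrightarrow> of_int D * coord (x ^ n) i \<in> \<int>"
    by (rule bounded_denominator_powers[OF assms(1)]) blast
  obtain n where n: "(1/2 :: rat) ^ n < 1 / (of_int D * ?e)"
  proof -
    obtain n where "of_int D * ?e < of_nat n" using reals_Archimedean2 by blast
    also have "of_nat n < (2::rat) ^ n" by (rule of_nat_less_two_power)
    finally have "of_int D * ?e < (2::rat) ^ n" .
    moreover have "of_int D * ?e > 0" using D discreteness_radius_pos by simp
    ultimately show ?thesis by (intro that[of n]) (simp add: power_one_over frac_less2)
  qed
  have "coord (x ^ Suc n) i = 0" if i: "i < d" for i
  proof -
    have "\<bar>of_int D * coord (x ^ Suc n) i\<bar> = of_int D * \<bar>coord (x ^ Suc n) i\<bar>" using D(1) by (simp add: abs_mult)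
    also have "\<dots> \<le> of_int D * (?e * (1/2) ^ n)"
      using small[OF i, of n] D(1) by (intro mult_left_mono) auto
    also have "\<dots> = of_int D * ?e * (1/2) ^ n" by simp
    also have "\<dots> < of_int D * ?e * (1 / (of_int D * ?e))"
      using n D(1) discreteness_radius_pos by (intro mult_strict_left_mono) auto
    also have "\<dots> = 1" using D(1) discreteness_radius_pos by simp
    finally have "\<bar>of_int D * coord (x ^ Suc n) i\<bar> < 1" .
    then have "of_int D * coord (x ^ Suc n) i = 0"
      using D(2)[OF i, of "Suc n"] by (metis Ints_nonzero_abs_less1)
    then show ?thesis using D(1) by simp
  qed
  then have "x ^ Suc n = 0" using eq_zero_iff_coord by blast
  then show ?thesis by (simp only: power_eq_0_iff)
qed

end

text \<open>
  The closure properties of the algebraic integers of a field, which hold as soon as they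
  form a ring in the sense of \<open>ring_of_integers\<close>.
\<close>
locale ring_of_algebraic_ints =
  fixes K :: "'k::field_char_0 itself"
  assumes algebraic_int_add: "algebraic_int (x::'k) \<Longrightarrow> algebraic_int y \<Longrightarrow> algebraic_int (x + y)"
    and algebraic_int_mult: "algebraic_int (x::'k) \<Longrightarrow> algebraic_int y \<Longrightarrow> algebraic_int (x * y)"
begin

lemma algebraic_int_diff: "algebraic_int (x::'k) \<Longrightarrow> algebraic_int y \<Longrightarrow> algebraic_int (x - y)"
  using algebraic_int_add[of x "- y"] by auto

lemma algebraic_int_sum: "(\<And>i. i \<in> S \<Longrightarrow> algebraic_int (f i :: 'k)) \<Longrightarrow> algebraic_int (\<Sum>i\<in>S. f i)"
  by (induction S rule: infinite_finite_induct) (auto intro: algebraic_int_add)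

end

locale algebraic_int_basis = rational_basis d b + ring_of_algebraic_ints "TYPE('k::field_char_0)"
  for d and b :: "nat \<Rightarrow> 'k::field_char_0" +
  assumes algebraic_int_basis: "algebraic_int (b i)"
begin

lemma algebraic_int_int_combination: "algebraic_int (\<Sum>i<d. of_int (z i) * b i)"
  by (intro algebraic_int_sum algebraic_int_mult algebraic_int_basis algebraic_int_of_int)

text \<open>
  Among the multiples \<open>0, x, \<dots>, N x\<close> of an algebraic integer, two agree up to a small error
  modulo the lattice spanned by \<open>b\<close>; by discreteness the error is \<open>0\<close>. So a positive
  multiple of \<open>x\<close> by some number at most \<open>N\<close> lies in that lattice, and \<open>N!\<close> works for all
  \<open>x\<close> at once.
\<close>
lemma bounded_denominator:
  obtains D :: int where "D > 0" "\<And>x i. algebraic_int x \<Longrightarrow> i < d \<Longrightarrow> of_int D * coord x i \<in> \<int>"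
proof -
  obtain k :: nat where k: "1 / discreteness_radius < of_nat k" using reals_Archimedean2 by blast
  have e0: "discreteness_radius > 0" by (rule discreteness_radius_pos)
  have k0: "k > 0" using k e0 by (cases k) (auto simp: not_less[symmetric])
  have ke: "1 / of_nat k < discreteness_radius" using k e0 k0 by (simp add: field_simps)
  define N where "N = k ^ d"
  have "of_int (fact N) * coord x i \<in> \<int>" if x: "algebraic_int x" and i: "i < d" for x i
  proof -
    define cell where "cell j = (\<lambda>i\<in>{..<d}. \<lfloor>of_nat k * frac (of_nat j * coord x i)\<rfloor>)" for j :: nat
    have "cell ` {..N} \<subseteq> {..<d} \<rightarrow>\<^sub>E {0..<int k}"
    proof (intro image_subsetI PiE_I)
      fix j i assume "i \<in> {..<d}"
      have "of_nat k * frac (of_nat j * coord x i) < of_nat k * 1"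
        using k0 by (intro mult_strict_left_mono frac_lt_1) auto
      then have "\<lfloor>of_nat k * frac (of_nat j * coord x i)\<rfloor> < int k" by (simp add: floor_less_iff)
      then show "cell j i \<in> {0..<int k}" using \<open>i \<in> {..<d}\<close> by (simp add: cell_def)
    qed (simp add: cell_def)
    moreover have "card ({..<d} \<rightarrow>\<^sub>E {0..<int k}) = N" by (simp add: card_PiE N_def)
    ultimately have "card (cell ` {..N}) \<le> N"
      by (metis card_mono finite_PiE finite_atLeastLessThan_int finite_lessThan)
    then have "\<not> inj_on cell {..N}" by (auto dest: card_image)
    then obtain j j' where j: "j < j'" "j' \<le> N" "cell j = cell j'"
      unfolding inj_on_def by (metis atMost_iff linorder_neqE_nat)
    define z where "z i = \<lfloor>of_nat j' * coord x i\<rfloor> - \<lfloor>of_nat j * coord x i\<rfloor>" for i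
    define y where "y = of_nat (j' - j) * x - (\<Sum>i<d. of_int (z i) * b i)"
    have cz: "coord (\<Sum>i<d. of_int (z i) * b i) i = of_int (z i)" if "i < d" for i
      by (rule coord_unique) (simp_all add: that)
    have cy: "coord y i = of_nat (j' - j) * coord x i - of_int (z i)" if "i < d" for i
      using that by (simp add: y_def coord_diff cz coord_scale_nat del: of_nat_diff)
    have "algebraic_int y" unfolding y_def
      by (intro algebraic_int_diff algebraic_int_mult x algebraic_int_of_nat algebraic_int_int_combination)
    then have "y = 0"
    proof (rule small_algebraic_int_eq_zero)
      fix i assume i: "i < d"
      let ?u = "frac (of_nat j * coord x i)" and ?v = "frac (of_nat j' * coord x i)"
      have "coord y i = ?v - ?u"
        using j(1) by (simp add: cy[OF i] z_def frac_def of_nat_diff algebra_simps)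
      moreover have "\<lfloor>of_nat k * ?u\<rfloor> = \<lfloor>of_nat k * ?v\<rfloor>"
        using fun_cong[OF j(3), of i] i by (simp add: cell_def)
      then have "\<bar>of_nat k * ?v - of_nat k * ?u\<bar> < 1" by linarith
      then have "of_nat k * \<bar>?v - ?u\<bar> < 1" by (simp add: abs_mult flip: right_diff_distrib)
      then have "\<bar>?v - ?u\<bar> < 1 / of_nat k" using k0 by (simp add: field_simps)
      ultimately show "\<bar>coord y i\<bar> \<le> discreteness_radius" using ke by simp
    qed
    then have "of_nat (j' - j) * coord x i = of_int (z i)" using cy[OF i] i by simp
    moreover have "(j' - j) dvd fact N" using j by (intro dvd_fact) auto
    then obtain c where "fact N = (j' - j) * c" by (elim dvdE)
    then have "of_int (fact N) = (of_nat c * of_nat (j' - j) :: rat)"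
      by (metis mult.commute of_int_fact of_nat_fact of_nat_mult)
    ultimately have "of_int (fact N) * coord x i = of_nat c * of_int (z i)" by (metis mult.assoc)
    then show ?thesis by simp
  qed
  then show ?thesis using that[of "fact N"] by simp
qed

text \<open>
  For each \<open>k\<close> choose, among the algebraic integers with vanishing coordinates beyond \<open>k\<close>,
  one whose \<open>k\<close>-th coordinate is positive and minimal; it exists because denominators are
  bounded. The minimality makes the \<open>k\<close>-th coordinate of any other such element an integral
  multiple of it, so these elements generate, and they are independent because they are in
  triangular form.
\<close>
theorem integral_basis_exists:
  obtains \<omega> :: "nat \<Rightarrow> 'k" where "rational_basis d \<omega>" "\<And>i. algebraic_int (\<omega> i)"
    "\<And>x. algebraic_int x \<Longrightarrow> \<exists>z. x = (\<Sum>i<d. of_int (z i) * \<omega> i)"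
proof -
  obtain D :: int where D: "D > 0" "\<And>x i. algebraic_int x \<Longrightarrow> i < d \<Longrightarrow> of_int D * coord x i \<in> \<int>"
    by (rule bounded_denominator) blast
  define V where "V k = {x. algebraic_int x \<and> (\<forall>i<d. k \<le> i \<longrightarrow> coord x i = 0)}" for k
  have "\<exists>w. w \<in> V (Suc k) \<and> coord w k > 0 \<and> (\<forall>y\<in>V (Suc k). 0 < coord y k \<longrightarrow> coord w k \<le> coord y k)"
    if k: "k < d" for k
  proof -
    let ?f = "\<lambda>x. nat \<lfloor>of_int D * coord x k\<rfloor>"
    let ?P = "\<lambda>x. x \<in> V (Suc k) \<and> coord x k > 0"
    have "?P (b k)" using k by (auto simp: V_def algebraic_int_basis coord_basis)
    then obtain w where w: "?P w" "\<And>y. ?P y \<Longrightarrow> ?f w \<le> ?f y"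
      using ex_has_least_nat[of ?P "b k" ?f] by blast
    have "coord w k \<le> coord y k" if y: "?P y" for y
    proof -
      obtain m n :: int where mn: "of_int D * coord w k = of_int m" "of_int D * coord y k = of_int n"
        using D(2) w(1) y k unfolding V_def by (metis (mono_tags, lifting) Ints_cases mem_Collect_eq)
      have "of_int D * coord y k > 0" "of_int D * coord w k > 0" using y w(1) D(1) by simp_all
      then have "m > 0" "n > 0" unfolding mn by simp_all
      then have "m \<le> n" using w(2)[OF y] mn by simp
      then have "of_int D * coord w k \<le> of_int D * coord y k" unfolding mn by simp
      then show ?thesis using D(1) by simp
    qed
    then show ?thesis using w(1) by blast
  qed
  then obtain w where w: "\<And>k. k < d \<Longrightarrow> w k \<in> V (Suc k)" "\<And>k. k < d \<Longrightarrow> coord (w k) k > 0"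
      "\<And>k y. k < d \<Longrightarrow> y \<in> V (Suc k) \<Longrightarrow> 0 < coord y k \<Longrightarrow> coord (w k) k \<le> coord y k"
    by metis
  have span: "\<exists>z. x = (\<Sum>i<k. of_int (z i) * w i)" if "k \<le> d" "x \<in> V k" for x k
    using that
  proof (induction k arbitrary: x)
    case 0
    then have "x = 0" using eq_zero_iff_coord by (auto simp: V_def)
    then show ?case by simp
  next
    case (Suc k)
    then have k: "k < d" by simp
    define n where "n = \<lfloor>coord x k / coord (w k) k\<rfloor>"
    define y where "y = x - of_int n * w k"
    have yV: "y \<in> V (Suc k)"
      using Suc.prems(2) w(1)[OF k] unfolding V_def y_def
      by (auto intro!: algebraic_int_diff algebraic_int_mult simp: coord_diff coord_scale_int)
    have cy: "coord y k = coord x k - of_int n * coord (w k) k"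
      by (simp add: y_def coord_diff coord_scale_int k)
    have "of_int n \<le> coord x k / coord (w k) k" "coord x k / coord (w k) k < of_int n + 1"
      using floor_correct[of "coord x k / coord (w k) k"] by (simp_all add: n_def)
    then have "0 \<le> coord y k" "coord y k < coord (w k) k"
      using w(2)[OF k] by (simp_all add: cy field_simps)
    then have "coord y k = 0" using w(3)[OF k yV] by force
    then have "y \<in> V k" using yV unfolding V_def
      by (auto simp: le_less Suc_le_eq)
    then obtain z where z: "y = (\<Sum>i<k. of_int (z i) * w i)" using Suc.IH k by fastforce
    have "x = (\<Sum>i<Suc k. of_int ((z(k := n)) i) * w i)"
      using z by (simp add: y_def algebra_simps)
    then show ?case by blast
  qed
  \<comment> \<open>Only the indices below \<open>d\<close> carry information; \<open>0\<close> makes every \<open>\<omega> i\<close> an algebraic integer.\<close>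
  define \<omega> where "\<omega> i = (if i < d then w i else 0)" for i
  have gen: "\<exists>z. x = (\<Sum>i<d. of_int (z i) * \<omega> i)" if "algebraic_int x" for x
    using span[of d x] that by (simp add: V_def \<omega>_def)
  have "rational_basis d \<omega>"
  proof
    fix x :: 'k
    obtain D :: int where D: "D > 0" "algebraic_int (of_int D * x)"
      using algebraic_imp_multiple_algebraic_int[OF algebraic] by blast
    obtain z where z: "of_int D * x = (\<Sum>i<d. of_int (z i) * \<omega> i)" using gen[OF D(2)] by blast
    have "x = inverse (of_int D) * (of_int D * x)" using D(1) by simp
    also have "\<dots> = (\<Sum>i<d. of_rat (of_int (z i) / of_int D) * \<omega> i)"
      by (simp only: z sum_distrib_left) (simp add: of_rat_divide divide_simps)
    finally show "\<exists>q. x = (\<Sum>i<d. of_rat (q i) * \<omega> i)" by (rule exI[of _ "\<lambda>i. of_int (z i) / of_int D"])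
  next
    fix q :: "nat \<Rightarrow> rat" and i
    assume s: "(\<Sum>i<d. of_rat (q i) * \<omega> i) = 0" and i: "i < d"
    show "q i = 0"
    proof (rule ccontr)
      assume "q i \<noteq> 0"
      define S where "S = {i. i < d \<and> q i \<noteq> 0}"
      have S: "finite S" "S \<noteq> {}" using i \<open>q i \<noteq> 0\<close> by (auto simp: S_def)
      define k where "k = Max S"
      have kS: "k \<in> S" unfolding k_def using S by (rule Max_in)
      then have k: "k < d" "q k \<noteq> 0" by (auto simp: S_def)
      have z: "q j * coord (\<omega> j) k = 0" if "j < d" "j \<noteq> k" for j
      proof (cases "j < k")
        case True
        then show ?thesis using w(1)[of j] that k by (auto simp: V_def \<omega>_def)
      next
        case False
        then have "j \<notin> S" using that Max_ge[OF S(1), of j] k_def by auto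
        then show ?thesis using that by (simp add: S_def)
      qed
      have "0 = coord (\<Sum>i<d. of_rat (q i) * \<omega> i) k" using s k by simp
      also have "\<dots> = (\<Sum>j<d. q j * coord (\<omega> j) k)" by (simp add: coord_sum coord_scale k)
      also have "\<dots> = q k * coord (\<omega> k) k"
        using sum.remove[of "{..<d}" k "\<lambda>j. q j * coord (\<omega> j) k"] k z by simp
      finally show False using k w(2)[of k] by (simp add: \<omega>_def)
    qed
  qed
  moreover have "algebraic_int (\<omega> i)" for i using w(1)[of i] by (simp add: \<omega>_def V_def)
  ultimately show ?thesis using gen by (rule that)
qed

end

section \<open>Complex embeddings\<close>

lemma additive_scale_rat:
  fixes f :: "'k::field_char_0 \<Rightarrow> complex"
  assumes add: "\<And>y z. f (y + z) = f y + f z"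
  shows "f (of_rat q * y) = of_rat q * f y"
proof -
  have f0: "f 0 = 0" using add[of 0 0] by simp
  have fm: "f (- y) = - f y" for y using add[of y "- y"] f0 by (simp add: add_eq_0_iff)
  have fn: "f (of_nat n * y) = of_nat n * f y" for n y
    by (induction n) (simp_all add: f0 add algebra_simps)
  have fi: "f (of_int n * y) = of_int n * f y" for n y
  proof (cases n rule: int_diff_cases)
    case (diff k l)
    have "f (of_int n * y) = f (of_nat k * y + - (of_nat l * y))" by (simp add: diff left_diff_distrib)
    also have "\<dots> = of_int n * f y" by (simp only: add fm fn) (simp add: diff left_diff_distrib)
    finally show ?thesis .
  qed
  obtain a b where ab: "b > 0" "q = of_int a / of_int b"
    by (metis Fract_of_int_quotient Rat_cases)
  have "of_int b * f (of_rat q * y) = f (of_int b * (of_rat q * y))" by (rule fi[symmetric])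
  also have "of_int b * (of_rat q * y) = of_int a * y" using ab by (simp add: of_rat_divide)
  also have "f (of_int a * y) = of_int a * f y" by (rule fi)
  finally have "f (of_rat q * y) = of_int a / of_int b * f y" using ab(1) by (simp add: eq_divide_eq mult.commute)
  then show ?thesis by (simp add: ab(2) of_rat_divide)
qed

context rational_basis begin

text \<open>
  An additive map \<open>f\<close> generates, under the operator \<open>g \<mapsto> (y \<mapsto> g (x y))\<close>, a space on which
  this operator is annihilated by a polynomial. If \<open>q\<close> has least degree with \<open>q\<close>
  annihilating \<open>f\<close> and \<open>c\<close> is a complex root of \<open>q\<close>, the quotient of \<open>q\<close> by the linear
  factor sends \<open>f\<close> to an eigenvector for \<open>c\<close>. All such operators commute, so eigenvector
  equations that already hold for \<open>f\<close> survive.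
\<close>
lemma eigenfunction_step:
  fixes f :: "'k \<Rightarrow> complex"
  assumes add: "\<And>y z. f (y + z) = f y + f z" and nz: "\<exists>y. f y \<noteq> 0"
  shows "\<exists>g c. (\<forall>y z. g (y + z) = g y + g z) \<and> (\<exists>y. g y \<noteq> 0) \<and> (\<forall>y. g (x * y) = c * g y) \<and>
    (\<forall>u e. (\<forall>y. f (u * y) = e * f y) \<longrightarrow> (\<forall>y. g (u * y) = e * g y))"
proof -
  define act where "act q y = (\<Sum>i\<le>degree q. coeff q i * f (x ^ i * y))" for q y
  have act_eq: "act q y = (\<Sum>i\<le>n. coeff q i * f (x ^ i * y))" if "degree q \<le> n" for q n y
    unfolding act_def using that by (intro sum.mono_neutral_left) (auto simp: coeff_eq_0)
  obtain p where p: "\<And>i. coeff p i \<in> \<int>" "p \<noteq> 0" "poly p x = 0"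
    using algebraic[of x] by (auto simp: algebraic_def)
  have "\<exists>z. \<forall>i. coeff p i = of_int (z i)"
  proof (rule choice, rule allI)
    show "\<exists>z. coeff p i = of_int z" for i using p(1)[of i] by (auto elim: Ints_cases)
  qed
  then obtain z :: "nat \<Rightarrow> int" where z: "\<And>i. coeff p i = of_int (z i)" by blast
  define P :: "complex poly" where "P = (\<Sum>i\<le>degree p. monom (of_int (z i)) i)"
  have cP: "coeff P i = of_int (z i)" for i
    using z[of i] by (auto simp: P_def coeff_sum not_le coeff_eq_0)
  have P0: "P \<noteq> 0" using p(2) z cP by (metis coeff_0 of_int_0_eq_iff poly_eqI)
  have dP: "degree P \<le> degree p" by (rule degree_le) (use cP z in \<open>metis coeff_eq_0 of_int_0_eq_iff\<close>)
  have sumf: "f (\<Sum>i\<in>S. h i) = (\<Sum>i\<in>S. f (h i))" for S :: "nat set" and h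
    using add add[of 0 0] by (induction S rule: infinite_finite_induct) simp_all
  have "act P y = 0" for y
  proof -
    have "act P y = (\<Sum>i\<le>degree p. f (of_int (z i) * (x ^ i * y)))"
      using additive_scale_rat[of f "of_int _", OF add] by (simp add: act_eq[OF dP] cP)
    also have "\<dots> = f (poly p x * y)"
      by (simp add: sumf[symmetric] poly_altdef z sum_distrib_right mult.assoc)
    finally show ?thesis using p(3) add[of 0 0] by simp
  qed
  then obtain q where q: "q \<noteq> 0" "\<And>y. act q y = 0"
      "\<And>q'. q' \<noteq> 0 \<Longrightarrow> (\<And>y. act q' y = 0) \<Longrightarrow> degree q \<le> degree q'"
    using ex_has_least_nat[of "\<lambda>q. q \<noteq> 0 \<and> (\<forall>y. act q y = 0)" P degree] P0 by blast
  have "degree q \<noteq> 0"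
  proof
    assume "degree q = 0"
    then have "act q y = coeff q 0 * f y" for y by (simp add: act_def)
    moreover have "coeff q 0 \<noteq> 0" using \<open>degree q = 0\<close> q(1) leading_coeff_0_iff by metis
    ultimately show False using nz q(2) by auto
  qed
  then have "\<not> constant (poly q)" by (simp add: constant_degree)
  then obtain c where "poly q c = 0" using fundamental_theorem_of_algebra by blast
  then obtain r where r: "q = [:- c, 1:] * r" using poly_eq_0_iff_dvd by (metis dvdE)
  have r0: "r \<noteq> 0" using r q(1) by auto
  have dq: "degree q = Suc (degree r)" unfolding r using r0 by (subst degree_mult_eq) auto
  show ?thesis
  proof (intro exI[of _ "act r"] exI[of _ c] conjI allI impI)
    show "act r (y + z) = act r y + act r z" for y z
      by (simp add: act_def add distrib_left sum.distrib)
    show "\<exists>y. act r y \<noteq> 0" using q(3)[OF r0] dq by auto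
    show "act r (u * y) = e * act r y" if "\<forall>y. f (u * y) = e * f y" for u e y
    proof -
      have "f (x ^ i * (u * y)) = e * f (x ^ i * y)" for i
        using that[rule_format, of "x ^ i * y"] by (simp add: mult_ac)
      then show ?thesis by (simp add: act_def sum_distrib_left mult_ac)
    qed
    show "act r (x * y) = c * act r y" for y
    proof -
      have cq: "coeff q i = (case i of 0 \<Rightarrow> 0 | Suc j \<Rightarrow> coeff r j) - c * coeff r i" for i
        unfolding r by (simp add: coeff_pCons split: nat.splits)
      have "0 = act q y" using q(2) by simp
      also have "\<dots> = (\<Sum>i\<le>Suc (degree r). (case i of 0 \<Rightarrow> 0 | Suc j \<Rightarrow> coeff r j) * f (x ^ i * y))
          - c * (\<Sum>i\<le>Suc (degree r). coeff r i * f (x ^ i * y))"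
        by (simp only: act_def dq cq left_diff_distrib sum_subtractf sum_distrib_left mult.assoc)
      also have "(\<Sum>i\<le>Suc (degree r). coeff r i * f (x ^ i * y)) = act r y"
        by (rule act_eq[symmetric]) simp
      also have "(\<Sum>i\<le>Suc (degree r). (case i of 0 \<Rightarrow> 0 | Suc j \<Rightarrow> coeff r j) * f (x ^ i * y)) = act r (x * y)"
        by (subst sum.atMost_Suc_shift) (simp add: act_def mult_ac)
      finally show ?thesis by simp
    qed
  qed
qed

text \<open>
  Starting from a coordinate function, make an additive map \<open>f\<close> into an eigenvector for
  every basis element, hence for every \<open>x\<close>. The eigenvalue \<open>\<tau> x\<close> given by
  \<open>f (x y) = \<tau> x \<cdot> f y\<close> is additive and multiplicative in \<open>x\<close>.
\<close>
theorem complex_embedding_exists: "\<exists>\<tau> :: 'k \<Rightarrow> complex. field_hom \<tau>"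
proof -
  have d0: "0 < d" using eq_zero_iff_coord[of 1] by (cases d) auto
  have "\<exists>f :: 'k \<Rightarrow> complex. (\<forall>y z. f (y + z) = f y + f z) \<and> (\<exists>y. f y \<noteq> 0) \<and>
      (\<forall>i<k. \<exists>c. \<forall>y. f (\<omega> i * y) = c * f y)" for k
  proof (induction k)
    case 0
    show ?case using d0
      by (intro exI[of _ "\<lambda>x. of_rat (coord x 0)"])
        (auto simp: coord_add of_rat_add coord_basis intro!: exI[of _ "\<omega> 0"])
  next
    case (Suc k)
    then obtain f :: "'k \<Rightarrow> complex" where f: "\<And>y z. f (y + z) = f y + f z" "\<exists>y. f y \<noteq> 0"
      "\<forall>i<k. \<exists>c. \<forall>y. f (\<omega> i * y) = c * f y" by blast
    obtain g c where g: "\<And>y z. g (y + z) = g y + g z" "\<exists>y. g y \<noteq> 0" "\<And>y. g (\<omega> k * y) = c * g y"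
      "\<And>u e. (\<forall>y. f (u * y) = e * f y) \<Longrightarrow> (\<forall>y. g (u * y) = e * g y)"
      using eigenfunction_step[of f "\<omega> k", OF f(1,2)] by blast
    show ?case
    proof (intro exI[of _ g] conjI allI impI)
      fix i assume "i < Suc k"
      then consider "i = k" | "i < k" by linarith
      then show "\<exists>c. \<forall>y. g (\<omega> i * y) = c * g y"
      proof cases
        case 2
        then show ?thesis using f(3) g(4) by metis
      qed (use g(3) in blast)
    qed (use g(1,2) in auto)
  qed
  then obtain f :: "'k \<Rightarrow> complex" where f: "\<And>y z. f (y + z) = f y + f z" "\<exists>y. f y \<noteq> 0"
    "\<forall>i<d. \<exists>c. \<forall>y. f (\<omega> i * y) = c * f y" by blast
  then obtain c where c: "\<And>i y. i < d \<Longrightarrow> f (\<omega> i * y) = c i * f y" by metis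
  have sumf: "f (\<Sum>i\<in>S. h i) = (\<Sum>i\<in>S. f (h i))" for S :: "nat set" and h
    using f(1) f(1)[of 0 0] by (induction S rule: infinite_finite_induct) simp_all
  define \<tau> where "\<tau> x = (\<Sum>i<d. of_rat (coord x i) * c i)" for x
  have \<tau>: "f (x * y) = \<tau> x * f y" for x y
  proof -
    have "f (x * y) = f (\<Sum>i<d. of_rat (coord x i) * (\<omega> i * y))"
      by (subst coord_expansion[of x]) (simp add: sum_distrib_right mult.assoc)
    also have "\<dots> = (\<Sum>i<d. of_rat (coord x i) * (c i * f y))"
      by (simp add: sumf additive_scale_rat[of f, OF f(1)] c)
    finally show ?thesis by (simp add: \<tau>_def sum_distrib_right mult.assoc)
  qed
  obtain y0 where y0: "f y0 \<noteq> 0" using f(2) by blast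
  have \<tau>_eqI: "\<tau> x = e" if "f (x * y0) = e * f y0" for x e using \<tau>[of x y0] that y0 by simp
  have "field_hom \<tau>"
  proof
    show "\<tau> 0 = 0" by (rule \<tau>_eqI) (use f(1)[of 0 0] in simp)
    show "\<tau> 1 = 1" by (rule \<tau>_eqI) simp
    show "\<tau> (x + y) = \<tau> x + \<tau> y" for x y by (rule \<tau>_eqI) (simp add: distrib_right f(1) \<tau>)
    show "\<tau> (x * y) = \<tau> x * \<tau> y" for x y by (rule \<tau>_eqI) (simp add: mult.assoc \<tau>)
  qed
  then show ?thesis by blast
qed

end

section \<open>Ideals and residue classes\<close>

text \<open>
  Apart from finitely many indices, each index counted up to \<open>x\<close> contributes at least \<open>1/x\<close>
  to a tail of the series, which is as small as desired.
\<close>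
lemma reciprocal_summable_sparse:
  fixes a :: "nat \<Rightarrow> nat"
  assumes pos: "\<And>i. a i > 0" and sm: "summable (\<lambda>i. 1 / real (a i))"
  shows "finite {i. real (a i) \<le> x}"
    and "\<epsilon> > 0 \<Longrightarrow> \<exists>x0. \<forall>x\<ge>x0. real (card {i. real (a i) \<le> x}) \<le> \<epsilon> * x"
proof -
  show fin: "finite {i. real (a i) \<le> x}" for x
  proof (cases "x > 0")
    case True
    have "(\<lambda>i. 1 / real (a i)) \<longlonglongrightarrow> 0" using sm by (rule summable_LIMSEQ_zero)
    then have "\<forall>\<^sub>F i in sequentially. 1 / real (a i) < 1 / x"
      by (rule order_tendstoD) (use True in simp)
    then obtain n where n: "\<And>i. i \<ge> n \<Longrightarrow> 1 / real (a i) < 1 / x"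
      by (auto simp: eventually_sequentially)
    have "{i. real (a i) \<le> x} \<subseteq> {..<n}"
    proof
      fix i assume i: "i \<in> {i. real (a i) \<le> x}"
      have "\<not> n \<le> i"
      proof
        assume "n \<le> i"
        from n[OF this] show False using i True pos[of i] by (simp add: field_simps)
      qed
      then show "i \<in> {..<n}" by simp
    qed
    then show ?thesis by (rule finite_subset) simp
  next
    case False
    have "x < real (a i)" for i using False pos[of i] by (meson le_less_trans not_less of_nat_0_less_iff)
    then have "{i. real (a i) \<le> x} = {}" by (auto simp: not_le)
    then show ?thesis by simp
  qed
  assume \<epsilon>: "\<epsilon> > 0"
  let ?f = "\<lambda>i. 1 / real (a i)"
  have "\<exists>M. norm (\<Sum>i. ?f (i + M)) < \<epsilon> / 2" using suminf_exist_split[OF _ sm, of "\<epsilon> / 2"] \<epsilon> by auto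
  then obtain M where "norm (\<Sum>i. ?f (i + M)) < \<epsilon> / 2" by blast
  then have M: "(\<Sum>i. ?f (i + M)) < \<epsilon> / 2" unfolding real_norm_def by linarith
  define x0 where "x0 = 2 * real M / \<epsilon> + 1"
  show "\<exists>x0. \<forall>x\<ge>x0. real (card {i. real (a i) \<le> x}) \<le> \<epsilon> * x"
  proof (intro exI[of _ x0] allI impI)
    fix x assume x: "x \<ge> x0"
    have "2 * real M / \<epsilon> \<ge> 0" using \<epsilon> by simp
    then have x1: "x > 0" "2 * real M / \<epsilon> \<le> x" using x unfolding x0_def by linarith+
    define P where "P = {i. real (a (i + M)) \<le> x}"
    have P: "finite P"
      using finite_vimageI[OF fin[of x], of "\<lambda>i. i + M"] by (simp add: P_def vimage_def)
    have sub: "{i. real (a i) \<le> x} \<subseteq> {..<M} \<union> (\<lambda>i. i + M) ` P"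
    proof
      fix i assume "i \<in> {i. real (a i) \<le> x}"
      then show "i \<in> {..<M} \<union> (\<lambda>i. i + M) ` P"
        by (cases "i < M") (auto simp: P_def image_iff intro!: exI[of _ "i - M"])
    qed
    have "card {i. real (a i) \<le> x} \<le> card ({..<M} \<union> (\<lambda>i. i + M) ` P)"
      by (rule card_mono[OF _ sub]) (use P in simp)
    also have "\<dots> \<le> M + card P"
      using card_Un_le[of "{..<M}" "(\<lambda>i. i + M) ` P"] card_image_le[OF P, of "\<lambda>i. i + M"] by simp
    finally have c: "real (card {i. real (a i) \<le> x}) \<le> real M + real (card P)" by simp
    have "real (card P) / x = (\<Sum>i\<in>P. 1 / x)" by simp
    also have "\<dots> \<le> (\<Sum>i\<in>P. ?f (i + M))"
      using pos x1 by (intro sum_mono) (auto simp: P_def frac_le)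
    also have "\<dots> \<le> (\<Sum>i. ?f (i + M))"
      using summable_ignore_initial_segment[OF sm, of M] by (intro sum_le_suminf) (auto simp: P)
    finally have "real (card P) / x \<le> \<epsilon> / 2" using M by linarith
    then have "real (card P) \<le> \<epsilon> / 2 * x" using x1 by (simp add: field_simps)
    moreover have "real M \<le> \<epsilon> / 2 * x" using x1 \<epsilon> by (simp add: field_simps)
    ultimately show "real (card {i. real (a i) \<le> x}) \<le> \<epsilon> * x" using c by simp
  qed
qed

definition integral_ideal :: "'k::field_char_0 set \<Rightarrow> bool" where
  "integral_ideal I \<longleftrightarrow> I \<subseteq> Collect algebraic_int \<and> 0 \<in> I \<and> (\<forall>x\<in>I. \<forall>y\<in>I. x - y \<in> I) \<and>
     (\<forall>x\<in>I. \<forall>a. algebraic_int a \<longrightarrow> a * x \<in> I)"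

definition residue_class :: "'k::field_char_0 set \<Rightarrow> 'k \<Rightarrow> 'k set" where
  "residue_class I x = {y. y - x \<in> I}"

definition residue_classes :: "'k::field_char_0 set \<Rightarrow> 'k set set" where
  "residue_classes I = residue_class I ` Collect algebraic_int"

lemma integral_ideal_diff: "integral_ideal I \<Longrightarrow> x \<in> I \<Longrightarrow> y \<in> I \<Longrightarrow> x - y \<in> I"
  by (simp add: integral_ideal_def)

lemma integral_ideal_uminus: "integral_ideal I \<Longrightarrow> x \<in> I \<Longrightarrow> - x \<in> I"
  using integral_ideal_diff[of I 0 x] by (simp add: integral_ideal_def)

lemma integral_ideal_add: "integral_ideal I \<Longrightarrow> x \<in> I \<Longrightarrow> y \<in> I \<Longrightarrow> x + y \<in> I"
  using integral_ideal_diff[of I x "- y"] integral_ideal_uminus[of I y] by simp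

lemma integral_ideal_mult: "integral_ideal I \<Longrightarrow> algebraic_int a \<Longrightarrow> x \<in> I \<Longrightarrow> a * x \<in> I"
  by (simp add: integral_ideal_def)

lemma integral_idealD: "integral_ideal I \<Longrightarrow> x \<in> I \<Longrightarrow> algebraic_int x"
  by (auto simp: integral_ideal_def)

lemma residue_class_eq_iff:
  assumes "integral_ideal I"
  shows "residue_class I x = residue_class I y \<longleftrightarrow> x - y \<in> I"
proof
  assume "residue_class I x = residue_class I y"
  moreover have "x \<in> residue_class I x" using assms by (simp add: residue_class_def integral_ideal_def)
  ultimately show "x - y \<in> I" by (simp add: residue_class_def)
next
  assume xy: "x - y \<in> I"
  have "z - x \<in> I \<longleftrightarrow> z - y \<in> I" for z
    using integral_ideal_add[OF assms _ xy, of "z - x"] integral_ideal_diff[OF assms _ xy, of "z - y"] by auto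
  then show "residue_class I x = residue_class I y" by (simp add: residue_class_def)
qed

lemma integral_ideal_Int: "integral_ideal I \<Longrightarrow> integral_ideal J \<Longrightarrow> integral_ideal (I \<inter> J)"
  by (auto simp: integral_ideal_def)

section \<open>Counting lattice points in residue classes\<close>

locale integral_basis = rational_basis d \<omega> + ring_of_algebraic_ints "TYPE('k::field_char_0)"
  for d and \<omega> :: "nat \<Rightarrow> 'k::field_char_0" +
  assumes algebraic_int_iff_coord: "algebraic_int (x::'k) \<longleftrightarrow> (\<forall>i<d. coord x i \<in> \<int>)"
begin

lemma degree_pos: "d > 0"
  using eq_zero_iff_coord[of 1] by (cases d) auto

definition coord_box :: "nat \<Rightarrow> 'k set" where
  "coord_box n = {x. algebraic_int x \<and> (\<forall>i<d. \<bar>coord x i\<bar> \<le> of_nat n)}"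

lemma coord_combination: "i < d \<Longrightarrow> coord (\<Sum>j<d. of_int (z j) * \<omega> j) i = of_int (z i)"
  by (rule coord_unique) simp_all

lemma bij_betw_coord_box:
  "bij_betw (\<lambda>z. \<Sum>i<d. of_int (z i) * \<omega> i) ({..<d} \<rightarrow>\<^sub>E {- int n..int n}) (coord_box n)"
proof (rule bij_betwI')
  fix y z assume "y \<in> {..<d} \<rightarrow>\<^sub>E {- int n..int n}" "z \<in> {..<d} \<rightarrow>\<^sub>E {- int n..int n}"
  then show "(\<Sum>i<d. of_int (y i) * \<omega> i) = (\<Sum>i<d. of_int (z i) * \<omega> i) \<longleftrightarrow> y = z"
    by (metis (mono_tags, lifting) PiE_ext coord_combination lessThan_iff of_int_eq_iff)
next
  fix z assume z: "z \<in> {..<d} \<rightarrow>\<^sub>E {- int n..int n}"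
  have "\<bar>of_int (z i) :: rat\<bar> \<le> of_nat n" if "i < d" for i
  proof -
    have "\<bar>z i\<bar> \<le> int n" using PiE_mem[OF z, of i] that by auto
    then have "of_int \<bar>z i\<bar> \<le> (of_int (int n) :: rat)" by (simp only: of_int_le_iff)
    then show ?thesis by simp
  qed
  then show "(\<Sum>i<d. of_int (z i) * \<omega> i) \<in> coord_box n"
    by (simp add: coord_box_def coord_combination algebraic_int_iff_coord)
next
  fix x assume x: "x \<in> coord_box n"
  define z where "z = (\<lambda>i\<in>{..<d}. \<lfloor>coord x i\<rfloor>)"
  have c: "coord x i = of_int (z i)" if "i < d" for i
    using x that by (auto simp: z_def coord_box_def algebraic_int_iff_coord elim!: Ints_cases)
  have "\<bar>z i\<bar> \<le> int n" if "i < d" for i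
  proof -
    have "\<bar>coord x i\<bar> \<le> of_nat n" using x that by (simp add: coord_box_def)
    then have "of_int \<bar>z i\<bar> \<le> (of_int (int n) :: rat)" unfolding c[OF that] by simp
    then show ?thesis by (simp only: of_int_le_iff)
  qed
  then have "z \<in> {..<d} \<rightarrow>\<^sub>E {- int n..int n}"
  proof (intro PiE_I)
    fix i assume "i \<in> {..<d}"
    then have "\<bar>z i\<bar> \<le> int n" using \<open>\<And>i. i < d \<Longrightarrow> \<bar>z i\<bar> \<le> int n\<close> by simp
    then show "z i \<in> {- int n..int n}" unfolding atLeastAtMost_iff by linarith
  qed (simp add: z_def)
  moreover have "x = (\<Sum>i<d. of_int (z i) * \<omega> i)"
    by (subst coord_expansion) (simp add: c)
  ultimately show "\<exists>z\<in>{..<d} \<rightarrow>\<^sub>E {- int n..int n}. x = (\<Sum>i<d. of_int (z i) * \<omega> i)" by blast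
qed

lemma card_coord_box: "card (coord_box n) = (2 * n + 1) ^ d"
proof -
  have "card (coord_box n) = card ({..<d} \<rightarrow>\<^sub>E {- int n..int n})"
    by (rule bij_betw_same_card[OF bij_betw_coord_box, symmetric])
  also have "\<dots> = card {- int n..int n} ^ d" by (simp only: card_PiE prod_constant card_lessThan finite_lessThan)
  also have "card {- int n..int n} = 2 * n + 1" unfolding card_atLeastAtMost_int by linarith
  finally show ?thesis .
qed

lemma finite_coord_box: "finite (coord_box n)"
  using bij_betw_finite[OF bij_betw_coord_box, of n] by (simp add: finite_PiE)

lemma coord_box_mono: "m \<le> n \<Longrightarrow> coord_box m \<subseteq> coord_box n"
  by (auto simp: coord_box_def intro: order_trans)

lemma coord_box_add: "x \<in> coord_box m \<Longrightarrow> y \<in> coord_box n \<Longrightarrow> x + y \<in> coord_box (m + n)"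
  by (auto simp: coord_box_def coord_add intro!: algebraic_int_add order_trans[OF abs_triangle_ineq] add_mono)

lemma coord_box_diff: "x \<in> coord_box m \<Longrightarrow> y \<in> coord_box n \<Longrightarrow> x - y \<in> coord_box (m + n)"
  by (auto simp: coord_box_def coord_diff intro!: algebraic_int_diff order_trans[OF abs_triangle_ineq4] add_mono)

lemma finite_subset_coord_box:
  assumes "finite Y" "Y \<subseteq> Collect algebraic_int"
  obtains n where "Y \<subseteq> coord_box n"
  using assms
proof (induction Y arbitrary: thesis rule: finite_induct)
  case empty
  then show ?case by blast
next
  case (insert x Y)
  then obtain n where n: "Y \<subseteq> coord_box n" by auto
  obtain m :: nat where m: "(\<Sum>i<d. \<bar>coord x i\<bar>) \<le> of_nat m" using real_arch_simple by blast
  have "x \<in> coord_box m"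
    using insert.prems(2) m by (auto simp: coord_box_def intro!: order_trans[OF member_le_sum m])
  then have "insert x Y \<subseteq> coord_box (max m n)" using n coord_box_mono[of m "max m n"] coord_box_mono[of n "max m n"] by auto
  then show ?case by (rule insert.prems(1))
qed

text \<open>
  Every \<open>z\<close> is congruent modulo \<open>w\<close> to \<open>w u\<close>, where \<open>u\<close> has the fractional parts of the
  coordinates of \<open>z / w\<close> as coordinates; so the residue classes are represented in a box of
  size \<open>mult_const \<cdot> m\<close>.
\<close>
lemma card_residue_classes_le:
  assumes J: "integral_ideal J" and w: "w \<in> J" "w \<noteq> 0" "w \<in> coord_box m"
  shows "finite (residue_classes J)" "card (residue_classes J) \<le> (3 * mult_const * m) ^ d"
proof -
  let ?M = "mult_const * m"
  have m: "m > 0"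
  proof (rule Nat.gr0I)
    assume "m = 0"
    then have "\<forall>i<d. coord w i = 0" using w(3) by (simp add: coord_box_def)
    then show False using w(2) eq_zero_iff_coord by blast
  qed
  have sub: "residue_classes J \<subseteq> residue_class J ` coord_box ?M"
  proof
    fix A assume "A \<in> residue_classes J"
    then obtain z where z: "algebraic_int z" "A = residue_class J z" by (auto simp: residue_classes_def)
    define q where "q = (\<Sum>i<d. of_int \<lfloor>coord (z / w) i\<rfloor> * \<omega> i)"
    define u where "u = z / w - q"
    have qi: "algebraic_int q" by (simp add: q_def algebraic_int_iff_coord coord_combination)
    have cu: "coord u i = frac (coord (z / w) i)" if "i < d" for i
      using that by (simp add: u_def q_def coord_diff coord_combination frac_def)
    have r: "z - q * w = w * u" using w(2) by (simp add: u_def field_simps)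
    have ai: "algebraic_int (z - q * w)"
      using z(1) qi integral_idealD[OF J w(1)] by (intro algebraic_int_diff algebraic_int_mult)
    have "\<bar>coord (w * u) i\<bar> \<le> of_nat mult_const * of_nat m * 1" if "i < d" for i
      using w(3) by (intro coord_mult_bound that) (auto simp: coord_box_def cu frac_lt_1 less_imp_le)
    then have "z - q * w \<in> coord_box ?M" using ai by (simp add: coord_box_def r)
    moreover have "z - (z - q * w) \<in> J" using integral_ideal_mult[OF J qi w(1)] by simp
    then have "A = residue_class J (z - q * w)" using z(2) residue_class_eq_iff[OF J] by simp
    ultimately show "A \<in> residue_class J ` coord_box ?M" by blast
  qed
  then show "finite (residue_classes J)" by (rule finite_subset) (simp add: finite_coord_box)
  have "card (residue_classes J) \<le> card (coord_box ?M)" by (rule surj_card_le[OF finite_coord_box sub])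
  also have "\<dots> \<le> (3 * ?M) ^ d"
    unfolding card_coord_box using m mult_const_pos by (intro power_mono) (auto simp: Suc_le_eq)
  finally show "card (residue_classes J) \<le> (3 * mult_const * m) ^ d" by (simp add: mult.assoc)
qed

lemma card_residue_classes_pos:
  "finite (residue_classes (J :: 'k set)) \<Longrightarrow> card (residue_classes J) > 0"
  by (auto simp: card_gt_0_iff residue_classes_def intro: exI[of _ 0])

text \<open>
  By \<open>card_residue_classes_le\<close>, distinct points of \<open>P\<close> differ in some coordinate by at least
  \<open>m\<close>, where \<open>(3 \<cdot> mult_const \<cdot> m)\<^sup>d = N(J)\<close>. So each cube of side \<open>m\<close> contains at most one
  of them.
\<close>
lemma packing_bound:
  assumes J: "integral_ideal J" and fin: "finite (residue_classes J)"
    and P: "P \<subseteq> coord_box n" "\<And>x y. x \<in> P \<Longrightarrow> y \<in> P \<Longrightarrow> x - y \<in> J"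
  shows "real (card P) \<le> 4 ^ d * (1 + real (3 * mult_const * n) ^ d / real (card (residue_classes J)))"
proof -
  define N where "N = card (residue_classes J)"
  define C where "C = 3 * mult_const"
  define m where "m = root d (real N) / real C"
  have N: "N > 0" using card_residue_classes_pos[OF fin] by (simp add: N_def)
  have C: "C > 0" using mult_const_pos by (simp add: C_def)
  have m: "m > 0" using N C degree_pos by (simp add: m_def)
  have mN: "(real C * m) ^ d = real N" using C degree_pos by (simp add: m_def)
  define c where "c x i = (of_rat (coord x i) :: real)" for x i
  define cell where "cell x = (\<lambda>i\<in>{..<d}. \<lfloor>c x i / m\<rfloor>)" for x
  have inj: "inj_on cell P"
  proof (rule inj_onI, rule ccontr)
    fix x y assume xy: "x \<in> P" "y \<in> P" "cell x = cell y" "x \<noteq> y"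
    define w where "w = x - y"
    have wJ: "w \<in> J" "w \<noteq> 0" using xy P(2) by (auto simp: w_def)
    have "\<bar>coord w i\<bar> \<le> of_nat (nat (\<lceil>m\<rceil> - 1))" if i: "i < d" for i
    proof -
      have "\<lfloor>c x i / m\<rfloor> = \<lfloor>c y i / m\<rfloor>" using fun_cong[OF xy(3), of i] i by (simp add: cell_def)
      then have "\<bar>c x i / m - c y i / m\<bar> < 1" by linarith
      then have "\<bar>c x i - c y i\<bar> < m" using m by (simp add: field_simps flip: diff_divide_distrib)
      then have lt: "\<bar>c w i\<bar> < m" by (simp add: c_def w_def coord_diff i of_rat_diff)
      obtain z :: int where z: "coord w i = of_int z"
        using integral_idealD[OF J wJ(1)] i by (auto simp: algebraic_int_iff_coord elim: Ints_cases)
      have "real_of_int \<bar>z\<bar> < m" using lt by (simp add: c_def z)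
      then have "\<bar>z\<bar> \<le> \<lceil>m\<rceil> - 1" by linarith
      then have "\<bar>z\<bar> \<le> int (nat (\<lceil>m\<rceil> - 1))" by linarith
      then have "(of_int \<bar>z\<bar> :: rat) \<le> of_int (int (nat (\<lceil>m\<rceil> - 1)))" by (simp only: of_int_le_iff)
      then show ?thesis by (simp only: z of_int_of_nat_eq of_int_abs)
    qed
    then have wb: "w \<in> coord_box (nat (\<lceil>m\<rceil> - 1))"
      using integral_idealD[OF J wJ(1)] by (simp add: coord_box_def)
    have "N \<le> (C * nat (\<lceil>m\<rceil> - 1)) ^ d"
      using card_residue_classes_le(2)[OF J wJ wb] by (simp add: N_def C_def)
    then have "real N \<le> (real C * real (nat (\<lceil>m\<rceil> - 1))) ^ d" by (metis of_nat_le_iff of_nat_mult of_nat_power)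
    also have "\<dots> < (real C * m) ^ d"
    proof (rule power_strict_mono)
      have "real (nat (\<lceil>m\<rceil> - 1)) < m" using m by linarith
      then show "real C * real (nat (\<lceil>m\<rceil> - 1)) < real C * m" using C by simp
    qed (use degree_pos in simp_all)
    finally show False using mN by simp
  qed
  define k where "k = \<lfloor>real n / m\<rfloor>"
  have k0: "k \<ge> 0" using m by (simp add: k_def)
  have "cell ` P \<subseteq> {..<d} \<rightarrow>\<^sub>E {- k - 1..k}"
  proof (intro image_subsetI PiE_I)
    fix x i assume x: "x \<in> P" and "i \<in> {..<d}"
    then have i: "i < d" by simp
    have "\<bar>coord x i\<bar> \<le> of_nat n" using P(1) x i by (auto simp: coord_box_def)
    then have "real_of_rat \<bar>coord x i\<bar> \<le> real_of_rat (of_nat n)" by (simp only: of_rat_less_eq)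
    then have "\<bar>c x i\<bar> \<le> real n" by (simp add: c_def)
    then have "- (real n / m) \<le> c x i / m" "c x i / m \<le> real n / m"
      using m by (auto simp: field_simps abs_le_iff)
    then show "cell x i \<in> {- k - 1..k}" using i unfolding cell_def k_def by simp linarith
  qed (simp add: cell_def)
  then have "card P \<le> card ({..<d} \<rightarrow>\<^sub>E {- k - 1..k})"
    by (metis card_image[OF inj] card_mono finite_PiE finite_atLeastAtMost_int finite_lessThan)
  also have "\<dots> = nat (2 * k + 2) ^ d" by (simp add: card_PiE algebra_simps)
  finally have "real (card P) \<le> real (nat (2 * k + 2) ^ d)" by (simp only: of_nat_le_iff)
  also have "\<dots> = (2 * real_of_int k + 2) ^ d" using k0 by simp
  also have "\<dots> \<le> (4 * max (real n / m) 1) ^ d"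
  proof (rule power_mono)
    have "real_of_int k \<le> real n / m" by (simp add: k_def)
    then show "2 * real_of_int k + 2 \<le> 4 * max (real n / m) 1" by linarith
  qed (use k0 in simp)
  also have "\<dots> \<le> 4 ^ d * (1 + (real n / m) ^ d)"
    using m by (simp add: power_mult_distrib max_def)
  also have "(real n / m) ^ d = real (C * n) ^ d / real N"
    using C m by (simp flip: mN) (simp add: power_mult_distrib power_divide)
  finally show ?thesis by (simp add: N_def C_def)
qed

text \<open>
  By the Chinese remainder theorem, a pair of residue classes modulo \<open>I\<close> and \<open>J\<close> comes from
  a residue class modulo the intersection.
\<close>
lemma card_residue_classes_Int_ge:
  assumes I: "integral_ideal I" and J: "integral_ideal J"
    and fin: "finite (residue_classes (I \<inter> J))"
    and co: "x \<in> I" "y \<in> J" "x + y = (1::'k)"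
  shows "card (residue_classes I) * card (residue_classes J) \<le> card (residue_classes (I \<inter> J))"
proof -
  let ?f = "\<lambda>A. (residue_class I (SOME a. a \<in> A), residue_class J (SOME a. a \<in> A))"
  have IJ: "integral_ideal (I \<inter> J)" by (rule integral_ideal_Int[OF I J])
  have "residue_classes I \<times> residue_classes J \<subseteq> ?f ` residue_classes (I \<inter> J)"
  proof safe
    fix A B assume "A \<in> residue_classes I" "B \<in> residue_classes J"
    then obtain a b where a: "algebraic_int a" "A = residue_class I a" and b: "algebraic_int b" "B = residue_class J b"
      by (auto simp: residue_classes_def)
    define z where "z = a * y + b * x"
    have xy: "y = 1 - x" "x = 1 - y" using co(3) by (auto simp: algebra_simps)
    have "z - a = (b - a) * x" unfolding z_def xy(1) by (simp add: algebra_simps)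
    then have za: "z - a \<in> I" using integral_ideal_mult[OF I algebraic_int_diff[OF b(1) a(1)] co(1)] by simp
    have "z - b = (a - b) * y" unfolding z_def xy(2) by (simp add: algebra_simps)
    then have zb: "z - b \<in> J" using integral_ideal_mult[OF J algebraic_int_diff[OF a(1) b(1)] co(2)] by simp
    let ?A = "residue_class (I \<inter> J) z"
    have "algebraic_int z" using algebraic_int_add[OF integral_idealD[OF I za] a(1)] by simp
    then have "?A \<in> residue_classes (I \<inter> J)" by (simp add: residue_classes_def)
    moreover have "(SOME a. a \<in> ?A) \<in> ?A"
      by (rule someI[of _ z]) (use IJ in \<open>simp add: residue_class_def integral_ideal_def\<close>)
    then have s: "(SOME a. a \<in> ?A) - z \<in> I" "(SOME a. a \<in> ?A) - z \<in> J" by (simp_all add: residue_class_def)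
    have "?f ?A = (A, B)"
      using integral_ideal_add[OF I s(1) za] integral_ideal_add[OF J s(2) zb]
      by (simp add: a(2) b(2) residue_class_eq_iff[OF I] residue_class_eq_iff[OF J])
    ultimately show "(A, B) \<in> ?f ` residue_classes (I \<inter> J)" by (intro rev_image_eqI) auto
  qed
  from surj_card_le[OF fin this] show ?thesis by (simp add: card_cartesian_product)
qed

text \<open>
  Each residue class can be translated into the class of \<open>t\<close> by one of finitely many
  representatives; for large \<open>n\<close> such a translation maps the box of size \<open>n\<close> into the box of
  size \<open>2 n\<close>. So no class has more points in the small box than that of \<open>t\<close> has in the large
  one, and the classes together cover the small box.
\<close>
lemma card_box_class_ge:
  assumes I: "integral_ideal I" and fin: "finite (residue_classes I)"
  obtains Q where "\<And>n t. n \<ge> Q \<Longrightarrow> algebraic_int t \<Longrightarrow>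
    n ^ d \<le> card (residue_classes I) * card {x \<in> coord_box (2 * n). x - t \<in> I}"
proof -
  have "\<exists>r. algebraic_int r \<and> A = residue_class I r" if "A \<in> residue_classes I" for A
    using that by (auto simp: residue_classes_def)
  then obtain rep where rep: "\<And>A. A \<in> residue_classes I \<Longrightarrow> algebraic_int (rep A)"
    "\<And>A. A \<in> residue_classes I \<Longrightarrow> A = residue_class I (rep A)" by metis
  obtain Q where Q: "rep ` residue_classes I \<subseteq> coord_box Q"
    by (rule finite_subset_coord_box[of "rep ` residue_classes I"]) (use fin rep in auto)
  have "n ^ d \<le> card (residue_classes I) * card {x \<in> coord_box (2 * n). x - t \<in> I}"
    if n: "n \<ge> Q" and t: "algebraic_int t" for n t
  proof -
    let ?T = "{x \<in> coord_box (2 * n). x - t \<in> I}"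
    have finT: "finite ?T" using finite_coord_box by simp
    have le: "card (A \<inter> coord_box n) \<le> card ?T" if A: "A \<in> residue_classes I" for A
    proof -
      define r where "r = rep (residue_class I (t - rep A))"
      have B: "residue_class I (t - rep A) \<in> residue_classes I"
        using t rep(1)[OF A] by (simp add: residue_classes_def algebraic_int_diff)
      have rb: "r \<in> coord_box n" using Q B coord_box_mono[OF n] by (auto simp: r_def)
      have rI: "t - rep A - r \<in> I"
        using rep(2)[OF B] residue_class_eq_iff[OF I] unfolding r_def by blast
      have "(\<lambda>x. x + r) ` (A \<inter> coord_box n) \<subseteq> ?T"
      proof safe
        fix x assume x: "x \<in> A" "x \<in> coord_box n"
        show "x + r \<in> coord_box (2 * n)" using coord_box_add[OF x(2) rb] by (simp add: mult_2)
        have "x - rep A \<in> I" using x(1) rep(2)[OF A] by (auto simp: residue_class_def)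
        from integral_ideal_diff[OF I this rI] show "x + r - t \<in> I" by (simp add: algebra_simps)
      qed
      then have "card ((\<lambda>x. x + r) ` (A \<inter> coord_box n)) \<le> card ?T" by (rule card_mono[OF finT])
      then show ?thesis by (simp add: card_image)
    qed
    have "coord_box n = (\<Union>A\<in>residue_classes I. A \<inter> coord_box n)"
    proof safe
      fix x assume "x \<in> coord_box n"
      then have "algebraic_int x" by (simp add: coord_box_def)
      moreover have "x \<in> residue_class I x" using I by (simp add: residue_class_def integral_ideal_def)
      ultimately show "x \<in> (\<Union>A\<in>residue_classes I. A \<inter> coord_box n)"
        using \<open>x \<in> coord_box n\<close> by (auto simp: residue_classes_def)
    qed
    then have "card (coord_box n) \<le> (\<Sum>A\<in>residue_classes I. card (A \<inter> coord_box n))"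
      using card_UN_le[OF fin, of "\<lambda>A. A \<inter> coord_box n"] by simp
    also have "\<dots> \<le> (\<Sum>A\<in>residue_classes I. card ?T)" by (intro sum_mono le)
    finally have "(2 * n + 1) ^ d \<le> card (residue_classes I) * card ?T" by (simp add: card_coord_box)
    moreover have "n ^ d \<le> (2 * n + 1) ^ d" by (intro power_mono) auto
    ultimately show ?thesis by linarith
  qed
  then show ?thesis by (rule that)
qed

end

section \<open>Sieving by coprime ideals\<close>

text \<open>
  What an Erdos family provides; \<open>card (residue_classes I)\<close> is the absolute norm of \<open>I\<close>.
\<close>
locale coprime_ideal_family = integral_basis d \<omega>
  for d and \<omega> :: "nat \<Rightarrow> 'k::field_char_0" +
  fixes \<bb> :: "nat \<Rightarrow> 'k set"
  assumes ideals: "integral_ideal (\<bb> i)" and nonzero: "\<exists>x\<in>\<bb> i. x \<noteq> 0"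
    and coprime: "i \<noteq> j \<Longrightarrow> \<exists>x\<in>\<bb> i. \<exists>y\<in>\<bb> j. x + y = 1"
    and summable_norms: "summable (\<lambda>i. 1 / real (card (residue_classes (\<bb> i))))"
begin

abbreviation N :: "nat \<Rightarrow> nat" where "N i \<equiv> card (residue_classes (\<bb> i))"

lemma finite_residue_classes_of_nonzero:
  assumes "integral_ideal I" "w \<in> I" "w \<noteq> 0"
  shows "finite (residue_classes (I :: 'k set))"
proof -
  obtain m where "{w} \<subseteq> coord_box m"
    by (rule finite_subset_coord_box[of "{w}"]) (use assms integral_idealD in auto)
  then show ?thesis using card_residue_classes_le(1)[OF assms] by simp
qed

lemma finite_residue_classes: "finite (residue_classes (\<bb> i))"
  using finite_residue_classes_of_nonzero[OF ideals] nonzero by blast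

lemma N_pos: "N i > 0"
  by (rule card_residue_classes_pos[OF finite_residue_classes])

lemma finite_N_le: "finite {i. real (N i) \<le> x}"
  by (rule reciprocal_summable_sparse(1)[OF N_pos summable_norms])

lemma finite_ideals_containing:
  assumes "x \<noteq> 0"
  shows "finite {i. x \<in> \<bb> i}"
proof (cases "algebraic_int x")
  case True
  obtain m where m: "{x} \<subseteq> coord_box m"
    by (rule finite_subset_coord_box[of "{x}"]) (use True in auto)
  have "{i. x \<in> \<bb> i} \<subseteq> {i. real (N i) \<le> real ((3 * mult_const * m) ^ d)}"
  proof
    fix i assume "i \<in> {i. x \<in> \<bb> i}"
    then have "N i \<le> (3 * mult_const * m) ^ d"
      using card_residue_classes_le(2)[OF ideals, of x i m] assms m by simp
    then show "i \<in> {i. real (N i) \<le> real ((3 * mult_const * m) ^ d)}" by (simp only: of_nat_le_iff mem_Collect_eq)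
  qed
  then show ?thesis by (rule finite_subset) (rule finite_N_le)
next
  case False
  then have "{i. x \<in> \<bb> i} = {}" using integral_idealD[OF ideals] by blast
  then show ?thesis by simp
qed

definition common :: "nat set \<Rightarrow> 'k set" where
  "common S = {x. algebraic_int x \<and> (\<forall>i\<in>S. x \<in> \<bb> i)}"

lemma integral_ideal_common: "integral_ideal (common S)"
  unfolding integral_ideal_def common_def
  using ideals by (auto simp: integral_ideal_def intro: algebraic_int_diff algebraic_int_mult)

lemma common_insert: "x \<in> common S \<Longrightarrow> y \<in> \<bb> k \<Longrightarrow> x * y \<in> common (insert k S)"
  using integral_ideal_mult[OF integral_ideal_common, of y x S] integral_ideal_mult[OF ideals, of x y k]
    integral_idealD[OF integral_ideal_common, of x S] integral_idealD[OF ideals, of y k]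
  by (auto simp: common_def mult.commute)

lemma common_nonzero:
  assumes "finite S"
  shows "\<exists>w\<in>common S. w \<noteq> 0"
  using assms
proof (induction S rule: finite_induct)
  case empty
  then show ?case by (auto simp: common_def intro: exI[of _ 1])
next
  case (insert k S)
  then obtain w v where "w \<in> common S" "w \<noteq> 0" "v \<in> \<bb> k" "v \<noteq> 0" using nonzero by blast
  then show ?case using common_insert[of w S v k] by (intro bexI[of _ "w * v"]) auto
qed

lemma common_coprime:
  assumes "finite S" "j \<notin> S"
  shows "\<exists>x\<in>common S. \<exists>y\<in>\<bb> j. x + y = 1"
  using assms
proof (induction S rule: finite_induct)
  case empty
  then show ?case using ideals[of j] by (intro bexI[of _ 1] bexI[of _ 0]) (auto simp: common_def integral_ideal_def)
next
  case (insert k S)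
  then obtain x1 y1 where 1: "x1 \<in> common S" "y1 \<in> \<bb> j" "x1 + y1 = 1" by auto
  obtain x2 y2 where 2: "x2 \<in> \<bb> k" "y2 \<in> \<bb> j" "x2 + y2 = 1" using coprime[of k j] insert.prems by auto
  have "x1 * x2 + (x1 * y2 + y1) = x1 * (x2 + y2) + y1" by (simp add: algebra_simps)
  then have "x1 * x2 + (x1 * y2 + y1) = 1" using 1 2 by simp
  moreover have "x1 * x2 \<in> common (insert k S)" by (rule common_insert[OF 1(1) 2(1)])
  moreover have "x1 * y2 + y1 \<in> \<bb> j"
    by (intro integral_ideal_add[OF ideals] integral_ideal_mult[OF ideals] 1 2
        integral_idealD[OF integral_ideal_common 1(1)])
  ultimately show ?case by blast
qed

lemma chinese_remainder:
  assumes "finite S" "\<And>i. i \<in> S \<Longrightarrow> algebraic_int (c i)"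
  shows "\<exists>t. algebraic_int t \<and> (\<forall>i\<in>S. t - c i \<in> \<bb> i)"
  using assms
proof (induction S rule: finite_induct)
  case empty
  then show ?case by (intro exI[of _ 0]) simp
next
  case (insert k S)
  then obtain u where u: "algebraic_int u" "\<forall>i\<in>S. u - c i \<in> \<bb> i" by auto
  obtain x y where xy: "x \<in> common S" "y \<in> \<bb> k" "x + y = 1" using common_coprime[OF insert.hyps] by blast
  have y: "y = 1 - x" and x: "x = 1 - y" using xy(3) by (auto simp: algebra_simps)
  have ck: "algebraic_int (c k)" using insert.prems by simp
  define t where "t = u * y + c k * x"
  have "t - u = (c k - u) * x" unfolding t_def y by (simp add: algebra_simps)
  then have tS: "t - u \<in> common S"
    using integral_ideal_mult[OF integral_ideal_common algebraic_int_diff[OF ck u(1)] xy(1)] by simp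
  have "t - c k = (u - c k) * y" unfolding t_def x by (simp add: algebra_simps)
  then have tk: "t - c k \<in> \<bb> k" using integral_ideal_mult[OF ideals algebraic_int_diff[OF u(1) ck] xy(2)] by simp
  have "t - c i \<in> \<bb> i" if "i \<in> S" for i
    using integral_ideal_add[OF ideals, of "t - u" i "u - c i"] tS u(2) that by (auto simp: common_def)
  moreover have "algebraic_int t"
    using algebraic_int_add[OF integral_idealD[OF integral_ideal_common tS] u(1)] by simp
  ultimately show ?case using tk by auto
qed

text \<open>
  Let \<open>I\<close> be the intersection of the ideals in \<open>S\<close>, of norm \<open>M\<close>. A box of size \<open>2 n\<close>
  contains at least \<open>n\<^sup>d / M\<close> points of the class of \<open>t\<^sub>0\<close> modulo \<open>I\<close>. For \<open>i \<notin> S\<close>, those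
  that are congruent to \<open>y\<close> modulo \<open>\<bb> i\<close> lie in one class of the intersection of \<open>I\<close> and
  \<open>\<bb> i\<close>, which has norm at least \<open>M \<cdot> N i\<close>, so there are at most \<open>A + A E n\<^sup>d / (M \<cdot> N i)\<close>
  of them. If one of them is different from \<open>y\<close>, then \<open>N i \<le> G n\<^sup>d\<close>, because its difference
  from \<open>y\<close> is a nonzero element of \<open>\<bb> i\<close> in a box of size \<open>3 n\<close>.

  For fixed \<open>S\<close> and large \<open>n\<close>, the terms \<open>A\<close> add up to \<open>o(n\<^sup>d)\<close>, because few norms are that
  small, and the others to at most \<open>m A E n\<^sup>d \<delta> / M\<close>, where \<open>\<delta>\<close> bounds a tail of the series.
  It is essential that \<open>A\<close> and \<open>E\<close> depend on the basis only: this allows \<open>K\<close> to be chosen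
  before \<open>S\<close>, and hence before \<open>M\<close>.
\<close>
theorem sieve:
  "\<exists>K. \<forall>Y S t\<^sub>0. finite Y \<longrightarrow> Y \<subseteq> Collect algebraic_int \<longrightarrow> card Y \<le> m \<longrightarrow> finite S \<longrightarrow> {..<K} \<subseteq> S \<longrightarrow> algebraic_int t\<^sub>0 \<longrightarrow>
     (\<exists>t. algebraic_int t \<and> (\<forall>i\<in>S. t - t\<^sub>0 \<in> \<bb> i) \<and> (\<forall>i. i \<notin> S \<longrightarrow> (\<forall>y\<in>Y. t - y \<notin> \<bb> i)))"
proof -
  define A :: real where "A = 4 ^ d"
  define E :: real where "E = real (3 * mult_const) ^ d * 2 ^ d"
  have A: "A > 0" and E: "E > 0" using mult_const_pos by (simp_all add: A_def E_def)
  \<comment> \<open>The choices of \<open>\<delta>\<close> and, below, \<open>\<epsilon>\<close> let each kind of error remove at most a quarter of the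
    available points; using \<open>Suc m\<close> avoids dividing by \<open>0\<close>.\<close>
  define \<delta> where "\<delta> = 1 / (4 * real (Suc m) * A * E)"
  have \<delta>: "\<delta> > 0" using A E by (simp add: \<delta>_def)
  let ?f = "\<lambda>i. 1 / real (N i)"
  obtain K where "norm (\<Sum>i. ?f (i + K)) < \<delta>"
    using suminf_exist_split[OF \<delta> summable_norms] by auto
  then have K: "(\<Sum>i. ?f (i + K)) < \<delta>" unfolding real_norm_def by linarith
  have tail: "(\<Sum>i\<in>J. ?f i) \<le> \<delta>" if "finite J" "J \<inter> {..<K} = {}" for J
  proof -
    have ge: "K \<le> i" if "i \<in> J" for i using that \<open>J \<inter> {..<K} = {}\<close> by (auto simp: not_less[symmetric])
    have "inj_on (\<lambda>i. i - K) J" by (rule inj_onI) (use ge in \<open>metis le_add_diff_inverse2\<close>)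
    then have "(\<Sum>i\<in>J. ?f i) = (\<Sum>i\<in>(\<lambda>i. i - K) ` J. ?f (i + K))"
      using ge by (simp add: sum.reindex)
    also have "\<dots> \<le> (\<Sum>i. ?f (i + K))"
      by (intro sum_le_suminf) (use that summable_ignore_initial_segment[OF summable_norms, of K] in auto)
    finally show ?thesis using K by simp
  qed
  show ?thesis
  proof (intro exI[of _ K] allI impI)
    fix Y :: "'k set" and S and t\<^sub>0 :: 'k
    assume Y: "finite Y" "Y \<subseteq> Collect algebraic_int" "card Y \<le> m"
      and S: "finite S" "{..<K} \<subseteq> S" and t\<^sub>0: "algebraic_int t\<^sub>0"
    define I where "I = common S"
    have I: "integral_ideal I" unfolding I_def by (rule integral_ideal_common)
    obtain w where w: "w \<in> I" "w \<noteq> 0" using common_nonzero[OF S(1)] I_def by auto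
    have finI: "finite (residue_classes I)" by (rule finite_residue_classes_of_nonzero[OF I w])
    define M where "M = card (residue_classes I)"
    have M: "M > 0" using card_residue_classes_pos[OF finI] by (simp add: M_def)
    obtain Q where Q: "\<And>n t. n \<ge> Q \<Longrightarrow> algebraic_int t \<Longrightarrow>
        n ^ d \<le> M * card {x \<in> coord_box (2 * n). x - t \<in> I}"
      unfolding M_def by (rule card_box_class_ge[OF I finI]) blast
    obtain Q' where Q': "Y \<subseteq> coord_box Q'" by (rule finite_subset_coord_box[OF Y(1,2)])
    define G where "G = real (9 * mult_const) ^ d"
    have G: "G > 0" using mult_const_pos by (simp add: G_def)
    define \<epsilon> where "\<epsilon> = 1 / (4 * real (Suc m) * A * G * real M)"
    have \<epsilon>: "\<epsilon> > 0" using A G M by (simp add: \<epsilon>_def)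
    obtain x0 where x0: "\<And>x. x \<ge> x0 \<Longrightarrow> real (card {i. real (N i) \<le> x}) \<le> \<epsilon> * x"
      using reciprocal_summable_sparse(2)[OF N_pos summable_norms \<epsilon>] by blast
    obtain n :: nat where n: "n \<ge> Q" "n \<ge> Q'" "n \<ge> 1" "G * real n \<ge> x0" "real n > 4 * real m * real M"
    proof -
      obtain n1 :: nat where n1: "x0 / G \<le> real n1" using real_arch_simple by blast
      obtain n2 :: nat where n2: "4 * real m * real M < real n2" using reals_Archimedean2 by blast
      define n where "n = Q + Q' + 1 + n1 + n2"
      have "x0 / G \<le> real n" using n1 by (simp add: n_def)
      then have "G * real n \<ge> x0" using G by (simp add: pos_divide_le_eq mult.commute)
      moreover have "real n > 4 * real m * real M" using n2 by (simp add: n_def)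
      ultimately show ?thesis by (intro that[of n]) (simp_all add: n_def)
    qed
    define X where "X = real n ^ d"
    have nX: "real n \<le> X" unfolding X_def using n(3) degree_pos by (intro self_le_power) auto
    have X: "X > 0" using nX n(3) by linarith
    define T where "T = {x \<in> coord_box (2 * n). x - t\<^sub>0 \<in> I}"
    have finT: "finite T" unfolding T_def using finite_coord_box by simp
    have "n ^ d \<le> M * card T" unfolding T_def by (rule Q[OF n(1) t\<^sub>0])
    then have "X \<le> real M * real (card T)" unfolding X_def by (metis of_nat_le_iff of_nat_mult of_nat_power)
    then have cT: "X / real M \<le> real (card T)" using M by (simp add: field_simps)
    define J where "J = {i. i \<notin> S \<and> real (N i) \<le> G * X}"
    have finJ: "finite J" by (rule finite_subset[OF _ finite_N_le[of "G * X"]]) (auto simp: J_def)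
    have "card J \<le> card {i. real (N i) \<le> G * X}"
      by (rule card_mono[OF finite_N_le]) (auto simp: J_def)
    moreover have "G * X \<ge> x0" using n(4) nX G by (smt (verit) mult_left_mono)
    ultimately have cJ: "real (card J) \<le> \<epsilon> * (G * X)" using x0 by fastforce
    define bad where "bad y i = {t \<in> T. t - y \<in> \<bb> i}" for y i
    have cbad: "real (card (bad y i)) \<le> A + A * E * X / real M * ?f i" if "i \<in> J" for y i
    proof -
      have i: "i \<notin> S" using that by (simp add: J_def)
      obtain x z where xz: "x \<in> I" "z \<in> \<bb> i" "x + z = 1" using common_coprime[OF S(1) i] I_def by auto
      obtain v where v: "v \<in> \<bb> i" "v \<noteq> 0" using nonzero by blast
      have II: "integral_ideal (I \<inter> \<bb> i)" by (rule integral_ideal_Int[OF I ideals])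
      have "w * v \<in> I \<inter> \<bb> i"
        using integral_ideal_mult[OF I integral_idealD[OF ideals v(1)] w(1)]
          integral_ideal_mult[OF ideals integral_idealD[OF I w(1)] v(1)] by (simp add: mult.commute)
      then have fin: "finite (residue_classes (I \<inter> \<bb> i))"
        using finite_residue_classes_of_nonzero[OF II] w v by simp
      define R where "R = card (residue_classes (I \<inter> \<bb> i))"
      have "M * N i \<le> R" unfolding M_def R_def by (rule card_residue_classes_Int_ge[OF I ideals fin xz])
      then have R: "real M * real (N i) \<le> real R" by (metis of_nat_le_iff of_nat_mult)
      have MN: "real M * real (N i) > 0" using M N_pos by simp
      have "real (card (bad y i)) \<le> 4 ^ d * (1 + real (3 * mult_const * (2 * n)) ^ d / real R)"
        unfolding R_def
      proof (rule packing_bound[OF II fin])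
        show "bad y i \<subseteq> coord_box (2 * n)" by (auto simp: bad_def T_def)
        fix a b assume ab: "a \<in> bad y i" "b \<in> bad y i"
        then have "a - t\<^sub>0 \<in> I" "b - t\<^sub>0 \<in> I" "a - y \<in> \<bb> i" "b - y \<in> \<bb> i" by (auto simp: bad_def T_def)
        then show "a - b \<in> I \<inter> \<bb> i"
          using integral_ideal_diff[OF I, of "a - t\<^sub>0" "b - t\<^sub>0"] integral_ideal_diff[OF ideals, of "a - y" i "b - y"] by simp
      qed
      also have "real (3 * mult_const * (2 * n)) ^ d = E * X"
      proof -
        have "real (3 * mult_const * (2 * n)) = real (3 * mult_const) * 2 * real n" by simp
        then show ?thesis by (simp only: E_def X_def power_mult_distrib)
      qed
      also have "4 ^ d * (1 + E * X / real R) \<le> A * (1 + E * X / (real M * real (N i)))"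
        unfolding A_def using E X R MN by (intro mult_left_mono add_left_mono divide_left_mono) (auto intro: less_le_trans)
      finally show ?thesis by (simp add: algebra_simps)
    qed
    have "\<not> T \<subseteq> Y \<union> (\<Union>y\<in>Y. \<Union>i\<in>J. bad y i)"
    proof
      assume sub: "T \<subseteq> Y \<union> (\<Union>y\<in>Y. \<Union>i\<in>J. bad y i)"
      have finU: "finite (\<Union>y\<in>Y. \<Union>i\<in>J. bad y i)" using Y finJ finT by (auto simp: bad_def)
      have "card T \<le> card Y + card (\<Union>y\<in>Y. \<Union>i\<in>J. bad y i)"
        using card_mono[OF _ sub] card_Un_le[of Y "\<Union>y\<in>Y. \<Union>i\<in>J. bad y i"] finU Y(1) by fastforce
      also have "\<dots> \<le> card Y + (\<Sum>y\<in>Y. \<Sum>i\<in>J. card (bad y i))"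
        by (intro add_left_mono order_trans[OF card_UN_le[OF Y(1)]] sum_mono card_UN_le[OF finJ])
      finally have "real (card T) \<le> real (card Y + (\<Sum>y\<in>Y. \<Sum>i\<in>J. card (bad y i)))" by (simp only: of_nat_le_iff)
      also have "\<dots> = real (card Y) + (\<Sum>y\<in>Y. \<Sum>i\<in>J. real (card (bad y i)))" by simp
      also have "\<dots> \<le> real (card Y) + (\<Sum>y\<in>Y. \<Sum>i\<in>J. A + A * E * X / real M * ?f i)"
        by (intro add_left_mono sum_mono cbad)
      also have "\<dots> = real (card Y) + real (card Y) * (A * real (card J) + A * E * X / real M * (\<Sum>i\<in>J. ?f i))"
        by (simp add: sum.distrib sum_distrib_left)
      also have "\<dots> \<le> real m + real (Suc m) * (A * (\<epsilon> * (G * X)) + A * E * X / real M * \<delta>)"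
      proof (intro add_mono mult_mono mult_left_mono)
        show "(\<Sum>i\<in>J. ?f i) \<le> \<delta>" by (rule tail[OF finJ]) (use S in \<open>auto simp: J_def\<close>)
      qed (use A E X cJ Y(3) \<delta> in \<open>auto intro!: add_nonneg_nonneg mult_nonneg_nonneg divide_nonneg_nonneg sum_nonneg\<close>)
      also have "real (Suc m) * (A * (\<epsilon> * (G * X)) + A * E * X / real M * \<delta>) = X / real M / 2"
      proof -
        define k where "k = real (Suc m)"
        have "k > 0" by (simp add: k_def)
        then show ?thesis using A E G M unfolding \<epsilon>_def \<delta>_def k_def[symmetric] by (simp add: field_simps)
      qed
      finally have "real (card T) \<le> real m + X / real M / 2" .
      then have "X / real M \<le> real m + X / real M / 2" using cT by (rule order_trans[rotated])
      moreover have "u \<le> 2 * v" if "u \<le> v + u / 2" for u v :: real using that by linarith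
      ultimately have "X / real M \<le> 2 * real m" by blast
      then have "X \<le> 2 * real m * real M" using M by (simp add: field_simps)
      also have "\<dots> \<le> 4 * real m * real M" by simp
      also have "\<dots> < real n" using n(5) .
      finally show False using nX by linarith
    qed
    then obtain t where t: "t \<in> T" "t \<notin> Y" "\<And>y i. y \<in> Y \<Longrightarrow> i \<in> J \<Longrightarrow> t \<notin> bad y i" by blast
    have tb: "t \<in> coord_box (2 * n)" "t - t\<^sub>0 \<in> I" using t(1) by (auto simp: T_def)
    show "\<exists>t. algebraic_int t \<and> (\<forall>i\<in>S. t - t\<^sub>0 \<in> \<bb> i) \<and> (\<forall>i. i \<notin> S \<longrightarrow> (\<forall>y\<in>Y. t - y \<notin> \<bb> i))"
    proof (intro exI[of _ t] conjI allI impI ballI)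
      show "algebraic_int t" using tb by (simp add: coord_box_def)
      show "t - t\<^sub>0 \<in> \<bb> i" if "i \<in> S" for i using tb(2) that by (simp add: I_def common_def)
      fix i y assume iy: "i \<notin> S" "y \<in> Y"
      show "t - y \<notin> \<bb> i"
      proof
        assume ty: "t - y \<in> \<bb> i"
        have "y \<in> coord_box n" using Q' iy(2) coord_box_mono[OF n(2)] by blast
        then have "t - y \<in> coord_box (3 * n)" using coord_box_diff[OF tb(1)] by fastforce
        moreover have "t - y \<noteq> 0" using t(2) iy(2) by auto
        ultimately have "N i \<le> (3 * mult_const * (3 * n)) ^ d"
          using card_residue_classes_le(2)[OF ideals ty] by blast
        then have "real (N i) \<le> real ((3 * mult_const * (3 * n)) ^ d)" by (simp only: of_nat_le_iff)
        also have "\<dots> = G * X"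
        proof -
          have "real (3 * mult_const * (3 * n)) = real (9 * mult_const) * real n" by simp
          then have "real ((3 * mult_const * (3 * n)) ^ d) = (real (9 * mult_const) * real n) ^ d"
            unfolding of_nat_power by (rule arg_cong)
          then show ?thesis by (simp only: G_def X_def power_mult_distrib)
        qed
        finally have "i \<in> J" using iy(1) by (simp add: J_def)
        then show False using t(3)[OF iy(2)] t(1) ty by (auto simp: bad_def)
      qed
    qed
  qed
qed

end

section \<open>The topology of the power set\<close>

lemma topspace_powerset_topology [simp]: "topspace (powerset_topology A) = Pow A"
  unfolding powerset_topology_def topspace_pullback_topology by auto

lemma openin_cylinder:
  assumes "finite F" "F \<subseteq> A"
  shows "openin (powerset_topology A) {V. V \<subseteq> A \<and> V \<inter> F = U \<inter> F}"
proof -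
  let ?P = "Pi\<^sub>E A (\<lambda>i. if i \<in> F then {i \<in> U} else UNIV)"
  have "openin (product_topology (\<lambda>_. discrete_topology (UNIV :: bool set)) A) ?P"
  proof (rule product_topology_basis)
    show "finite {i. (if i \<in> F then {i \<in> U} else UNIV) \<noteq> topspace (discrete_topology (UNIV :: bool set))}"
      by (rule finite_subset[OF _ assms(1)]) auto
  qed auto
  moreover have "{V. V \<subseteq> A \<and> V \<inter> F = U \<inter> F} = (\<lambda>U. \<lambda>x\<in>A. x \<in> U) -` ?P \<inter> Pow A"
    using assms(2) by (auto simp: PiE_iff split: if_splits)
  ultimately show ?thesis unfolding powerset_topology_def openin_pullback_topology by blast
qed

lemma openin_powerset_topology_iff:
  "openin (powerset_topology A) W \<longleftrightarrow> W \<subseteq> Pow A \<and>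
     (\<forall>U\<in>W. \<exists>F. finite F \<and> F \<subseteq> A \<and> (\<forall>V. V \<subseteq> A \<longrightarrow> V \<inter> F = U \<inter> F \<longrightarrow> V \<in> W))"
proof (intro iffI conjI ballI)
  assume o: "openin (powerset_topology A) W"
  show "W \<subseteq> Pow A" using openin_subset[OF o] by simp
  fix U assume U: "U \<in> W"
  obtain Q where Q: "openin (product_topology (\<lambda>_. discrete_topology (UNIV :: bool set)) A) Q"
    "W = (\<lambda>U. \<lambda>x\<in>A. x \<in> U) -` Q \<inter> Pow A"
    using o unfolding powerset_topology_def openin_pullback_topology by blast
  have "(\<lambda>x\<in>A. x \<in> U) \<in> Q" using U Q(2) by auto
  then obtain B where B: "finite {i \<in> A. B i \<noteq> UNIV}" "(\<lambda>x\<in>A. x \<in> U) \<in> Pi\<^sub>E A B" "Pi\<^sub>E A B \<subseteq> Q"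
    using Q(1) unfolding openin_product_topology_alt by auto
  show "\<exists>F. finite F \<and> F \<subseteq> A \<and> (\<forall>V. V \<subseteq> A \<longrightarrow> V \<inter> F = U \<inter> F \<longrightarrow> V \<in> W)"
  proof (intro exI[of _ "{i \<in> A. B i \<noteq> UNIV}"] conjI allI impI)
    fix V assume V: "V \<subseteq> A" "V \<inter> {i \<in> A. B i \<noteq> UNIV} = U \<inter> {i \<in> A. B i \<noteq> UNIV}"
    have "(x \<in> V) \<in> B x" if "x \<in> A" for x
    proof (cases "B x = UNIV")
      case False
      then have "x \<in> V \<longleftrightarrow> x \<in> U" using V(2) that by blast
      then show ?thesis using PiE_mem[OF B(2) that] that by simp
    qed simp
    then have "(\<lambda>x\<in>A. x \<in> V) \<in> Pi\<^sub>E A B" by auto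
    from subsetD[OF B(3) this] show "V \<in> W" unfolding Q(2) using V(1) by simp
  qed (use B in auto)
next
  assume W: "W \<subseteq> Pow A \<and>
     (\<forall>U\<in>W. \<exists>F. finite F \<and> F \<subseteq> A \<and> (\<forall>V. V \<subseteq> A \<longrightarrow> V \<inter> F = U \<inter> F \<longrightarrow> V \<in> W))"
  show "openin (powerset_topology A) W"
  proof (subst openin_subopen, intro ballI)
    fix U assume U: "U \<in> W"
    then obtain F where F: "finite F" "F \<subseteq> A" "\<forall>V. V \<subseteq> A \<longrightarrow> V \<inter> F = U \<inter> F \<longrightarrow> V \<in> W" using W by blast
    show "\<exists>T. openin (powerset_topology A) T \<and> U \<in> T \<and> T \<subseteq> W"
      by (intro exI[of _ "{V. V \<subseteq> A \<and> V \<inter> F = U \<inter> F}"] conjI openin_cylinder F(1,2)) (use U W F(3) in auto)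
  qed
qed

lemma in_closure_of_powerset_topology:
  assumes "\<And>V. V \<in> \<V> \<Longrightarrow> V \<subseteq> A"
  shows "U \<in> powerset_topology A closure_of \<V> \<longleftrightarrow>
    U \<subseteq> A \<and> (\<forall>F. finite F \<longrightarrow> F \<subseteq> A \<longrightarrow> (\<exists>V\<in>\<V>. V \<inter> F = U \<inter> F))"
proof
  assume U: "U \<in> powerset_topology A closure_of \<V>"
  then have UA: "U \<subseteq> A" by (simp add: in_closure_of)
  have "\<exists>V\<in>\<V>. V \<inter> F = U \<inter> F" if F: "finite F" "F \<subseteq> A" for F
  proof -
    have "U \<in> {V. V \<subseteq> A \<and> V \<inter> F = U \<inter> F}" using UA by simp
    with U openin_cylinder[OF F, of U] obtain V where "V \<in> \<V>" "V \<in> {V. V \<subseteq> A \<and> V \<inter> F = U \<inter> F}"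
      unfolding in_closure_of by metis
    then show ?thesis by blast
  qed
  then show "U \<subseteq> A \<and> (\<forall>F. finite F \<longrightarrow> F \<subseteq> A \<longrightarrow> (\<exists>V\<in>\<V>. V \<inter> F = U \<inter> F))" using UA by blast
next
  assume U: "U \<subseteq> A \<and> (\<forall>F. finite F \<longrightarrow> F \<subseteq> A \<longrightarrow> (\<exists>V\<in>\<V>. V \<inter> F = U \<inter> F))"
  show "U \<in> powerset_topology A closure_of \<V>"
    unfolding in_closure_of
  proof (intro conjI allI impI)
    show "U \<in> topspace (powerset_topology A)" using U by simp
    fix T assume T: "U \<in> T \<and> openin (powerset_topology A) T"
    then obtain F where F: "finite F" "F \<subseteq> A" "\<And>V. V \<subseteq> A \<Longrightarrow> V \<inter> F = U \<inter> F \<Longrightarrow> V \<in> T"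
      unfolding openin_powerset_topology_iff by blast
    then obtain V where "V \<in> \<V>" "V \<inter> F = U \<inter> F" using U by blast
    then show "\<exists>V. V \<in> \<V> \<and> V \<in> T" using F(3) assms by blast
  qed
qed

text \<open>
  The pointwise form of the description of continuous maps as sliding block codes: the
  finite window that decides whether \<open>x\<close> belongs to \<open>f U\<close> may depend on \<open>U\<close>.
\<close>
lemma continuous_map_powerset_iff:
  assumes X: "X \<subseteq> Pow A" and f: "f \<in> X \<rightarrow> X"
  shows "continuous_map (subtopology (powerset_topology A) X) (subtopology (powerset_topology A) X) f \<longleftrightarrow>
    (\<forall>U\<in>X. \<forall>x\<in>A. \<exists>F. finite F \<and> F \<subseteq> A \<and> (\<forall>V\<in>X. V \<inter> F = U \<inter> F \<longrightarrow> (x \<in> f V \<longleftrightarrow> x \<in> f U)))"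
    (is "?C \<longleftrightarrow> ?L")
proof
  have ts: "topspace (subtopology (powerset_topology A) X) = X" using X by auto
  {
    assume c: ?C
    show ?L
    proof (intro ballI)
      fix U x assume U: "U \<in> X" and x: "x \<in> A"
      let ?O = "{V. V \<subseteq> A \<and> V \<inter> {x} = f U \<inter> {x}}"
      have "openin (subtopology (powerset_topology A) X) {V \<in> topspace (subtopology (powerset_topology A) X). f V \<in> ?O \<inter> X}"
        by (rule openin_continuous_map_preimage[OF c])
          (use openin_cylinder[of "{x}" A "f U"] x in \<open>auto simp: openin_subtopology\<close>)
      then obtain T where T: "openin (powerset_topology A) T" "{V \<in> X. f V \<in> ?O \<inter> X} = T \<inter> X"
        unfolding openin_subtopology ts by blast
      have "U \<in> {V \<in> X. f V \<in> ?O \<inter> X}" using U f X by auto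
      then have "U \<in> T" using T(2) by blast
      then obtain F where F: "finite F" "F \<subseteq> A" "\<And>V. V \<subseteq> A \<Longrightarrow> V \<inter> F = U \<inter> F \<Longrightarrow> V \<in> T"
        using T(1) unfolding openin_powerset_topology_iff by blast
      show "\<exists>F. finite F \<and> F \<subseteq> A \<and> (\<forall>V\<in>X. V \<inter> F = U \<inter> F \<longrightarrow> (x \<in> f V \<longleftrightarrow> x \<in> f U))"
      proof (intro exI[of _ F] conjI F(1,2) ballI impI)
        fix V assume V: "V \<in> X" "V \<inter> F = U \<inter> F"
        then have "V \<in> {V \<in> X. f V \<in> ?O \<inter> X}" using F(3)[of V] T(2) X by blast
        then show "x \<in> f V \<longleftrightarrow> x \<in> f U" by blast
      qed
    qed
  }
  assume l: ?L
  show ?C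
    unfolding continuous_map ts
  proof (intro conjI allI impI)
    show "f ` X \<subseteq> X" using f by auto
    fix O' assume "openin (subtopology (powerset_topology A) X) O'"
    then obtain T where T: "openin (powerset_topology A) T" "O' = T \<inter> X" unfolding openin_subtopology by blast
    define T' where "T' = {V. V \<subseteq> A \<and> (\<exists>U\<in>X. f U \<in> T \<and> (\<exists>F. finite F \<and> F \<subseteq> A \<and> V \<inter> F = U \<inter> F \<and>
        (\<forall>V\<in>X. V \<inter> F = U \<inter> F \<longrightarrow> f V \<in> T)))}"
    have "openin (powerset_topology A) T'"
      unfolding openin_powerset_topology_iff
    proof (intro conjI ballI)
      show "T' \<subseteq> Pow A" by (auto simp: T'_def)
      fix V assume "V \<in> T'"
      then obtain U F where UF: "U \<in> X" "f U \<in> T" "finite F" "F \<subseteq> A" "V \<inter> F = U \<inter> F"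
        "\<forall>V\<in>X. V \<inter> F = U \<inter> F \<longrightarrow> f V \<in> T"
        unfolding T'_def mem_Collect_eq by (elim conjE bexE exE) (rule that)
      show "\<exists>F. finite F \<and> F \<subseteq> A \<and> (\<forall>V'. V' \<subseteq> A \<longrightarrow> V' \<inter> F = V \<inter> F \<longrightarrow> V' \<in> T')"
        using UF by (intro exI[of _ F]) (auto simp: T'_def)
    qed
    moreover have "{U \<in> X. f U \<in> O'} = T' \<inter> X"
    proof (intro equalityI subsetI)
      fix U assume "U \<in> {U \<in> X. f U \<in> O'}"
      then have U: "U \<in> X" "f U \<in> T" using T(2) by auto
      then obtain E where E: "finite E" "E \<subseteq> A" "\<And>V. V \<subseteq> A \<Longrightarrow> V \<inter> E = f U \<inter> E \<Longrightarrow> V \<in> T"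
        using T(1) unfolding openin_powerset_topology_iff by blast
      have "\<forall>x\<in>E. \<exists>F. finite F \<and> F \<subseteq> A \<and> (\<forall>V\<in>X. V \<inter> F = U \<inter> F \<longrightarrow> (x \<in> f V \<longleftrightarrow> x \<in> f U))"
        using bspec[OF l U(1)] E(2) by (meson subsetD)
      then obtain W where W: "\<And>x. x \<in> E \<Longrightarrow> finite (W x)" "\<And>x. x \<in> E \<Longrightarrow> W x \<subseteq> A"
        "\<And>x V. x \<in> E \<Longrightarrow> V \<in> X \<Longrightarrow> V \<inter> W x = U \<inter> W x \<Longrightarrow> (x \<in> f V \<longleftrightarrow> x \<in> f U)" by metis
      have "f V \<in> T" if V: "V \<in> X" "V \<inter> (\<Union>x\<in>E. W x) = U \<inter> (\<Union>x\<in>E. W x)" for V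
      proof (rule E(3))
        show "f V \<subseteq> A" using V f X by auto
        have "x \<in> f V \<longleftrightarrow> x \<in> f U" if "x \<in> E" for x
          by (rule W(3)[OF that V(1)]) (use V(2) that in blast)
        then show "f V \<inter> E = f U \<inter> E" by blast
      qed
      moreover have "finite (\<Union>x\<in>E. W x)" "(\<Union>x\<in>E. W x) \<subseteq> A" using E(1) W(1,2) by blast+
      ultimately have "U \<in> T'" using U X unfolding T'_def by (intro CollectI conjI bexI[of _ U] exI[of _ "\<Union>x\<in>E. W x"]) auto
      then show "U \<in> T' \<inter> X" using U by blast
    next
      fix V assume V: "V \<in> T' \<inter> X"
      then have "f V \<in> T" unfolding T'_def by blast
      then show "V \<in> {U \<in> X. f U \<in> O'}" using V T(2) f by auto
    qed
    ultimately show "openin (subtopology (powerset_topology A) X) {U \<in> X. f U \<in> O'}"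
      unfolding openin_subtopology by blast
  qed
qed

section \<open>Admissible sets in an abelian group\<close>

lemma (in comm_group) power_index_mem:
  assumes H: "subgroup H G" and fin: "finite (rcosets H)" and x: "x \<in> carrier G" and q: "card (rcosets H) dvd q"
  shows "x [^] (q::nat) \<in> H"
proof -
  have N: "H \<lhd> G" using H by (rule subgroup_imp_normal)
  interpret F: comm_group "G Mod H" by (rule abelian_FactGroup[OF H])
  have carrier: "carrier (G Mod H) = rcosets H" by (simp add: FactGroup_def)
  have pow: "(H #> x) [^]\<^bsub>G Mod H\<^esub> n = H #> (x [^] n)" for n :: nat
  proof (induction n)
    case 0
    then show ?case using subgroup.subset[OF H] by (simp add: FactGroup_def coset_mult_one)
  next
    case (Suc n)
    then show ?case using x by (simp add: FactGroup_def normal.rcos_sum[OF N])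
  qed
  have c: "H #> x \<in> carrier (G Mod H)" using x by (auto simp: FactGroup_def RCOSETS_def)
  obtain k where k: "q = card (carrier (G Mod H)) * k" using q unfolding carrier by (auto elim: dvdE)
  have "(H #> x) [^]\<^bsub>G Mod H\<^esub> q = \<one>\<^bsub>G Mod H\<^esub>"
    unfolding k F.nat_pow_pow[OF c, symmetric] F.power_order_eq_one[OF fin[folded carrier] c] by (rule F.nat_pow_one)
  then have "H #> (x [^] q) = \<one>\<^bsub>G Mod H\<^esub>" unfolding pow .
  then have "H #> (x [^] q) = H" by simp
  then show ?thesis using coset_join1[OF _ _ H] x by simp
qed

text \<open>
  All that the dynamics needs to know about the ideals inside the lattice. The assumption
  \<open>sieve\<close> finds an element in a prescribed residue class for the subgroups in \<open>S\<close> that is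
  not congruent to any element of \<open>Y\<close> for the others; its bound \<open>K\<close> depends only on the
  number of elements of \<open>Y\<close>.
\<close>
locale sieve_system = comm_group G for G (structure) +
  fixes L :: "nat \<Rightarrow> 'a set"
  assumes subgroups: "subgroup (L i) G"
    and finite_index: "finite (rcosets (L i))"
    and proper: "L i \<noteq> carrier G"
    and crt: "finite S \<Longrightarrow> (\<And>i. i \<in> S \<Longrightarrow> c i \<in> carrier G) \<Longrightarrow> \<exists>t\<in>carrier G. \<forall>i\<in>S. t \<otimes> inv c i \<in> L i"
    and finite_containing: "x \<in> carrier G \<Longrightarrow> x \<noteq> \<one> \<Longrightarrow> finite {i. x \<in> L i}"
    and finite_small_index: "finite {i. card (rcosets (L i)) \<le> n}"
    and infinite_powers: "q > 0 \<Longrightarrow> infinite ((\<lambda>x. x [^] (q::nat)) ` carrier G)"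
    and sieve: "\<exists>K. \<forall>Y S t\<^sub>0. finite Y \<longrightarrow> Y \<subseteq> carrier G \<longrightarrow> card Y \<le> m \<longrightarrow> finite S \<longrightarrow> {..<K} \<subseteq> S \<longrightarrow>
      t\<^sub>0 \<in> carrier G \<longrightarrow>
      (\<exists>t\<in>carrier G. (\<forall>i\<in>S. t \<otimes> inv t\<^sub>0 \<in> L i) \<and> (\<forall>i. i \<notin> S \<longrightarrow> (\<forall>y\<in>Y. t \<otimes> inv y \<notin> L i)))"
begin

definition cong :: "nat \<Rightarrow> 'a \<Rightarrow> 'a \<Rightarrow> bool" where
  "cong i x y \<longleftrightarrow> x \<otimes> inv y \<in> L i"

lemma cong_refl [simp]: "x \<in> carrier G \<Longrightarrow> cong i x x"
  using subgroup.one_closed[OF subgroups] by (simp add: cong_def)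

lemma cong_sym: "x \<in> carrier G \<Longrightarrow> y \<in> carrier G \<Longrightarrow> cong i x y \<Longrightarrow> cong i y x"
  using subgroup.m_inv_closed[OF subgroups, of "x \<otimes> inv y" i] by (simp add: cong_def inv_mult_group)

lemma cong_trans: "x \<in> carrier G \<Longrightarrow> y \<in> carrier G \<Longrightarrow> z \<in> carrier G \<Longrightarrow> cong i x y \<Longrightarrow> cong i y z \<Longrightarrow> cong i x z"
  using subgroup.m_closed[OF subgroups, of "x \<otimes> inv y" i "y \<otimes> inv z"]
  by (simp add: cong_def m_assoc inv_solve_left[of "inv z"] flip: m_assoc[of "inv y" y "inv z"])

lemma cong_mult: "x \<in> carrier G \<Longrightarrow> y \<in> carrier G \<Longrightarrow> z \<in> carrier G \<Longrightarrow> cong i (x \<otimes> z) (y \<otimes> z) \<longleftrightarrow> cong i x y"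
  by (simp add: cong_def inv_mult_group m_assoc flip: m_assoc[of z "inv z"])

lemma mem_rcos_iff: "x \<in> carrier G \<Longrightarrow> c \<in> carrier G \<Longrightarrow> x \<in> L i #> c \<longleftrightarrow> cong i x c"
  unfolding cong_def by (rule subgroup.rcos_module[OF subgroups]) (auto simp: is_group)

lemma rcos_eq_iff: "x \<in> carrier G \<Longrightarrow> y \<in> carrier G \<Longrightarrow> L i #> x = L i #> y \<longleftrightarrow> cong i x y"
  using mem_rcos_iff[of x y i] repr_independence[of x "L i" y] rcos_self[of x "L i"] subgroups by auto

definition index :: "nat \<Rightarrow> nat" where
  "index i = card (rcosets (L i))"

lemma index_pos: "index i > 0"
  using finite_index[of i] subgroup.subgroup_in_rcosets[OF subgroups[of i] is_group]
  by (auto simp: index_def card_gt_0_iff)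

lemma not_cong_exists: "x \<in> carrier G \<Longrightarrow> \<exists>c\<in>carrier G. \<not> cong i x c"
proof -
  assume x: "x \<in> carrier G"
  obtain z where z: "z \<in> carrier G" "z \<notin> L i" using proper[of i] subgroup.subset[OF subgroups[of i]] by auto
  have "\<not> cong i (z \<otimes> x) x" using z x by (simp add: cong_def m_assoc)
  then show ?thesis using z x cong_sym by blast
qed

lemma admissible_iff:
  "U \<in> admissible_sets G L \<longleftrightarrow> U \<subseteq> carrier G \<and> (\<forall>i. \<exists>c\<in>carrier G. \<forall>u\<in>U. \<not> cong i u c)"
proof -
  have "(\<exists>C\<in>rcosets (L i). U \<inter> C = {}) \<longleftrightarrow> (\<exists>c\<in>carrier G. \<forall>u\<in>U. \<not> cong i u c)" if "U \<subseteq> carrier G" for i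
    using that by (auto simp: RCOSETS_def disjoint_iff mem_rcos_iff subset_iff)
  then show ?thesis unfolding admissible_sets_def by auto
qed

lemma admissibleI:
  "U \<subseteq> carrier G \<Longrightarrow> (\<And>i. \<exists>c\<in>carrier G. \<forall>u\<in>U. \<not> cong i u c) \<Longrightarrow> U \<in> admissible_sets G L"
  by (simp add: admissible_iff)

lemma admissible_misses: "U \<in> admissible_sets G L \<Longrightarrow> \<exists>c\<in>carrier G. \<forall>u\<in>U. \<not> cong i u c"
  by (simp add: admissible_iff)

lemma admissible_subset: "U \<in> admissible_sets G L \<Longrightarrow> V \<subseteq> U \<Longrightarrow> V \<in> admissible_sets G L"
  unfolding admissible_iff by blast

lemma representatives:
  obtains R where "finite R" "R \<subseteq> carrier G" "card R = index i" "\<And>x. x \<in> carrier G \<Longrightarrow> \<exists>r\<in>R. cong i x r"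
proof -
  let ?rep = "\<lambda>C. SOME x. x \<in> carrier G \<and> C = L i #> x"
  have rep: "?rep C \<in> carrier G \<and> C = L i #> ?rep C" if "C \<in> rcosets (L i)" for C
    by (rule someI_ex) (use that in \<open>auto simp: RCOSETS_def\<close>)
  have inj: "inj_on ?rep (rcosets (L i))" by (rule inj_onI) (metis rep)
  show ?thesis
  proof (rule that[of "?rep ` (rcosets (L i))"])
    show "card (?rep ` (rcosets (L i))) = index i" using inj by (simp add: card_image index_def)
    fix x assume x: "x \<in> carrier G"
    then have C: "L i #> x \<in> rcosets (L i)" by (auto simp: RCOSETS_def)
    have "cong i x (?rep (L i #> x))" using rep[OF C] rcos_eq_iff[OF x] by blast
    then show "\<exists>r\<in>?rep ` (rcosets (L i)). cong i x r" using C by blast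
  qed (use finite_index rep in auto)
qed

lemma few_points_miss_class:
  assumes "finite U" "U \<subseteq> carrier G" "card U < index i"
  shows "\<exists>c\<in>carrier G. \<forall>u\<in>U. \<not> cong i u c"
proof (rule ccontr)
  assume "\<not> ?thesis"
  then have hit: "\<And>c. c \<in> carrier G \<Longrightarrow> \<exists>u\<in>U. cong i u c" by blast
  have "rcosets (L i) \<subseteq> (\<lambda>u. L i #> u) ` U"
  proof
    fix C assume "C \<in> rcosets (L i)"
    then obtain c where c: "c \<in> carrier G" "C = L i #> c" by (auto simp: RCOSETS_def)
    obtain u where u: "u \<in> U" "cong i u c" using hit[OF c(1)] by blast
    then have "L i #> u = C" using rcos_eq_iff[of u c i] c assms(2) by auto
    then show "C \<in> (\<lambda>u. L i #> u) ` U" using u(1) by blast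
  qed
  then have "index i \<le> card U" unfolding index_def by (rule surj_card_le[OF assms(1)])
  then show False using assms(3) by simp
qed

lemma finite_index_le: "finite {i. index i \<le> n}"
  using finite_small_index by (simp add: index_def)

lemma finite_cong: "x \<in> carrier G \<Longrightarrow> y \<in> carrier G \<Longrightarrow> x \<noteq> y \<Longrightarrow> finite {i. cong i x y}"
  unfolding cong_def by (rule finite_containing) (simp, metis inv_closed inv_equality inv_inv)

text \<open>
  A set that meets every coset of \<open>L i\<close> has a finite subset that does so, since the index is
  finite.
\<close>
lemma admissible_of_finite_subsets:
  assumes "U \<subseteq> carrier G" "\<And>V. finite V \<Longrightarrow> V \<subseteq> U \<Longrightarrow> V \<in> admissible_sets G L"
  shows "U \<in> admissible_sets G L"
proof (rule admissibleI[OF assms(1)], rule ccontr)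
  fix i assume "\<not> (\<exists>c\<in>carrier G. \<forall>u\<in>U. \<not> cong i u c)"
  then have hit: "\<exists>u\<in>U. cong i u c" if "c \<in> carrier G" for c using that by blast
  obtain R where R: "finite R" "R \<subseteq> carrier G" "card R = index i" "\<And>x. x \<in> carrier G \<Longrightarrow> \<exists>r\<in>R. cong i x r"
    by (rule representatives) blast
  have "\<forall>r\<in>R. \<exists>u\<in>U. cong i u r" using hit R(2) by blast
  then obtain f where f: "\<And>r. r \<in> R \<Longrightarrow> f r \<in> U" "\<And>r. r \<in> R \<Longrightarrow> cong i (f r) r" by metis
  have "f ` R \<in> admissible_sets G L" by (rule assms(2)) (use R f in auto)
  from admissible_misses[OF this, of i]
  obtain c where c: "c \<in> carrier G" "\<And>r. r \<in> R \<Longrightarrow> \<not> cong i (f r) c" by auto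
  obtain r where r: "r \<in> R" "cong i c r" using R(4)[OF c(1)] by blast
  have "f r \<in> carrier G" "r \<in> carrier G" using f(1)[OF r(1)] assms(1) R(2) r(1) by auto
  then have "cong i (f r) c"
    using f(2)[OF r(1)] cong_sym[OF c(1) _ r(2)] cong_trans[of "f r" r c i] c(1) by blast
  then show False using c(2)[OF r(1)] by blast
qed

lemma mem_translate_iff:
  assumes "U \<subseteq> carrier G" "t \<in> carrier G" "x \<in> carrier G"
  shows "x \<in> U #> t \<longleftrightarrow> x \<otimes> inv t \<in> U"
proof
  assume "x \<in> U #> t"
  then obtain u where "u \<in> U" "x = u \<otimes> t" by (auto simp: r_coset_def)
  then show "x \<otimes> inv t \<in> U" using assms by (auto simp: m_assoc)
next
  assume "x \<otimes> inv t \<in> U"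
  moreover have "x = (x \<otimes> inv t) \<otimes> t" using assms by (simp add: m_assoc)
  ultimately show "x \<in> U #> t" by (auto simp: r_coset_def)
qed

lemma translate_admissible:
  assumes "U \<in> admissible_sets G L" "t \<in> carrier G"
  shows "U #> t \<in> admissible_sets G L"
proof (rule admissibleI)
  have U: "U \<subseteq> carrier G" using assms(1) by (simp add: admissible_iff)
  show "U #> t \<subseteq> carrier G" using r_coset_subset_G[OF U assms(2)] .
  fix i
  obtain c where c: "c \<in> carrier G" "\<forall>u\<in>U. \<not> cong i u c" using admissible_misses[OF assms(1)] by blast
  have "\<forall>v\<in>U #> t. \<not> cong i v (c \<otimes> t)"
    using c U assms(2) by (auto simp: r_coset_def cong_mult subset_iff)
  then show "\<exists>c\<in>carrier G. \<forall>v\<in>U #> t. \<not> cong i v c" using c(1) assms(2) by blast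
qed

section \<open>The orbit closure of the free points\<close>

lemma mem_translate_free_points:
  assumes "t \<in> carrier G" "x \<in> carrier G"
  shows "x \<in> t <#\<^bsub>G\<^esub> free_points G L \<longleftrightarrow> (\<forall>i. \<not> cong i x t)"
proof -
  have "x \<in> t <#\<^bsub>G\<^esub> free_points G L \<longleftrightarrow> x \<otimes> inv t \<in> free_points G L"
  proof
    assume "x \<in> t <#\<^bsub>G\<^esub> free_points G L"
    then obtain v where "v \<in> free_points G L" "x = t \<otimes> v" by (auto simp: l_coset_def)
    then show "x \<otimes> inv t \<in> free_points G L" using assms by (auto simp: free_points_def m_comm[of t] m_assoc)
  next
    assume "x \<otimes> inv t \<in> free_points G L"
    moreover have "x = t \<otimes> (x \<otimes> inv t)" using assms by (simp add: m_comm[of t] m_assoc)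
    ultimately show "x \<in> t <#\<^bsub>G\<^esub> free_points G L" by (auto simp: l_coset_def)
  qed
  then show ?thesis using assms by (auto simp: free_points_def cong_def)
qed

lemma translate_free_points_subset: "t \<in> carrier G \<Longrightarrow> t <#\<^bsub>G\<^esub> free_points G L \<subseteq> carrier G"
  by (auto simp: l_coset_def free_points_def)

lemma infinite_choose_injection:
  assumes "finite A" "infinite (B :: nat set)"
  obtains g where "inj_on g A" "g ` A \<subseteq> B"
proof -
  obtain T where T: "T \<subseteq> B" "finite T" "card T = card A"
    using infinite_arbitrarily_large[OF assms(2), of "card A"] by auto
  obtain g where "bij_betw g A T" using finite_same_card_bij[OF assms(1) T(2)] T(3) by auto
  then show ?thesis using that[of g] T(1) by (auto simp: bij_betw_def)
qed

text \<open>
  The translate of the free points by \<open>t\<close> consists of the points that are not congruent to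
  \<open>t\<close> for any index. Each point \<open>x\<close> of \<open>F - U\<close> gets an index \<open>g x\<close> of its own at which \<open>t\<close>
  is made congruent to \<open>x\<close>; the set \<open>B\<close> of forbidden indices ensures that this removes no
  point of \<open>U\<close>. At the other indices below \<open>K\<close> let \<open>t\<close> be congruent to an element of a coset
  missed by \<open>U\<close>. The sieve keeps the remaining indices away from \<open>F \<inter> U\<close>.
\<close>
theorem admissible_local_pattern:
  assumes U: "U \<in> admissible_sets G L" and F: "finite F" "F \<subseteq> carrier G"
  obtains t where "t \<in> carrier G" "(t <#\<^bsub>G\<^esub> free_points G L) \<inter> F = U \<inter> F"
proof -
  define Y where "Y = F \<inter> U"
  have Y: "finite Y" "Y \<subseteq> carrier G" using F by (auto simp: Y_def)
  obtain K where K: "\<And>S t\<^sub>0. finite S \<Longrightarrow> {..<K} \<subseteq> S \<Longrightarrow> t\<^sub>0 \<in> carrier G \<Longrightarrow>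
      \<exists>t\<in>carrier G. (\<forall>i\<in>S. t \<otimes> inv t\<^sub>0 \<in> L i) \<and> (\<forall>i. i \<notin> S \<longrightarrow> (\<forall>y\<in>Y. t \<otimes> inv y \<notin> L i))"
    using sieve[of "card Y"]
  proof (elim exE, goal_cases)
    case (1 K)
    show ?case by (rule 1(1)[of K]) (use 1(2)[rule_format, OF Y order_refl] in auto)
  qed
  define B where "B = {..<K} \<union> (\<Union>x\<in>F - U. \<Union>y\<in>Y. {i. cong i x y})"
  have "finite B"
    unfolding B_def by (intro finite_UnI finite_UN_I finite_cong) (use F Y in \<open>auto simp: Y_def\<close>)
  then have "infinite (- B)" by (simp add: finite_compl)
  then obtain g where g: "inj_on g (F - U)" "g ` (F - U) \<subseteq> - B"
    using infinite_choose_injection[of "F - U" "- B"] F(1) by blast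
  define S where "S = {..<K} \<union> g ` (F - U)"
  have S: "finite S" "{..<K} \<subseteq> S" using F(1) by (auto simp: S_def)
  have "\<forall>i. \<exists>c\<in>carrier G. \<forall>u\<in>U. \<not> cong i u c" using U by (simp add: admissible_iff)
  then obtain c where c: "\<And>i. c i \<in> carrier G" "\<And>i u. u \<in> U \<Longrightarrow> \<not> cong i u (c i)" by metis
  define e where "e i = (if i \<in> g ` (F - U) then inv_into (F - U) g i else c i)" for i
  have ex: "e (g x) = x" if "x \<in> F - U" for x using that g(1) by (simp add: e_def inv_into_f_f)
  have eF: "e i \<in> F - U" if "i \<in> g ` (F - U)" for i using that ex by auto
  have e: "e i \<in> carrier G" for i
  proof (cases "i \<in> g ` (F - U)")
    case True
    then show ?thesis using eF[OF True] F(2) by blast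
  next
    case False
    then show ?thesis using c(1) by (simp add: e_def)
  qed
  obtain t\<^sub>0 where t0: "t\<^sub>0 \<in> carrier G" "\<forall>i\<in>S. t\<^sub>0 \<otimes> inv e i \<in> L i"
    using crt[OF S(1), of e] e by blast
  obtain t where t: "t \<in> carrier G" "\<forall>i\<in>S. t \<otimes> inv t\<^sub>0 \<in> L i" "\<And>i y. i \<notin> S \<Longrightarrow> y \<in> Y \<Longrightarrow> t \<otimes> inv y \<notin> L i"
    using K[OF S t0(1)] by blast
  have te: "cong i t (e i)" if "i \<in> S" for i
    using cong_trans[OF t(1) t0(1) e, of i i] t(2) t0(2) that by (auto simp: cong_def)
  have "x \<in> t <#\<^bsub>G\<^esub> free_points G L \<longleftrightarrow> x \<in> U" if x: "x \<in> F" for x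
  proof -
    have xc: "x \<in> carrier G" using x F(2) by blast
    show ?thesis
    proof
      assume fr: "x \<in> t <#\<^bsub>G\<^esub> free_points G L"
      show "x \<in> U"
      proof (rule ccontr)
        assume "x \<notin> U"
        then have x': "x \<in> F - U" using x by blast
        then have "g x \<in> S" by (auto simp: S_def)
        from te[OF this] have "cong (g x) t x" using ex[OF x'] by simp
        then have "cong (g x) x t" by (rule cong_sym[OF t(1) xc])
        then show False using fr mem_translate_free_points[OF t(1) xc] by blast
      qed
    next
      assume "x \<in> U"
      then have xY: "x \<in> Y" using x by (simp add: Y_def)
      have "\<not> cong i x t" for i
      proof (cases "i \<in> S")
        case True
        have "\<not> cong i x (e i)"
        proof (cases "i \<in> g ` (F - U)")
          case True
          then have ei: "e i \<in> F - U" by (rule eF)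
          have "i \<notin> B" using subsetD[OF g(2) True] by simp
          moreover have "g (e i) = i" using True ex by auto
          ultimately have "g (e i) \<notin> B" by simp
          then have "\<not> cong i (e i) x" using ei xY \<open>g (e i) = i\<close> unfolding B_def by auto
          then show ?thesis using cong_sym[OF xc e] by blast
        next
          case False
          then show ?thesis using c(2)[OF \<open>x \<in> U\<close>] by (simp add: e_def)
        qed
        then show ?thesis using cong_trans[OF xc t(1) e] te[OF True] by blast
      next
        case False
        then have "\<not> cong i t x" using t(3) xY by (simp add: cong_def)
        then show ?thesis using cong_sym[OF xc t(1)] by blast
      qed
      then show "x \<in> t <#\<^bsub>G\<^esub> free_points G L" using mem_translate_free_points[OF t(1) xc] by blast
    qed
  qed
  then show ?thesis using that[OF t(1)] by blast
qed

text \<open>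
  Translates of the free points are admissible, and a set all of whose finite subsets are
  admissible is admissible; the converse is the preceding theorem.
\<close>
theorem free_space_eq_admissible: "free_space G L = admissible_sets G L"
proof -
  have sub: "V \<subseteq> carrier G" if "V \<in> {t <#\<^bsub>G\<^esub> free_points G L | t. t \<in> carrier G}" for V
    using that translate_free_points_subset by blast
  have mem: "U \<in> free_space G L \<longleftrightarrow> U \<subseteq> carrier G \<and> (\<forall>F. finite F \<longrightarrow> F \<subseteq> carrier G \<longrightarrow>
      (\<exists>V\<in>{t <#\<^bsub>G\<^esub> free_points G L | t. t \<in> carrier G}. V \<inter> F = U \<inter> F))" for U
    unfolding free_space_def by (rule in_closure_of_powerset_topology[OF sub])
  show ?thesis
  proof (intro equalityI subsetI)
    fix U assume U: "U \<in> free_space G L"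
    show "U \<in> admissible_sets G L"
    proof (rule admissible_of_finite_subsets)
      show "U \<subseteq> carrier G" using U mem by blast
      fix V assume V: "finite V" "V \<subseteq> U"
      have Uc: "U \<subseteq> carrier G" and "\<exists>V'\<in>{t <#\<^bsub>G\<^esub> free_points G L | t. t \<in> carrier G}. V' \<inter> V = U \<inter> V"
        using U V mem[of U] by auto
      then obtain t where t: "t \<in> carrier G" "(t <#\<^bsub>G\<^esub> free_points G L) \<inter> V = U \<inter> V" by auto
      have "\<not> cong i v t" if v: "v \<in> V" for v i
      proof -
        have "v \<in> t <#\<^bsub>G\<^esub> free_points G L" using t(2) V(2) v by blast
        moreover have "v \<in> carrier G" using v V(2) Uc by blast
        ultimately show ?thesis using mem_translate_free_points[OF t(1)] by simp
      qed
      then show "V \<in> admissible_sets G L" using V Uc t(1) by (intro admissibleI) blast+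
    qed
  next
    fix U assume U: "U \<in> admissible_sets G L"
    show "U \<in> free_space G L"
      unfolding mem
    proof (intro conjI allI impI)
      show "U \<subseteq> carrier G" using U by (simp add: admissible_iff)
      fix F assume "finite F" "F \<subseteq> carrier G"
      then obtain t where "t \<in> carrier G" "(t <#\<^bsub>G\<^esub> free_points G L) \<inter> F = U \<inter> F"
        by (rule admissible_local_pattern[OF U]) blast
      then show "\<exists>V\<in>{t <#\<^bsub>G\<^esub> free_points G L | t. t \<in> carrier G}. V \<inter> F = U \<inter> F" by blast
    qed
  qed
qed

end

section \<open>Adding isolated points to admissible sets\<close>

context sieve_system begin

abbreviation X where "X \<equiv> admissible_sets G L"

text \<open>
  With \<open>q\<close> the product of the indices of finitely many \<open>L i\<close>, all \<open>q\<close>-th powers lie in each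
  of them, and there are infinitely many such powers.
\<close>
lemma infinite_congruent_powers:
  assumes "finite S" "x \<in> carrier G"
  obtains q where "q > 0" "\<And>z i. z \<in> carrier G \<Longrightarrow> i \<in> S \<Longrightarrow> z [^] (q::nat) \<in> L i"
    "infinite ((\<lambda>z. x \<otimes> z [^] q) ` carrier G)"
proof -
  define q where "q = (\<Prod>i\<in>S. index i)"
  have q: "q > 0" using index_pos by (auto simp: q_def intro!: prod_pos)
  show ?thesis
  proof (rule that[of q])
    show "z [^] q \<in> L i" if "z \<in> carrier G" "i \<in> S" for z i
    proof (rule power_index_mem[OF subgroups finite_index that(1)])
      show "card (rcosets (L i)) dvd q" unfolding q_def index_def[symmetric]
        using assms(1) that(2) by (rule dvd_prodI)
    qed
    have "infinite ((\<lambda>z. x \<otimes> z) ` (\<lambda>z. z [^] q) ` carrier G)"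
      using infinite_powers[OF q] assms(2) by (subst finite_image_iff) (auto intro!: inj_onI)
    then show "infinite ((\<lambda>z. x \<otimes> z [^] q) ` carrier G)" by (simp add: image_image)
  qed (rule q)
qed

lemma infinite_residue:
  assumes "finite S" "\<And>i. i \<in> S \<Longrightarrow> c i \<in> carrier G"
  shows "infinite {x \<in> carrier G. \<forall>i\<in>S. cong i x (c i)}"
proof -
  have "\<exists>t\<in>carrier G. \<forall>i\<in>S. cong i t (c i)" unfolding cong_def by (rule crt[OF assms])
  then obtain t where t: "t \<in> carrier G" "\<And>i. i \<in> S \<Longrightarrow> cong i t (c i)" by auto
  obtain q where q: "\<And>z i. z \<in> carrier G \<Longrightarrow> i \<in> S \<Longrightarrow> z [^] (q::nat) \<in> L i"
    "infinite ((\<lambda>z. t \<otimes> z [^] q) ` carrier G)"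
    by (rule infinite_congruent_powers[OF assms(1) t(1)]) blast
  have "(\<lambda>z. t \<otimes> z [^] q) ` carrier G \<subseteq> {x \<in> carrier G. \<forall>i\<in>S. cong i x (c i)}"
  proof (intro image_subsetI CollectI conjI ballI)
    fix z i assume z: "z \<in> carrier G" and i: "i \<in> S"
    have "cong i (t \<otimes> z [^] q) t" using q(1)[OF z i] t(1) z by (simp add: cong_def m_comm[of t] m_assoc)
    then show "cong i (t \<otimes> z [^] q) (c i)"
      using cong_trans[of "t \<otimes> z [^] q" t "c i" i] t assms(2)[OF i] i z by simp
  qed (use t in simp)
  then show ?thesis using q(2) by (meson finite_subset)
qed

text \<open>
  From infinite sets one can choose elements greedily so that no two of them, and none of
  them together with an element of \<open>Z\<close>, have a quotient in \<open>W\<close>: each condition excludes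
  finitely many elements.
\<close>
lemma separated_choice:
  assumes "finite R" "finite W" "finite Z" "Z \<subseteq> carrier G"
    and "\<And>r. r \<in> R \<Longrightarrow> infinite (C r)" "\<And>r. r \<in> R \<Longrightarrow> C r \<subseteq> carrier G"
  obtains y where "\<And>r. r \<in> R \<Longrightarrow> y r \<in> C r"
    "\<And>r z. r \<in> R \<Longrightarrow> z \<in> Z \<Longrightarrow> y r \<noteq> z \<and> y r \<otimes> inv z \<notin> W \<and> z \<otimes> inv (y r) \<notin> W"
    "\<And>r r'. r \<in> R \<Longrightarrow> r' \<in> R \<Longrightarrow> r \<noteq> r' \<Longrightarrow> y r \<noteq> y r' \<and> y r \<otimes> inv (y r') \<notin> W"
proof -
  define far where "far x z \<longleftrightarrow> x \<noteq> z \<and> x \<otimes> inv z \<notin> W \<and> z \<otimes> inv x \<notin> W" for x z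
  have near: "finite {x \<in> carrier G. \<not> far x z}" if z: "z \<in> carrier G" for z
  proof -
    have "{x \<in> carrier G. \<not> far x z} \<subseteq> insert z ((\<lambda>w. w \<otimes> z) ` W \<union> (\<lambda>w. inv w \<otimes> z) ` W)"
    proof
      fix x assume "x \<in> {x \<in> carrier G. \<not> far x z}"
      then have x: "x \<in> carrier G" and "x = z \<or> x \<otimes> inv z \<in> W \<or> z \<otimes> inv x \<in> W" by (auto simp: far_def)
      then consider "x = z" | "x \<otimes> inv z \<in> W" | "z \<otimes> inv x \<in> W" by blast
      then show "x \<in> insert z ((\<lambda>w. w \<otimes> z) ` W \<union> (\<lambda>w. inv w \<otimes> z) ` W)"
      proof cases
        case 2
        moreover have "x = (x \<otimes> inv z) \<otimes> z" using x z by (simp add: m_assoc)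
        ultimately show ?thesis by blast
      next
        case 3
        moreover have "x = inv (z \<otimes> inv x) \<otimes> z" using x z by (simp add: inv_mult_group m_assoc)
        ultimately show ?thesis by blast
      qed simp
    qed
    then show ?thesis by (rule finite_subset) (use assms(2) in simp)
  qed
  have "\<exists>y. (\<forall>r\<in>R. y r \<in> C r) \<and> (\<forall>r\<in>R. \<forall>z\<in>Z. far (y r) z) \<and> (\<forall>r\<in>R. \<forall>r'\<in>R. r \<noteq> r' \<longrightarrow> far (y r) (y r'))"
    using assms(1,5,6)
  proof (induction R rule: finite_induct)
    case empty
    then show ?case by simp
  next
    case (insert r R)
    then obtain y where y: "\<And>r. r \<in> R \<Longrightarrow> y r \<in> C r" "\<And>r z. r \<in> R \<Longrightarrow> z \<in> Z \<Longrightarrow> far (y r) z"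
      "\<And>r r'. r \<in> R \<Longrightarrow> r' \<in> R \<Longrightarrow> r \<noteq> r' \<Longrightarrow> far (y r) (y r')"
      by (metis insertI2)
    have yc: "y r' \<in> carrier G" if "r' \<in> R" for r' using y(1)[OF that] insert.prems(2)[of r'] that by auto
    let ?bad = "\<Union>z\<in>Z \<union> y ` R. {x \<in> carrier G. \<not> far x z}"
    have "finite ?bad" by (intro finite_UN_I near) (use assms(3,4) insert.hyps yc in auto)
    then have "infinite (C r - ?bad)" using insert.prems(1)[of r] by simp
    then have "\<exists>x. x \<in> C r - ?bad" unfolding ex_in_conv by (rule infinite_imp_nonempty)
    then obtain x where "x \<in> C r - ?bad" ..
    note x = DiffD1[OF this] DiffD2[OF this]
    have xc: "x \<in> carrier G" using x(1) insert.prems(2)[of r] by auto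
    have fx: "far x z" if "z \<in> Z \<union> y ` R" for z using x(2) xc that by blast
    have sym: "far a b \<Longrightarrow> far b a" for a b by (auto simp: far_def)
    show ?case
    proof (intro exI[of _ "y(r := x)"] conjI ballI impI)
      fix a b assume "a \<in> insert r R" "b \<in> insert r R" "a \<noteq> b"
      then show "far ((y(r := x)) a) ((y(r := x)) b)"
        using y(3)[of a b] fx sym by (cases "a = r"; cases "b = r") auto
    qed (use x y fx insert.hyps in auto)
  qed
  then show ?thesis using that unfolding far_def by metis
qed

text \<open>
  The points of \<open>Y\<close> represent all cosets of \<open>L i\<close> other than that of \<open>a\<close>. At the finitely
  many other indices that are so small that \<open>U \<union> Y\<close> might meet all cosets, they are taken
  congruent to a point of \<open>U\<close> and therefore meet no new coset. Within the resulting residue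
  classes there is room to keep them far apart and outside \<open>Z\<close>.
\<close>
lemma separated_cover:
  assumes U: "finite U" "U \<in> admissible_sets G L" "U \<noteq> {}" and a: "a \<in> carrier G" "\<And>u. u \<in> U \<Longrightarrow> \<not> cong i u a"
    and W: "finite W" "finite Z"
  obtains Y where "Y \<subseteq> carrier G" "Y \<inter> Z = {}" "U \<union> Y \<in> admissible_sets G L"
    "\<And>c. c \<in> carrier G \<Longrightarrow> \<not> cong i c a \<Longrightarrow> \<exists>y\<in>Y. cong i y c"
    "\<And>y z. y \<in> Y \<Longrightarrow> z \<in> U \<union> Y \<Longrightarrow> z \<noteq> y \<Longrightarrow> z \<otimes> inv y \<notin> W"
proof -
  have Uc: "U \<subseteq> carrier G" using U(2) by (simp add: admissible_iff)
  obtain R' where R': "finite R'" "R' \<subseteq> carrier G" "card R' = index i" "\<And>x. x \<in> carrier G \<Longrightarrow> \<exists>r\<in>R'. cong i x r"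
    by (rule representatives) blast
  define R where "R = {r \<in> R'. \<not> cong i r a}"
  have R: "finite R" "R \<subseteq> carrier G" "card R \<le> index i"
    using R' card_mono[OF R'(1), of R] by (auto simp: R_def)
  obtain u0 where u0: "u0 \<in> U" using U(3) by blast
  have u0c: "u0 \<in> carrier G" using u0 Uc by blast
  define J where "J = {j. index j \<le> card U + index i} - {i}"
  have J: "finite J" using finite_index_le by (simp add: J_def)
  define C where "C r = {x \<in> carrier G. \<forall>j\<in>insert i J. cong j x (if j = i then r else u0)} - Z" for r
  have Cinf: "infinite (C r)" if "r \<in> R" for r
  proof -
    have "infinite {x \<in> carrier G. \<forall>j\<in>insert i J. cong j x (if j = i then r else u0)}"
      by (rule infinite_residue) (use J R that u0c in auto)
    then show ?thesis unfolding C_def by (rule Diff_infinite_finite[OF W(2)])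
  qed
  obtain y where y: "\<And>r. r \<in> R \<Longrightarrow> y r \<in> C r"
    "\<And>r z. r \<in> R \<Longrightarrow> z \<in> U \<Longrightarrow> y r \<noteq> z \<and> y r \<otimes> inv z \<notin> W \<and> z \<otimes> inv (y r) \<notin> W"
    "\<And>r r'. r \<in> R \<Longrightarrow> r' \<in> R \<Longrightarrow> r \<noteq> r' \<Longrightarrow> y r \<noteq> y r' \<and> y r \<otimes> inv (y r') \<notin> W"
    by (rule separated_choice[OF R(1) W(1) U(1) Uc, of C]) (use Cinf C_def in auto)
  have yc: "y r \<in> carrier G" and yi: "cong i (y r) r" and yZ: "y r \<notin> Z" if "r \<in> R" for r
    using y(1)[OF that] by (auto simp: C_def)
  have yj: "cong j (y r) u0" if "r \<in> R" "j \<in> J" for r j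
    using y(1)[OF that(1)] that(2) by (auto simp: C_def J_def)
  show ?thesis
  proof (rule that[of "y ` R"])
    show "y ` R \<subseteq> carrier G" "y ` R \<inter> Z = {}" using yc yZ by auto
    show "\<exists>z\<in>y ` R. cong i z c" if c: "c \<in> carrier G" "\<not> cong i c a" for c
    proof -
      obtain r where r: "r \<in> R'" "cong i c r" using R'(4)[OF c(1)] by blast
      then have rc: "r \<in> carrier G" using R'(2) by blast
      have "r \<in> R" using r c cong_trans[OF c(1) rc a(1)] by (auto simp: R_def)
      moreover have "cong i (y r) c"
        using cong_trans[OF yc[OF calculation] rc c(1) yi[OF calculation]] cong_sym[OF c(1) rc r(2)] by blast
      ultimately show ?thesis by blast
    qed
    show "z \<otimes> inv x \<notin> W" if "x \<in> y ` R" "z \<in> U \<union> y ` R" "z \<noteq> x" for x z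
      using that y(2,3) by (auto; metis)
    show "U \<union> y ` R \<in> admissible_sets G L"
    proof (rule admissibleI)
      show "U \<union> y ` R \<subseteq> carrier G" using Uc yc by auto
      fix j
      show "\<exists>c\<in>carrier G. \<forall>u\<in>U \<union> y ` R. \<not> cong j u c"
      proof (cases "j = i \<or> j \<in> J")
        case False
        have "card (U \<union> y ` R) \<le> card U + card (y ` R)" by (rule card_Un_le)
        also have "\<dots> \<le> card U + index i" using card_image_le[OF R(1), of y] R(3) by linarith
        also have "\<dots> < index j" using False by (auto simp: J_def)
        finally show ?thesis by (intro few_points_miss_class) (use U(1) R(1) Uc yc in auto)
      next
        case True
        then consider "j = i" | "j \<in> J" by blast
        then show ?thesis
        proof cases
          case 1
          have "\<not> cong i (y r) a" if r: "r \<in> R" for r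
          proof
            assume "cong i (y r) a"
            moreover have "cong i r (y r)" using cong_sym[OF yc[OF r] _ yi[OF r]] r R(2) by blast
            ultimately have "cong i r a" using cong_trans[of r "y r" a i] r R(2) yc[OF r] a(1) by blast
            then show False using r by (simp add: R_def)
          qed
          then show ?thesis using a 1 by (intro bexI[of _ a]) auto
        next
          case 2
          obtain c where c: "c \<in> carrier G" "\<And>u. u \<in> U \<Longrightarrow> \<not> cong j u c" using admissible_misses[OF U(2), of j] by blast
          have "\<not> cong j (y r) c" if r: "r \<in> R" for r
            using cong_trans[OF u0c yc[OF r] c(1), of j] cong_sym[OF yc[OF r] u0c yj[OF r 2]] c(2)[OF u0] by blast
          then show ?thesis using c by (intro bexI[of _ c]) auto
        qed
      qed
    qed
  qed
qed

lemma singleton_admissible: "x \<in> carrier G \<Longrightarrow> {x} \<in> admissible_sets G L"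
  using not_cong_exists by (intro admissibleI) auto

lemma empty_admissible: "{} \<in> admissible_sets G L"
  by (rule admissible_subset[OF singleton_admissible[OF one_closed]]) simp

lemma carrier_not_admissible: "carrier G \<notin> admissible_sets G L"
  unfolding admissible_iff using cong_refl by blast

end

section \<open>Rigidity of symmetries\<close>

text \<open>
  A continuous bijection of the space of admissible sets that commutes with translations up
  to an automorphism.
\<close>
locale twisted_symmetry = sieve_system G L for G (structure) and L +
  fixes \<Phi> :: "'a set \<Rightarrow> 'a set" and \<alpha> :: "'a \<Rightarrow> 'a"
  assumes bij: "bij_betw \<Phi> (admissible_sets G L) (admissible_sets G L)"
    and locality: "U \<in> admissible_sets G L \<Longrightarrow> x \<in> carrier G \<Longrightarrow>
      \<exists>F. finite F \<and> F \<subseteq> carrier G \<and> (\<forall>V\<in>admissible_sets G L. V \<inter> F = U \<inter> F \<longrightarrow> (x \<in> \<Phi> V \<longleftrightarrow> x \<in> \<Phi> U))"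
    and auto: "\<alpha> \<in> hom G G" "bij_betw \<alpha> (carrier G) (carrier G)"
    and twist: "U \<in> admissible_sets G L \<Longrightarrow> t \<in> carrier G \<Longrightarrow> \<Phi> (U #> t) = \<Phi> U #> \<alpha> t"
begin

lemma window:
  assumes "U \<in> X" "x \<in> carrier G"
  obtains W where "finite W" "\<And>V. V \<in> X \<Longrightarrow> V \<inter> W = U \<inter> W \<Longrightarrow> x \<in> \<Phi> V \<longleftrightarrow> x \<in> \<Phi> U"
proof -
  obtain W where "finite W \<and> W \<subseteq> carrier G \<and> (\<forall>V\<in>X. V \<inter> W = U \<inter> W \<longrightarrow> (x \<in> \<Phi> V \<longleftrightarrow> x \<in> \<Phi> U))"
    using locality[OF assms] by (rule exE)
  then show ?thesis by (intro that[of W]) auto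
qed

lemma \<Phi>_X: "U \<in> X \<Longrightarrow> \<Phi> U \<in> X"
  using bij by (auto simp: bij_betw_def)

lemma \<Phi>_carrier: "U \<in> X \<Longrightarrow> \<Phi> U \<subseteq> carrier G"
  using \<Phi>_X by (simp add: admissible_iff)

lemma \<alpha>_closed [simp]: "t \<in> carrier G \<Longrightarrow> \<alpha> t \<in> carrier G"
  using auto(1) by (auto simp: hom_def)

lemma \<alpha>_mult: "s \<in> carrier G \<Longrightarrow> t \<in> carrier G \<Longrightarrow> \<alpha> (s \<otimes> t) = \<alpha> s \<otimes> \<alpha> t"
  using auto(1) by (simp add: hom_def)

lemma \<alpha>_hom: "group_hom G G \<alpha>"
  using auto(1) is_group by (simp add: group_hom_def group_hom_axioms_def)

lemma \<alpha>_inv: "t \<in> carrier G \<Longrightarrow> \<alpha> (inv t) = inv (\<alpha> t)"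
  by (rule group_hom.hom_inv[OF \<alpha>_hom])

lemma \<alpha>_pow: "t \<in> carrier G \<Longrightarrow> \<alpha> (t [^] (n::nat)) = \<alpha> t [^] n"
  by (rule group_hom.hom_nat_pow[OF \<alpha>_hom])

text \<open>
  The image of the empty set is invariant under all translations, hence empty or the whole
  group, and the whole group is not admissible.
\<close>
lemma empty_fixed: "\<Phi> {} = {}"
proof (rule ccontr)
  assume "\<Phi> {} \<noteq> {}"
  have c: "\<Phi> {} \<subseteq> carrier G" by (rule \<Phi>_carrier[OF empty_admissible])
  then obtain x where x: "x \<in> \<Phi> {}" "x \<in> carrier G" using \<open>\<Phi> {} \<noteq> {}\<close> by blast
  have "y \<in> \<Phi> {}" if y: "y \<in> carrier G" for y
  proof -
    obtain t where t: "t \<in> carrier G" "\<alpha> t = inv x \<otimes> y"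
      using auto(2) x y by (metis bij_betw_imp_surj_on imageE inv_closed m_closed)
    have "{} #> t = ({} :: 'a set)" by (simp add: r_coset_def)
    then have "\<Phi> {} = \<Phi> {} #> (inv x \<otimes> y)" using twist[OF empty_admissible t(1)] t(2) by simp
    moreover have "x \<otimes> (inv x \<otimes> y) \<in> \<Phi> {} #> (inv x \<otimes> y)" using x(1) by (auto simp: r_coset_def)
    moreover have "x \<otimes> (inv x \<otimes> y) = y" using x(2) y by (simp flip: m_assoc)
    ultimately show ?thesis by simp
  qed
  then have "\<Phi> {} = carrier G" using c by blast
  then show False using carrier_not_admissible \<Phi>_X[OF empty_admissible] by simp
qed

lemma image_of_one_nonempty: "\<Phi> {\<one>} \<noteq> {}"
proof
  assume "\<Phi> {\<one>} = {}"
  then have "\<Phi> {\<one>} = \<Phi> {}" using empty_fixed by simp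
  then have "{\<one>} = ({} :: 'a set)"
    using bij singleton_admissible[OF one_closed] empty_admissible by (metis bij_betw_def inj_onD)
  then show False by simp
qed

text \<open>
  Near an isolated point \<open>y\<close>, the set \<open>Y\<close> looks like a translate of \<open>{1}\<close>. So continuity at
  \<open>{1}\<close> carries \<open>f\<close> over to the image of \<open>Y\<close>.
\<close>
lemma isolated_window:
  assumes f: "f \<in> \<Phi> {\<one>}"
  obtains W where "finite W" "\<And>Y y. Y \<in> X \<Longrightarrow> y \<in> Y \<Longrightarrow> (\<And>z. z \<in> Y \<Longrightarrow> z \<noteq> y \<Longrightarrow> z \<otimes> inv y \<notin> W) \<Longrightarrow> \<alpha> y \<otimes> f \<in> \<Phi> Y"
proof -
  have one: "{\<one>} \<in> X" by (rule singleton_admissible[OF one_closed])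
  have fc: "f \<in> carrier G" using f \<Phi>_carrier[OF one] by blast
  obtain W where W: "finite W" "\<And>V. V \<in> X \<Longrightarrow> V \<inter> W = {\<one>} \<inter> W \<Longrightarrow> f \<in> \<Phi> V \<longleftrightarrow> f \<in> \<Phi> {\<one>}"
    by (rule window[OF one fc]) blast
  have "\<alpha> y \<otimes> f \<in> \<Phi> Y" if Y: "Y \<in> X" "y \<in> Y" "\<And>z. z \<in> Y \<Longrightarrow> z \<noteq> y \<Longrightarrow> z \<otimes> inv y \<notin> W" for Y y
  proof -
    have Yc: "Y \<subseteq> carrier G" using Y(1) by (simp add: admissible_iff)
    have yc: "y \<in> carrier G" using Y(2) Yc by blast
    define V where "V = Y #> inv y"
    have V: "V \<in> X" unfolding V_def by (rule translate_admissible[OF Y(1)]) (use yc in simp)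
    have oV: "\<one> \<in> V" using Y(2) yc by (auto simp: V_def r_coset_def intro!: bexI[of _ y])
    have "w = \<one>" if "w \<in> V" "w \<in> W" for w
    proof -
      obtain z where z: "z \<in> Y" "w = z \<otimes> inv y" using \<open>w \<in> V\<close> by (auto simp: V_def r_coset_def)
      then have "z = y" using Y(3) \<open>w \<in> W\<close> by blast
      then show ?thesis using z yc by simp
    qed
    then have "V \<inter> W = {\<one>} \<inter> W" using oV by blast
    then have "f \<in> \<Phi> V" using W(2)[OF V] f by blast
    also have "\<Phi> V = \<Phi> Y #> inv (\<alpha> y)" unfolding V_def using twist[OF Y(1), of "inv y"] yc by (simp add: \<alpha>_inv)
    finally have "f \<otimes> \<alpha> y \<in> \<Phi> Y"
      using mem_translate_iff[OF \<Phi>_carrier[OF Y(1)], of "inv (\<alpha> y)" f] yc fc by simp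
    then show ?thesis using fc yc by (simp add: m_comm)
  qed
  then show ?thesis using that W(1) by blast
qed

text \<open>
  Only the finitely many indices in \<open>J\<close> can make \<open>Y\<close> or its image inadmissible. Multiplying
  the points of \<open>Y\<close> by suitable \<open>q\<close>-th powers changes neither their classes at these indices
  nor those of their images under \<open>\<alpha>\<close>, but separates them. For the separated copy \<open>\<eta> ` Y\<close>, a
  translate of its image under \<open>\<alpha>\<close> is contained in the admissible set \<open>\<Phi> (\<eta> ` Y)\<close>.
\<close>
lemma automorphism_preserves_finite_admissible:
  assumes Y: "finite Y" "Y \<in> X"
  shows "\<alpha> ` Y \<in> X"
proof -
  have Yc: "Y \<subseteq> carrier G" using Y(2) by (simp add: admissible_iff)
  obtain f where f: "f \<in> \<Phi> {\<one>}" using image_of_one_nonempty by blast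
  have fc: "f \<in> carrier G" using f \<Phi>_carrier[OF singleton_admissible[OF one_closed]] by blast
  obtain W where W: "finite W" "\<And>Y y. Y \<in> X \<Longrightarrow> y \<in> Y \<Longrightarrow> (\<And>z. z \<in> Y \<Longrightarrow> z \<noteq> y \<Longrightarrow> z \<otimes> inv y \<notin> W) \<Longrightarrow> \<alpha> y \<otimes> f \<in> \<Phi> Y"
    by (rule isolated_window[OF f]) blast
  define J where "J = {j. index j \<le> card Y}"
  have J: "finite J" unfolding J_def by (rule finite_index_le)
  obtain q where q: "q > 0" "\<And>z j. z \<in> carrier G \<Longrightarrow> j \<in> J \<Longrightarrow> z [^] (q::nat) \<in> L j"
    by (rule infinite_congruent_powers[OF J one_closed]) blast
  define C where "C y = (\<lambda>z. y \<otimes> z [^] q) ` carrier G" for y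
  have Cinf: "infinite (C y)" if "y \<in> Y" for y
  proof -
    have "infinite ((\<lambda>z. y \<otimes> z) ` (\<lambda>z. z [^] q) ` carrier G)"
      using infinite_powers[OF q(1)] that Yc by (subst finite_image_iff) (auto intro!: inj_onI)
    then show ?thesis by (simp add: image_image C_def)
  qed
  have Cc: "C y \<subseteq> carrier G" if "y \<in> Y" for y using that Yc by (auto simp: C_def)
  obtain \<eta> where \<eta>: "\<And>y. y \<in> Y \<Longrightarrow> \<eta> y \<in> C y"
    "\<And>y y'. y \<in> Y \<Longrightarrow> y' \<in> Y \<Longrightarrow> y \<noteq> y' \<Longrightarrow> \<eta> y \<noteq> \<eta> y' \<and> \<eta> y \<otimes> inv (\<eta> y') \<notin> W"
    by (rule separated_choice[OF Y(1) W(1), of "{}" C]) (use Cinf Cc in auto)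
  have \<eta>c: "\<eta> y \<in> carrier G" if "y \<in> Y" for y using \<eta>(1)[OF that] Cc[OF that] by blast
  have \<eta>j: "cong j (\<eta> y) y" "cong j (\<alpha> y) (\<alpha> (\<eta> y))" if y: "y \<in> Y" and j: "j \<in> J" for y j
  proof -
    obtain z where z: "z \<in> carrier G" "\<eta> y = y \<otimes> z [^] q" using \<eta>(1)[OF y] by (auto simp: C_def)
    have yc: "y \<in> carrier G" using y Yc by blast
    show "cong j (\<eta> y) y" using q(2)[OF z(1) j] z yc by (simp add: cong_def m_comm[of y] m_assoc)
    have "cong j (\<alpha> (\<eta> y)) (\<alpha> y)"
      using q(2)[of "\<alpha> z" j] j z yc by (simp add: cong_def \<alpha>_mult \<alpha>_pow m_comm[of "\<alpha> y"] m_assoc)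
    then show "cong j (\<alpha> y) (\<alpha> (\<eta> y))" using cong_sym \<eta>c[OF y] yc by simp
  qed
  have \<eta>X: "\<eta> ` Y \<in> X"
  proof (rule admissibleI)
    show "\<eta> ` Y \<subseteq> carrier G" using \<eta>c by blast
    fix j
    show "\<exists>c\<in>carrier G. \<forall>u\<in>\<eta> ` Y. \<not> cong j u c"
    proof (cases "j \<in> J")
      case True
      obtain c where c: "c \<in> carrier G" "\<And>y. y \<in> Y \<Longrightarrow> \<not> cong j y c" using admissible_misses[OF Y(2), of j] by blast
      have "\<not> cong j (\<eta> y) c" if y: "y \<in> Y" for y
      proof -
        have yc: "y \<in> carrier G" using y Yc by blast
        show ?thesis
          using cong_trans[OF yc \<eta>c[OF y] c(1), of j] cong_sym[OF \<eta>c[OF y] yc \<eta>j(1)[OF y True]] c(2)[OF y] by blast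
      qed
      then show ?thesis using c(1) by blast
    next
      case False
      then have "card (\<eta> ` Y) < index j" using card_image_le[OF Y(1), of \<eta>] by (auto simp: J_def)
      then show ?thesis by (intro few_points_miss_class) (use Y(1) \<eta>c in auto)
    qed
  qed
  have mem: "\<alpha> (\<eta> y) \<otimes> f \<in> \<Phi> (\<eta> ` Y)" if y: "y \<in> Y" for y
  proof (rule W(2)[OF \<eta>X])
    fix z assume "z \<in> \<eta> ` Y" "z \<noteq> \<eta> y"
    then obtain y' where "y' \<in> Y" "z = \<eta> y'" "y' \<noteq> y" by blast
    then show "z \<otimes> inv (\<eta> y) \<notin> W" using \<eta>(2)[of y' y] y by blast
  qed (use y in blast)
  have adm: "(\<lambda>y. \<alpha> (\<eta> y) \<otimes> f) ` Y \<in> X"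
    by (rule admissible_subset[OF \<Phi>_X[OF \<eta>X]]) (use mem in blast)
  show ?thesis
  proof (rule admissibleI)
    show "\<alpha> ` Y \<subseteq> carrier G" using Yc by auto
    fix j
    show "\<exists>c\<in>carrier G. \<forall>u\<in>\<alpha> ` Y. \<not> cong j u c"
    proof (cases "j \<in> J")
      case True
      obtain c where c: "c \<in> carrier G" "\<And>y. y \<in> Y \<Longrightarrow> \<not> cong j (\<alpha> (\<eta> y) \<otimes> f) c"
        using admissible_misses[OF adm, of j] by auto
      have "\<not> cong j (\<alpha> y) (c \<otimes> inv f)" if y: "y \<in> Y" for y
      proof
        have yc: "y \<in> carrier G" using y Yc by blast
        assume "cong j (\<alpha> y) (c \<otimes> inv f)"
        then have "cong j (\<alpha> (\<eta> y)) (c \<otimes> inv f)"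
          using cong_trans[of "\<alpha> (\<eta> y)" "\<alpha> y" "c \<otimes> inv f" j] cong_sym[OF _ _ \<eta>j(2)[OF y True]] yc \<eta>c[OF y] c(1) fc by simp
        then have "cong j (\<alpha> (\<eta> y) \<otimes> f) (c \<otimes> inv f \<otimes> f)"
          using cong_mult[of "\<alpha> (\<eta> y)" "c \<otimes> inv f" f j] \<eta>c[OF y] c(1) fc by simp
        then show False using c fc y by (simp add: m_assoc)
      qed
      then show ?thesis using c(1) fc by (intro bexI[of _ "c \<otimes> inv f"]) auto
    next
      case False
      then have "card (\<alpha> ` Y) < index j" using card_image_le[OF Y(1), of \<alpha>] by (auto simp: J_def)
      then show ?thesis by (intro few_points_miss_class) (use Y(1) Yc in auto)
    qed
  qed
qed

theorem automorphism_preserves_admissible: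
  assumes "U \<in> X"
  shows "\<alpha> ` U \<in> X"
proof (rule admissible_of_finite_subsets)
  show "\<alpha> ` U \<subseteq> carrier G" using assms by (auto simp: admissible_iff)
  fix V assume "finite V" "V \<subseteq> \<alpha> ` U"
  then obtain Y where Y: "Y \<subseteq> U" "finite Y" "V = \<alpha> ` Y" by (meson finite_subset_image)
  then show "V \<in> X"
    using automorphism_preserves_finite_admissible[OF Y(2) admissible_subset[OF assms Y(1)]] by simp
qed

end

locale shift_symmetry = twisted_symmetry G L \<Phi> "\<lambda>t. t" for G (structure) and L \<Phi>
begin

text \<open>
  Suppose \<open>x \<in> \<Phi> U\<close> while \<open>a = x f\<^sup>-\<^sup>1\<close> is not in \<open>U\<close>. Choose an index \<open>i\<close> with \<open>a\<close> not
  congruent to any element of \<open>U\<close>, and add to \<open>U\<close> isolated points in all cosets of \<open>L i\<close>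
  other than that of \<open>a\<close>, outside the window that decides about \<open>x\<close>. The image then still
  contains \<open>x\<close>, and the translates by \<open>f\<close> of the new points meet every coset other than that
  of \<open>x\<close>: it cannot be admissible.
\<close>
lemma image_subset_translate_finite:
  assumes f: "f \<in> \<Phi> {\<one>}" and U: "finite U" "U \<in> X"
  shows "\<Phi> U \<subseteq> U #> f"
proof (rule subsetI, rule ccontr)
  fix x assume x: "x \<in> \<Phi> U" "x \<notin> U #> f"
  have one: "{\<one>} \<in> X" by (rule singleton_admissible[OF one_closed])
  have fc: "f \<in> carrier G" using f \<Phi>_carrier[OF one] by auto
  have xc: "x \<in> carrier G" using x(1) \<Phi>_carrier[OF U(2)] by blast
  have Uc: "U \<subseteq> carrier G" using U(2) by (simp add: admissible_iff)
  have Une: "U \<noteq> {}" using x(1) empty_fixed by auto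
  define a where "a = x \<otimes> inv f"
  have a: "a \<in> carrier G" using xc fc by (simp add: a_def)
  have aU: "a \<notin> U" using x(2) mem_translate_iff[OF Uc fc xc] by (simp add: a_def)
  have "finite (\<Union>u\<in>U. {i. cong i u a})"
    using U(1) Uc aU a by (intro finite_UN_I finite_cong) auto
  then obtain i where i: "i \<notin> (\<Union>u\<in>U. {i. cong i u a})" using ex_new_if_finite[OF infinite_UNIV_nat] by blast
  obtain W1 where W1: "finite W1" "\<And>Y y. Y \<in> X \<Longrightarrow> y \<in> Y \<Longrightarrow> (\<And>z. z \<in> Y \<Longrightarrow> z \<noteq> y \<Longrightarrow> z \<otimes> inv y \<notin> W1) \<Longrightarrow> y \<otimes> f \<in> \<Phi> Y"
    by (rule isolated_window[OF f]) blast
  obtain W2 where W2: "finite W2" "\<And>V. V \<in> X \<Longrightarrow> V \<inter> W2 = U \<inter> W2 \<Longrightarrow> x \<in> \<Phi> V \<longleftrightarrow> x \<in> \<Phi> U"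
    by (rule window[OF U(2) xc]) blast
  obtain Y where Y: "Y \<subseteq> carrier G" "Y \<inter> W2 = {}" "U \<union> Y \<in> X"
    "\<And>c. c \<in> carrier G \<Longrightarrow> \<not> cong i c a \<Longrightarrow> \<exists>y\<in>Y. cong i y c"
    "\<And>y z. y \<in> Y \<Longrightarrow> z \<in> U \<union> Y \<Longrightarrow> z \<noteq> y \<Longrightarrow> z \<otimes> inv y \<notin> W1"
    by (rule separated_cover[OF U Une a, of i W1 W2]) (use i W1 W2 in auto)
  have xm: "x \<in> \<Phi> (U \<union> Y)" using W2(2)[OF Y(3)] Y(2) x(1) by blast
  have ym: "y \<otimes> f \<in> \<Phi> (U \<union> Y)" if "y \<in> Y" for y
    by (rule W1(2)[OF Y(3)]) (use that Y(5) in auto)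
  obtain c where c: "c \<in> carrier G" "\<And>x. x \<in> \<Phi> (U \<union> Y) \<Longrightarrow> \<not> cong i x c"
    using admissible_misses[OF \<Phi>_X[OF Y(3)], of i] by blast
  have cf: "c \<otimes> inv f \<in> carrier G" using c(1) fc by simp
  have "cong i (c \<otimes> inv f) a"
  proof (rule ccontr)
    assume "\<not> cong i (c \<otimes> inv f) a"
    then obtain y where y: "y \<in> Y" "cong i y (c \<otimes> inv f)" using Y(4)[OF cf] by auto
    have "cong i (y \<otimes> f) (c \<otimes> inv f \<otimes> f)" using cong_mult[of y "c \<otimes> inv f" f i] y Y(1) c(1) fc by auto
    then show False using c fc ym[OF y(1)] by (simp add: m_assoc)
  qed
  then have "cong i (a \<otimes> f) (c \<otimes> inv f \<otimes> f)" using cong_mult[OF a cf fc] cong_sym[OF cf a] by blast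
  then have "cong i x c" using xc fc c(1) by (simp add: a_def m_assoc)
  then show False using c(2)[OF xm] by blast
qed

lemma image_subset_translate:
  assumes f: "f \<in> \<Phi> {\<one>}" and U: "U \<in> X"
  shows "\<Phi> U \<subseteq> U #> f"
proof
  fix x assume x: "x \<in> \<Phi> U"
  have xc: "x \<in> carrier G" using x \<Phi>_carrier[OF U] by blast
  obtain W where W: "finite W" "\<And>V. V \<in> X \<Longrightarrow> V \<inter> W = U \<inter> W \<Longrightarrow> x \<in> \<Phi> V \<longleftrightarrow> x \<in> \<Phi> U"
    by (rule window[OF U xc]) blast
  have V: "U \<inter> W \<in> X" by (rule admissible_subset[OF U]) blast
  have "x \<in> \<Phi> (U \<inter> W)" using W(2)[OF V] x by blast
  then have "x \<in> (U \<inter> W) #> f" using image_subset_translate_finite[OF f _ V] W(1) by blast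
  then show "x \<in> U #> f" by (auto simp: r_coset_def)
qed

end

section \<open>Centraliser and normaliser of the translations\<close>

lemma subgroup_homeomorphisms:
  "subgroup {f \<in> Bij (topspace T). homeomorphic_map T T f} (BijGroup (topspace T))"
proof (rule group.subgroupI[OF group_BijGroup])
  let ?S = "topspace T"
  show "{f \<in> Bij ?S. homeomorphic_map T T f} \<subseteq> carrier (BijGroup ?S)" by (auto simp: BijGroup_def)
  have "homeomorphic_map T T (\<lambda>x\<in>?S. x)"
    by (rule homeomorphic_map_eq[of T T id]) auto
  then show "{f \<in> Bij ?S. homeomorphic_map T T f} \<noteq> {}" using id_Bij by blast
next
  let ?S = "topspace T"
  fix f assume f: "f \<in> {f \<in> Bij ?S. homeomorphic_map T T f}"
  then obtain g where g: "homeomorphic_maps T T f g" using homeomorphic_map_maps by blast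
  then have gm: "homeomorphic_map T T g" using homeomorphic_maps_sym homeomorphic_map_maps by blast
  have bij: "bij_betw f ?S ?S" using f by (simp add: Bij_def)
  have gS: "g y \<in> ?S" if "y \<in> ?S" for y
    using gm that homeomorphic_imp_surjective_map by blast
  have "inv_into ?S f y = g y" if y: "y \<in> ?S" for y
    using g y gS[OF y] bij unfolding homeomorphic_maps_def by (metis bij_betw_inv_into_left)
  then have "homeomorphic_map T T (\<lambda>x\<in>?S. inv_into ?S f x)"
    by (intro homeomorphic_map_eq[OF gm]) auto
  then show "inv\<^bsub>BijGroup ?S\<^esub> f \<in> {f \<in> Bij ?S. homeomorphic_map T T f}"
    using f by (simp add: inv_BijGroup restrict_inv_into_Bij)
next
  let ?S = "topspace T"
  fix f g assume fg: "f \<in> {f \<in> Bij ?S. homeomorphic_map T T f}" "g \<in> {f \<in> Bij ?S. homeomorphic_map T T f}"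
  have "homeomorphic_map T T (compose ?S f g)"
  proof (rule homeomorphic_map_eq)
    show "homeomorphic_map T T (f \<circ> g)" using fg by (intro homeomorphic_map_compose[of T T g T f]) auto
  qed (simp add: compose_def)
  then show "f \<otimes>\<^bsub>BijGroup ?S\<^esub> g \<in> {f \<in> Bij ?S. homeomorphic_map T T f}"
    using fg by (simp add: BijGroup_def compose_Bij)
qed

lemma group_homeo_group: "group (homeo_group T)"
  unfolding homeo_group_def by (rule subgroup.subgroup_is_group[OF subgroup_homeomorphisms group_BijGroup])

lemma mult_homeo_group:
  "f \<in> carrier (homeo_group T) \<Longrightarrow> g \<in> carrier (homeo_group T) \<Longrightarrow> x \<in> topspace T \<Longrightarrow> (f \<otimes>\<^bsub>homeo_group T\<^esub> g) x = f (g x)"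
  by (simp add: homeo_group_def BijGroup_def compose_def)

lemma carrier_homeo_group: "f \<in> carrier (homeo_group T) \<longleftrightarrow> f \<in> Bij (topspace T) \<and> homeomorphic_map T T f"
  by (simp add: homeo_group_def)

lemma homeo_group_eqI:
  assumes "f \<in> carrier (homeo_group T)" "g \<in> carrier (homeo_group T)" "\<And>x. x \<in> topspace T \<Longrightarrow> f x = g x"
  shows "f = g"
  using assms by (intro extensionalityI[of f "topspace T" g]) (auto simp: carrier_homeo_group Bij_def)

lemma image_inverse: "(\<And>u. u \<in> U \<Longrightarrow> g (f u) = u) \<Longrightarrow> g ` f ` U = U"
  by (simp add: image_image)

lemma mem_image_inverse:
  assumes "\<And>v. v \<in> V \<Longrightarrow> g (f v) = v" "f (g x) = x"
  shows "x \<in> f ` V \<longleftrightarrow> g x \<in> V"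
proof
  assume "g x \<in> V"
  then have "f (g x) \<in> f ` V" by (rule imageI)
  then show "x \<in> f ` V" by (simp add: assms(2))
qed (use assms(1) in auto)

lemma (in group) normalizer_conj:
  assumes H: "H \<subseteq> carrier G" and g: "g \<in> normalizer G H" and h: "h \<in> H"
  shows "g \<otimes> h \<otimes> inv g \<in> H"
proof -
  have "g <# H #> inv g = H" using g H by (simp add: normalizer_def stabilizer_def)
  moreover have "g \<otimes> h \<otimes> inv g \<in> g <# H #> inv g" using h by (auto simp: r_coset_def l_coset_def)
  ultimately show ?thesis by simp
qed

lemma (in group) normalizerI:
  assumes H: "H \<subseteq> carrier G" and g: "g \<in> carrier G"
    and "\<And>h. h \<in> H \<Longrightarrow> g \<otimes> h \<otimes> inv g \<in> H" "\<And>h. h \<in> H \<Longrightarrow> inv g \<otimes> h \<otimes> g \<in> H"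
  shows "g \<in> normalizer G H"
proof -
  have "g <# H #> inv g = H"
  proof (intro equalityI subsetI)
    fix x assume "x \<in> g <# H #> inv g"
    then show "x \<in> H" using assms(3) by (auto simp: r_coset_def l_coset_def)
  next
    fix h assume h: "h \<in> H"
    then have "h \<in> carrier G" using H by blast
    then have "h = g \<otimes> (inv g \<otimes> h \<otimes> g) \<otimes> inv g" using g by (simp add: m_assoc) (simp flip: m_assoc)
    then show "h \<in> g <# H #> inv g" using assms(4)[OF h] by (auto simp: r_coset_def l_coset_def)
  qed
  then show ?thesis using g H by (simp add: normalizer_def stabilizer_def)
qed

context sieve_system begin

definition A where "A = Aut_space G X"
definition S where "S = shift_group G X"
abbreviation sh where "sh \<equiv> shift_map G X"

text \<open>
  Continuity of a self-map of \<open>X\<close>, in the pointwise form used above.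
\<close>
definition windowed :: "('a set \<Rightarrow> 'a set) \<Rightarrow> bool" where
  "windowed f \<longleftrightarrow> (\<forall>U\<in>X. \<forall>x\<in>carrier G. \<exists>F. finite F \<and> F \<subseteq> carrier G \<and>
     (\<forall>V\<in>X. V \<inter> F = U \<inter> F \<longrightarrow> (x \<in> f V \<longleftrightarrow> x \<in> f U)))"

lemma X_carrier: "U \<in> X \<Longrightarrow> U \<subseteq> carrier G"
  by (simp add: admissible_iff)

lemma Pow_Int_X [simp]: "Pow (carrier G) \<inter> X = X"
  using X_carrier by auto

lemma continuous_iff_windowed:
  "f \<in> X \<rightarrow> X \<Longrightarrow> continuous_map (subtopology (powerset_topology (carrier G)) X) (subtopology (powerset_topology (carrier G)) X) f \<longleftrightarrow> windowed f"
  unfolding windowed_def by (rule continuous_map_powerset_iff) (use X_carrier in auto)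

lemma group_A: "group A"
  by (simp add: A_def Aut_space_def group_homeo_group)

interpretation A: group A by (rule group_A)

lemma A_Bij: "f \<in> carrier A \<Longrightarrow> f \<in> Bij X"
  by (simp add: A_def Aut_space_def carrier_homeo_group)

lemma A_closed: "f \<in> carrier A \<Longrightarrow> U \<in> X \<Longrightarrow> f U \<in> X"
  using Bij_imp_funcset[OF A_Bij] by blast

lemma A_windowed: "f \<in> carrier A \<Longrightarrow> windowed f"
  using continuous_iff_windowed[of f] A_closed[of f] homeomorphic_imp_continuous_map
  by (auto simp: A_def Aut_space_def carrier_homeo_group)

lemma A_mult: "f \<in> carrier A \<Longrightarrow> g \<in> carrier A \<Longrightarrow> U \<in> X \<Longrightarrow> (f \<otimes>\<^bsub>A\<^esub> g) U = f (g U)"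
  unfolding A_def Aut_space_def by (rule mult_homeo_group) simp_all

lemma A_eqI: "f \<in> carrier A \<Longrightarrow> g \<in> carrier A \<Longrightarrow> (\<And>U. U \<in> X \<Longrightarrow> f U = g U) \<Longrightarrow> f = g"
proof -
  assume f: "f \<in> carrier A" and g: "g \<in> carrier A" and eq: "\<And>U. U \<in> X \<Longrightarrow> f U = g U"
  show "f = g" using f g unfolding A_def Aut_space_def
  proof (rule homeo_group_eqI)
    fix U assume "U \<in> topspace (subtopology (powerset_topology (carrier G)) X)"
    then show "f U = g U" by (intro eq) simp
  qed
qed

lemma A_one: "U \<in> X \<Longrightarrow> \<one>\<^bsub>A\<^esub> U = U"
  by (simp add: A_def Aut_space_def homeo_group_def BijGroup_def)

lemma A_inv: "f \<in> carrier A \<Longrightarrow> U \<in> X \<Longrightarrow> (inv\<^bsub>A\<^esub> f) (f U) = U" "f \<in> carrier A \<Longrightarrow> U \<in> X \<Longrightarrow> f ((inv\<^bsub>A\<^esub> f) U) = U"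
  using A_mult[of "inv\<^bsub>A\<^esub> f" f U] A_mult[of f "inv\<^bsub>A\<^esub> f" U] A_one[of U] by simp_all

lemma A_memI:
  assumes "f \<in> extensional X" "\<And>U. U \<in> X \<Longrightarrow> f U \<in> X" "\<And>U. U \<in> X \<Longrightarrow> g U \<in> X"
    "\<And>U. U \<in> X \<Longrightarrow> g (f U) = U" "\<And>U. U \<in> X \<Longrightarrow> f (g U) = U" "windowed f" "windowed g"
  shows "f \<in> carrier A"
proof -
  have "bij_betw f X X" by (rule bij_betw_byWitness[of X g f X]) (use assms in auto)
  moreover have "homeomorphic_maps (subtopology (powerset_topology (carrier G)) X) (subtopology (powerset_topology (carrier G)) X) f g"
    unfolding homeomorphic_maps_def using assms continuous_iff_windowed[of f] continuous_iff_windowed[of g] by auto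
  ultimately show ?thesis
    using assms(1) homeomorphic_map_maps by (auto simp: A_def Aut_space_def carrier_homeo_group Bij_def)
qed

lemma sh_apply: "U \<in> X \<Longrightarrow> sh t U = U #> inv t"
  by (simp add: shift_map_def)

lemma translate_X: "U \<in> X \<Longrightarrow> t \<in> carrier G \<Longrightarrow> U #> t \<in> X"
  by (rule translate_admissible)

lemma singleton_X: "x \<in> carrier G \<Longrightarrow> {x} \<in> X"
  by (rule singleton_admissible)

lemma sh_A: "t \<in> carrier G \<Longrightarrow> sh t \<in> carrier A"
proof -
  have w: "windowed (sh t)" if t: "t \<in> carrier G" for t
    unfolding windowed_def
  proof (intro ballI)
    fix U x assume U: "U \<in> X" and x: "x \<in> carrier G"
    have "x \<in> sh t V \<longleftrightarrow> x \<otimes> t \<in> V" if "V \<in> X" for V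
      using mem_translate_iff[OF X_carrier[OF that], of "inv t" x] t x by (simp add: sh_apply that)
    then show "\<exists>F. finite F \<and> F \<subseteq> carrier G \<and> (\<forall>V\<in>X. V \<inter> F = U \<inter> F \<longrightarrow> (x \<in> sh t V \<longleftrightarrow> x \<in> sh t U))"
      using U x t by (intro exI[of _ "{x \<otimes> t}"]) auto
  qed
  assume t: "t \<in> carrier G"
  show ?thesis
  proof (rule A_memI[where g = "sh (inv t)"])
    show "sh t \<in> extensional X" by (simp add: shift_map_def)
    show "windowed (sh t)" by (rule w[OF t])
    show "windowed (sh (inv t))" by (rule w) (use t in simp)
  qed (use t in \<open>auto simp: sh_apply translate_X coset_mult_assoc X_carrier coset_mult_one\<close>)
qed

lemma sh_mult: "s \<in> carrier G \<Longrightarrow> t \<in> carrier G \<Longrightarrow> sh (s \<otimes> t) = sh s \<otimes>\<^bsub>A\<^esub> sh t"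
  by (rule A_eqI)
    (auto simp: sh_A A_mult sh_apply translate_X coset_mult_assoc X_carrier inv_mult_group m_comm)

lemma sh_inj: "inj_on sh (carrier G)"
proof (rule inj_onI)
  fix s t assume st: "s \<in> carrier G" "t \<in> carrier G" "sh s = sh t"
  have "{\<one>} #> inv s = {\<one>} #> inv t"
    using fun_cong[OF st(3), of "{\<one>}"] by (simp only: sh_apply singleton_X one_closed)
  then have "inv s = inv t" using st(1,2) by (simp add: r_coset_def)
  then show "s = t" using st(1,2) by (metis inv_inv)
qed

lemma sh_hom: "sh \<in> hom G A"
  by (auto simp: hom_def sh_A sh_mult)

lemma S_eq: "S = sh ` carrier G"
  by (simp add: S_def shift_group_def)

lemma subgroup_S: "subgroup S A"
proof -
  interpret h: group_hom G A sh using sh_hom is_group group_A by (simp add: group_hom_def group_hom_axioms_def)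
  show ?thesis using h.img_is_subgroup by (simp add: S_eq)
qed

lemma S_sub: "S \<subseteq> carrier A"
  using sh_A by (auto simp: S_eq)

lemma twisted_symmetryI:
  assumes f: "f \<in> carrier A" and \<alpha>: "\<alpha> \<in> hom G G" "bij_betw \<alpha> (carrier G) (carrier G)"
    and tw: "\<And>t. t \<in> carrier G \<Longrightarrow> f \<otimes>\<^bsub>A\<^esub> sh t = sh (\<alpha> t) \<otimes>\<^bsub>A\<^esub> f"
  shows "twisted_symmetry G L f \<alpha>"
proof -
  have "f (U #> t) = f U #> \<alpha> t" if U: "U \<in> X" and t: "t \<in> carrier G" for U t
  proof -
    have \<alpha>t: "\<alpha> (inv t) \<in> carrier G" using \<alpha>(1) t by (auto simp: hom_def)
    have "f (sh (inv t) U) = sh (\<alpha> (inv t)) (f U)"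
      using fun_cong[OF tw[of "inv t"], of U] f U t sh_A \<alpha>t by (simp add: A_mult)
    moreover have "\<alpha> (inv t) = inv (\<alpha> t)"
      using group_hom.hom_inv[of G G \<alpha> t] \<alpha>(1) t is_group by (simp add: group_hom_def group_hom_axioms_def)
    moreover have "\<alpha> t \<in> carrier G" using \<alpha>(1) t by (auto simp: hom_def)
    ultimately show ?thesis using U t A_closed[OF f U] by (simp add: sh_apply)
  qed
  then show ?thesis
    using A_Bij[OF f] \<alpha> bspec[OF bspec[OF A_windowed[OF f, unfolded windowed_def]]]
    by (intro twisted_symmetry.intro twisted_symmetry_axioms.intro sieve_system_axioms) (simp_all add: Bij_def)
qed

lemma shift_symmetryI:
  assumes f: "f \<in> carrier A" and c: "\<And>t. t \<in> carrier G \<Longrightarrow> f \<otimes>\<^bsub>A\<^esub> sh t = sh t \<otimes>\<^bsub>A\<^esub> f"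
  shows "shift_symmetry G L f"
  unfolding shift_symmetry_def by (rule twisted_symmetryI[OF f]) (use c in \<open>auto simp: hom_def bij_betw_def\<close>)

text \<open>
  Apply the previous inclusion to \<open>f\<close> and to its inverse: with \<open>h \<in> f {1}\<close> and \<open>k\<close> in the
  image of \<open>{1}\<close> under the inverse, one gets \<open>f U \<subseteq> U h\<close> and \<open>U \<subseteq> (f U) k\<close>, and evaluating
  at \<open>{1}\<close> shows \<open>h k = 1\<close>.
\<close>
theorem commuting_homeomorphism_is_shift:
  assumes f: "f \<in> carrier A" and c: "\<And>t. t \<in> carrier G \<Longrightarrow> f \<otimes>\<^bsub>A\<^esub> sh t = sh t \<otimes>\<^bsub>A\<^esub> f"
  shows "f \<in> S"
proof -
  let ?g = "inv\<^bsub>A\<^esub> f"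
  have g: "?g \<in> carrier A" using f by simp
  have cg: "?g \<otimes>\<^bsub>A\<^esub> sh t = sh t \<otimes>\<^bsub>A\<^esub> ?g" if t: "t \<in> carrier G" for t
  proof -
    have "sh t = ?g \<otimes>\<^bsub>A\<^esub> (sh t \<otimes>\<^bsub>A\<^esub> f)" using A.inv_solve_left[of "sh t" f "sh t \<otimes>\<^bsub>A\<^esub> f"] c[OF t] f sh_A[OF t] by simp
    then have "sh t = (?g \<otimes>\<^bsub>A\<^esub> sh t) \<otimes>\<^bsub>A\<^esub> f" using f sh_A[OF t] by (simp add: A.m_assoc)
    then show ?thesis using A.inv_solve_right[of "?g \<otimes>\<^bsub>A\<^esub> sh t" "sh t" f] f sh_A[OF t] by simp
  qed
  interpret f: shift_symmetry G L f by (rule shift_symmetryI[OF f c])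
  interpret g: shift_symmetry G L ?g by (rule shift_symmetryI[OF g cg])
  have one: "{\<one>} \<in> X" by (rule singleton_X[OF one_closed])
  obtain h where h: "h \<in> f {\<one>}" using f.image_of_one_nonempty by blast
  obtain k where k: "k \<in> ?g {\<one>}" using g.image_of_one_nonempty by blast
  have hc: "h \<in> carrier G" using h X_carrier[OF A_closed[OF f one]] by blast
  have kc: "k \<in> carrier G" using k X_carrier[OF A_closed[OF g one]] by blast
  have fsub: "f U \<subseteq> U #> h" if "U \<in> X" for U using f.image_subset_translate[OF h] that by blast
  have gsub: "?g U \<subseteq> U #> k" if "U \<in> X" for U using g.image_subset_translate[OF k] that by blast
  have "f {\<one>} = {h}" using fsub[OF one] h hc by (auto simp: r_coset_def)
  then have "?g {h} = {\<one>}" using A_inv(1)[OF f one] by simp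
  then have hk: "h \<otimes> k = \<one>" using gsub[OF singleton_X[OF hc]] by (auto simp: r_coset_def)
  have fU: "f U = U #> h" if U: "U \<in> X" for U
  proof
    show "f U \<subseteq> U #> h" by (rule fsub[OF U])
    have fU: "f U \<in> X" by (rule A_closed[OF f U])
    have "U \<subseteq> f U #> k" using gsub[OF fU] A_inv(1)[OF f U] by simp
    then have "U #> h \<subseteq> (f U #> k) #> h" by (auto simp: r_coset_def)
    also have "\<dots> = f U" using X_carrier[OF fU] hc kc hk by (simp add: coset_mult_assoc m_comm coset_mult_one)
    finally show "U #> h \<subseteq> f U" .
  qed
  have "f = sh (inv h)"
    by (rule A_eqI[OF f sh_A]) (use hc fU in \<open>simp_all add: sh_apply\<close>)
  then show ?thesis using hc by (simp add: S_eq)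
qed

theorem centralizer_eq_shifts: "centralizer A S = S"
proof
  show "centralizer A S \<subseteq> S"
    using commuting_homeomorphism_is_shift by (auto simp: centralizer_def S_eq)
  show "S \<subseteq> centralizer A S"
    using S_sub sh_mult by (auto simp: centralizer_def S_eq m_comm simp flip: sh_mult)
qed

definition R where "R = normalizer A S"

lemma subgroup_R: "subgroup R A"
  unfolding R_def by (rule A.normalizer_imp_subgroup[OF S_sub])

lemma R_A: "g \<in> R \<Longrightarrow> g \<in> carrier A"
  using subgroup.subset[OF subgroup_R] by blast

lemma R_inv: "g \<in> R \<Longrightarrow> inv\<^bsub>A\<^esub> g \<in> R"
  by (rule subgroup.m_inv_closed[OF subgroup_R])

text \<open>
  The automorphism of the group by which an element of the normaliser permutes the
  translations.
\<close>
definition conj_aut :: "('a set \<Rightarrow> 'a set) \<Rightarrow> 'a \<Rightarrow> 'a" where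
  "conj_aut g = (\<lambda>t\<in>carrier G. inv_into (carrier G) sh (g \<otimes>\<^bsub>A\<^esub> sh t \<otimes>\<^bsub>A\<^esub> inv\<^bsub>A\<^esub> g))"

lemma conj_aut:
  assumes g: "g \<in> R" and t: "t \<in> carrier G"
  shows "conj_aut g t \<in> carrier G" "sh (conj_aut g t) = g \<otimes>\<^bsub>A\<^esub> sh t \<otimes>\<^bsub>A\<^esub> inv\<^bsub>A\<^esub> g"
proof -
  have m: "g \<otimes>\<^bsub>A\<^esub> sh t \<otimes>\<^bsub>A\<^esub> inv\<^bsub>A\<^esub> g \<in> sh ` carrier G"
    using A.normalizer_conj[OF S_sub, of g "sh t"] g t by (auto simp: R_def S_eq)
  then show "conj_aut g t \<in> carrier G" using t by (simp add: conj_aut_def inv_into_into)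
  show "sh (conj_aut g t) = g \<otimes>\<^bsub>A\<^esub> sh t \<otimes>\<^bsub>A\<^esub> inv\<^bsub>A\<^esub> g" using t f_inv_into_f[OF m] by (simp add: conj_aut_def)
qed

lemma sh_eqD: "s \<in> carrier G \<Longrightarrow> t \<in> carrier G \<Longrightarrow> sh s = sh t \<Longrightarrow> s = t"
  using sh_inj by (rule inj_onD)

text \<open>
  By this relation \<open>g\<close> is a twisted symmetry for its automorphism.
\<close>
lemma conj_aut_twist:
  assumes g: "g \<in> R" and t: "t \<in> carrier G"
  shows "g \<otimes>\<^bsub>A\<^esub> sh t = sh (conj_aut g t) \<otimes>\<^bsub>A\<^esub> g"
  using conj_aut(2)[OF g t] R_A[OF g] sh_A[OF t] by (simp add: A.m_assoc)

lemma conj_aut_inverse: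
  assumes g: "g \<in> R" and t: "t \<in> carrier G"
  shows "conj_aut (inv\<^bsub>A\<^esub> g) (conj_aut g t) = t"
proof (rule sh_eqD)
  have "inv\<^bsub>A\<^esub> g \<otimes>\<^bsub>A\<^esub> (g \<otimes>\<^bsub>A\<^esub> sh t \<otimes>\<^bsub>A\<^esub> inv\<^bsub>A\<^esub> g) \<otimes>\<^bsub>A\<^esub> g = (inv\<^bsub>A\<^esub> g \<otimes>\<^bsub>A\<^esub> g) \<otimes>\<^bsub>A\<^esub> sh t \<otimes>\<^bsub>A\<^esub> (inv\<^bsub>A\<^esub> g \<otimes>\<^bsub>A\<^esub> g)"
    using R_A[OF g] sh_A[OF t] by (simp only: A.m_assoc A.m_closed A.inv_closed)
  then show "sh (conj_aut (inv\<^bsub>A\<^esub> g) (conj_aut g t)) = sh t"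
    using R_A[OF g] sh_A[OF t] by (simp add: conj_aut[OF R_inv[OF g]] conj_aut[OF g] t)
qed (use conj_aut g R_inv t in auto)

lemma conj_aut_bij: "g \<in> R \<Longrightarrow> bij_betw (conj_aut g) (carrier G) (carrier G)"
  using conj_aut_inverse[of g] conj_aut_inverse[of "inv\<^bsub>A\<^esub> g"] conj_aut(1) R_inv R_A
  by (intro bij_betw_byWitness[of _ "conj_aut (inv\<^bsub>A\<^esub> g)"]) auto

lemma conj_aut_auto: "g \<in> R \<Longrightarrow> conj_aut g \<in> auto G"
proof -
  assume g: "g \<in> R"
  have "conj_aut g (s \<otimes> t) = conj_aut g s \<otimes> conj_aut g t" if st: "s \<in> carrier G" "t \<in> carrier G" for s t
  proof (rule sh_eqD)
    note c = conj_aut[OF g]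
    have "g \<otimes>\<^bsub>A\<^esub> (sh s \<otimes>\<^bsub>A\<^esub> sh t) \<otimes>\<^bsub>A\<^esub> inv\<^bsub>A\<^esub> g =
        (g \<otimes>\<^bsub>A\<^esub> sh s) \<otimes>\<^bsub>A\<^esub> (inv\<^bsub>A\<^esub> g \<otimes>\<^bsub>A\<^esub> g) \<otimes>\<^bsub>A\<^esub> (sh t \<otimes>\<^bsub>A\<^esub> inv\<^bsub>A\<^esub> g)"
      using R_A[OF g] sh_A st by (simp add: A.m_assoc)
    also have "\<dots> = (g \<otimes>\<^bsub>A\<^esub> sh s \<otimes>\<^bsub>A\<^esub> inv\<^bsub>A\<^esub> g) \<otimes>\<^bsub>A\<^esub> (g \<otimes>\<^bsub>A\<^esub> sh t \<otimes>\<^bsub>A\<^esub> inv\<^bsub>A\<^esub> g)"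
      using R_A[OF g] sh_A st by (simp only: A.m_assoc A.m_closed A.inv_closed)
    finally show "sh (conj_aut g (s \<otimes> t)) = sh (conj_aut g s \<otimes> conj_aut g t)"
      using c st by (simp add: sh_mult)
  qed (use conj_aut(1)[OF g] st in auto)
  then show ?thesis
    using conj_aut(1)[OF g] conj_aut_bij[OF g] by (auto simp: auto_def hom_def Bij_def conj_aut_def)
qed

definition admissible_automorphisms where
  "admissible_automorphisms = {\<alpha> \<in> auto G. \<forall>U. U \<subseteq> carrier G \<longrightarrow> (\<alpha> ` U \<in> X \<longleftrightarrow> U \<in> X)}"

text \<open>
  Both \<open>g\<close> and its inverse are twisted symmetries, and their automorphisms are inverse to
  each other.
\<close>
lemma conj_aut_admissible:
  assumes g: "g \<in> R"
  shows "conj_aut g \<in> admissible_automorphisms"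
proof -
  have pres: "conj_aut g ` U \<in> X" if g: "g \<in> R" and U: "U \<in> X" for g U
  proof -
    have "twisted_symmetry G L g (conj_aut g)"
      by (rule twisted_symmetryI[OF R_A[OF g]])
        (use conj_aut_auto[OF g] conj_aut_bij[OF g] conj_aut_twist[OF g] in \<open>auto simp: auto_def\<close>)
    then show ?thesis
      using twisted_symmetry.automorphism_preserves_admissible U by blast
  qed
  have "U \<in> X" if U: "U \<subseteq> carrier G" "conj_aut g ` U \<in> X" for U
  proof -
    have "conj_aut (inv\<^bsub>A\<^esub> g) ` conj_aut g ` U = U"
      by (rule image_inverse) (use conj_aut_inverse[OF g] U(1) in blast)
    then show ?thesis using pres[OF R_inv[OF g] U(2)] by simp
  qed
  then show ?thesis using pres[OF g] conj_aut_auto[OF g] unfolding admissible_automorphisms_def by blast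
qed

definition induced :: "('a \<Rightarrow> 'a) \<Rightarrow> 'a set \<Rightarrow> 'a set" where
  "induced \<alpha> = (\<lambda>U\<in>X. \<alpha> ` U)"

lemma admissible_automorphismsD:
  assumes "\<alpha> \<in> admissible_automorphisms"
  shows "\<alpha> \<in> auto G" "U \<subseteq> carrier G \<Longrightarrow> \<alpha> ` U \<in> X \<longleftrightarrow> U \<in> X" "bij_betw \<alpha> (carrier G) (carrier G)"
    "t \<in> carrier G \<Longrightarrow> \<alpha> t \<in> carrier G" "\<alpha> \<in> hom G G"
  using assms by (auto simp: admissible_automorphisms_def auto_def Bij_def bij_betw_def)

lemma subgroup_admissible_automorphisms: "subgroup admissible_automorphisms (AutoGroup G)"
proof (rule group.subgroupI[OF AutoGroup])
  show "admissible_automorphisms \<subseteq> carrier (AutoGroup G)"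
    by (auto simp: admissible_automorphisms_def AutoGroup_def)
  have "(\<lambda>x\<in>carrier G. x) \<in> admissible_automorphisms"
  proof -
    have "(\<lambda>x\<in>carrier G. x) ` U = U" if "U \<subseteq> carrier G" for U using that by (force simp: image_iff)
    then show ?thesis using id_in_auto by (simp add: admissible_automorphisms_def)
  qed
  then show "admissible_automorphisms \<noteq> {}" by blast
next
  fix \<alpha> assume a: "\<alpha> \<in> admissible_automorphisms"
  note aD = admissible_automorphismsD[OF a]
  have B: "\<alpha> \<in> Bij (carrier G)" using aD(1) by (simp add: auto_def)
  have i: "inv\<^bsub>AutoGroup G\<^esub> \<alpha> = (\<lambda>x\<in>carrier G. inv_into (carrier G) \<alpha> x)"
    using group.m_inv_consistent[OF group_BijGroup subgroup_auto aD(1)] inv_BijGroup[OF B] by (simp add: AutoGroup_def)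
  have "inv\<^bsub>AutoGroup G\<^esub> \<alpha> \<in> auto G"
    using group.inv_closed[OF AutoGroup, of \<alpha>] aD(1) by (simp add: AutoGroup_def)
  moreover have "(inv\<^bsub>AutoGroup G\<^esub> \<alpha>) ` U \<in> X \<longleftrightarrow> U \<in> X" if U: "U \<subseteq> carrier G" for U
  proof -
    let ?V = "(inv\<^bsub>AutoGroup G\<^esub> \<alpha>) ` U"
    have V: "?V \<subseteq> carrier G" unfolding i using U aD(3) by (auto simp: bij_betw_def subset_iff intro!: inv_into_into)
    have "\<alpha> ` ?V = U" unfolding i
      by (rule image_inverse) (use U in \<open>auto simp: bij_betw_inv_into_right[OF aD(3)] subset_iff\<close>)
    then show ?thesis using aD(2)[OF V] by simp
  qed
  ultimately show "inv\<^bsub>AutoGroup G\<^esub> \<alpha> \<in> admissible_automorphisms" by (simp add: admissible_automorphisms_def)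
next
  fix \<alpha> \<beta> assume a: "\<alpha> \<in> admissible_automorphisms" and b: "\<beta> \<in> admissible_automorphisms"
  note aD = admissible_automorphismsD[OF a] and bD = admissible_automorphismsD[OF b]
  have m: "\<alpha> \<otimes>\<^bsub>AutoGroup G\<^esub> \<beta> = compose (carrier G) \<alpha> \<beta>"
    using aD(1) bD(1) by (simp add: AutoGroup_def BijGroup_def auto_def)
  have "\<alpha> \<otimes>\<^bsub>AutoGroup G\<^esub> \<beta> \<in> auto G"
    using monoid.m_closed[OF group.is_monoid[OF AutoGroup], of \<alpha> \<beta>] aD(1) bD(1) by (simp add: AutoGroup_def)
  moreover have "(\<alpha> \<otimes>\<^bsub>AutoGroup G\<^esub> \<beta>) ` U \<in> X \<longleftrightarrow> U \<in> X" if U: "U \<subseteq> carrier G" for U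
  proof -
    have "(\<alpha> \<otimes>\<^bsub>AutoGroup G\<^esub> \<beta>) ` U = \<alpha> ` \<beta> ` U" unfolding m image_image using U by (intro image_cong) (auto simp: compose_def)
    moreover have "\<beta> ` U \<subseteq> carrier G" using U bD(4) by blast
    ultimately show ?thesis using aD(2) bD(2)[OF U] by simp
  qed
  ultimately show "\<alpha> \<otimes>\<^bsub>AutoGroup G\<^esub> \<beta> \<in> admissible_automorphisms" by (simp add: admissible_automorphisms_def)
qed

lemma induced_apply: "U \<in> X \<Longrightarrow> induced \<alpha> U = \<alpha> ` U"
  by (simp add: induced_def)

lemma induced_A:
  assumes a: "\<alpha> \<in> admissible_automorphisms"
  shows "induced \<alpha> \<in> carrier A"
proof -
  note aD = admissible_automorphismsD[OF a]
  let ?\<beta> = "inv_into (carrier G) \<alpha>"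
  have inj: "inj_on \<alpha> (carrier G)" using aD(3) by (simp add: bij_betw_def)
  have \<beta>c: "?\<beta> x \<in> carrier G" if "x \<in> carrier G" for x using aD(3) that by (simp add: bij_betw_def inv_into_into)
  have \<alpha>\<beta>: "\<alpha> (?\<beta> x) = x" if "x \<in> carrier G" for x using aD(3) that by (rule bij_betw_inv_into_right)
  have \<beta>\<alpha>: "?\<beta> (\<alpha> x) = x" if "x \<in> carrier G" for x using aD(3) that by (rule bij_betw_inv_into_left)
  have \<alpha>\<beta>U: "\<alpha> ` ?\<beta> ` U = U" and \<beta>\<alpha>U: "?\<beta> ` \<alpha> ` U = U" if "U \<subseteq> carrier G" for U
    by (rule image_inverse, use \<alpha>\<beta> that in blast) (rule image_inverse, use \<beta>\<alpha> that in blast)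
  have \<beta>X: "?\<beta> ` U \<in> X" if U: "U \<in> X" for U
  proof -
    have "?\<beta> ` U \<subseteq> carrier G" using X_carrier[OF U] \<beta>c by blast
    from aD(2)[OF this] show ?thesis using \<alpha>\<beta>U[OF X_carrier[OF U]] U by simp
  qed
  have \<alpha>X: "\<alpha> ` U \<in> X" if "U \<in> X" for U using aD(2)[OF X_carrier[OF that]] that by simp
  have mem\<alpha>: "x \<in> \<alpha> ` V \<longleftrightarrow> ?\<beta> x \<in> V" if "x \<in> carrier G" "V \<subseteq> carrier G" for x V
    by (rule mem_image_inverse) (use that \<alpha>\<beta> \<beta>\<alpha> in blast)+
  have mem\<beta>: "x \<in> ?\<beta> ` V \<longleftrightarrow> \<alpha> x \<in> V" if "x \<in> carrier G" "V \<subseteq> carrier G" for x V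
    by (rule mem_image_inverse) (use that \<alpha>\<beta> \<beta>\<alpha> in blast)+
  show ?thesis
  proof (rule A_memI[where g = "\<lambda>U. ?\<beta> ` U"])
    show "windowed (induced \<alpha>)"
      unfolding windowed_def
    proof (intro ballI)
      fix U x assume "U \<in> X" "x \<in> carrier G"
      then show "\<exists>F. finite F \<and> F \<subseteq> carrier G \<and> (\<forall>V\<in>X. V \<inter> F = U \<inter> F \<longrightarrow> (x \<in> induced \<alpha> V \<longleftrightarrow> x \<in> induced \<alpha> U))"
        using \<beta>c by (intro exI[of _ "{?\<beta> x}"]) (auto simp: induced_apply mem\<alpha> X_carrier)
    qed
    show "windowed (\<lambda>U. ?\<beta> ` U)"
      unfolding windowed_def
    proof (intro ballI)
      fix U x assume "U \<in> X" "x \<in> carrier G"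
      then show "\<exists>F. finite F \<and> F \<subseteq> carrier G \<and> (\<forall>V\<in>X. V \<inter> F = U \<inter> F \<longrightarrow> (x \<in> ?\<beta> ` V \<longleftrightarrow> x \<in> ?\<beta> ` U))"
        using aD(4) by (intro exI[of _ "{\<alpha> x}"]) (auto simp: mem\<beta> X_carrier)
    qed
  qed (use \<beta>X \<alpha>X \<alpha>\<beta>U \<beta>\<alpha>U X_carrier in \<open>auto simp: induced_def\<close>)
qed

lemma induced_mult:
  assumes a: "\<alpha> \<in> admissible_automorphisms" and b: "\<beta> \<in> admissible_automorphisms"
  shows "induced (\<alpha> \<otimes>\<^bsub>AutoGroup G\<^esub> \<beta>) = induced \<alpha> \<otimes>\<^bsub>A\<^esub> induced \<beta>"
proof (rule A_eqI)
  note aD = admissible_automorphismsD[OF a] and bD = admissible_automorphismsD[OF b]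
  show "induced (\<alpha> \<otimes>\<^bsub>AutoGroup G\<^esub> \<beta>) \<in> carrier A"
    by (rule induced_A[OF subgroup.m_closed[OF subgroup_admissible_automorphisms a b]])
  show "induced \<alpha> \<otimes>\<^bsub>A\<^esub> induced \<beta> \<in> carrier A" using induced_A[OF a] induced_A[OF b] by simp
  fix U assume U: "U \<in> X"
  have m: "\<alpha> \<otimes>\<^bsub>AutoGroup G\<^esub> \<beta> = compose (carrier G) \<alpha> \<beta>"
    using aD(1) bD(1) by (simp add: AutoGroup_def BijGroup_def auto_def)
  have "compose (carrier G) \<alpha> \<beta> ` U = \<alpha> ` \<beta> ` U"
    unfolding image_image using X_carrier[OF U] by (intro image_cong) (auto simp: compose_def)
  moreover have "\<beta> ` U \<in> X" using bD(2)[OF X_carrier[OF U]] U by simp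
  ultimately show "induced (\<alpha> \<otimes>\<^bsub>AutoGroup G\<^esub> \<beta>) U = (induced \<alpha> \<otimes>\<^bsub>A\<^esub> induced \<beta>) U"
    using U induced_A[OF a] induced_A[OF b] by (simp add: A_mult induced_apply m)
qed

lemma induced_inj: "inj_on induced admissible_automorphisms"
proof (rule inj_onI)
  fix \<alpha> \<beta> assume ab: "\<alpha> \<in> admissible_automorphisms" "\<beta> \<in> admissible_automorphisms" "induced \<alpha> = induced \<beta>"
  show "\<alpha> = \<beta>"
  proof (rule extensionalityI[of _ "carrier G"])
    show "\<alpha> \<in> extensional (carrier G)" "\<beta> \<in> extensional (carrier G)"
      using ab by (auto simp: admissible_automorphisms_def auto_def Bij_def)
    fix x assume x: "x \<in> carrier G"
    then show "\<alpha> x = \<beta> x" using fun_cong[OF ab(3), of "{x}"] singleton_X by (simp add: induced_apply)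
  qed
qed

lemma induced_twist:
  assumes a: "\<alpha> \<in> admissible_automorphisms" and t: "t \<in> carrier G"
  shows "induced \<alpha> \<otimes>\<^bsub>A\<^esub> sh t = sh (\<alpha> t) \<otimes>\<^bsub>A\<^esub> induced \<alpha>"
proof (rule A_eqI)
  note aD = admissible_automorphismsD[OF a]
  note mem = sh_A[OF t] sh_A[OF aD(4)[OF t]] induced_A[OF a]
  show "induced \<alpha> \<otimes>\<^bsub>A\<^esub> sh t \<in> carrier A" "sh (\<alpha> t) \<otimes>\<^bsub>A\<^esub> induced \<alpha> \<in> carrier A" using mem by auto
  fix U assume U: "U \<in> X"
  have \<alpha>i: "\<alpha> (inv t) = inv (\<alpha> t)"
    using group_hom.hom_inv[of G G \<alpha> t] aD(5) t is_group by (simp add: group_hom_def group_hom_axioms_def)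
  have "\<alpha> (u \<otimes> inv t) = \<alpha> u \<otimes> inv (\<alpha> t)" if "u \<in> U" for u
  proof -
    have "u \<in> carrier G" using that X_carrier[OF U] by blast
    then show ?thesis using aD(5) t by (simp add: hom_def \<alpha>i)
  qed
  then have "\<alpha> ` (U #> inv t) = \<alpha> ` U #> inv (\<alpha> t)"
    unfolding r_coset_def by (force simp: image_iff)
  then show "(induced \<alpha> \<otimes>\<^bsub>A\<^esub> sh t) U = (sh (\<alpha> t) \<otimes>\<^bsub>A\<^esub> induced \<alpha>) U"
    using U mem A_closed[OF mem(1) U] A_closed[OF mem(3) U] translate_X[OF U] t
    by (simp add: A_mult) (simp add: sh_apply induced_apply)
qed

definition H where "H = induced ` admissible_automorphisms"

lemma induced_iso: "induced \<in> iso (AutoGroup G\<lparr>carrier := admissible_automorphisms\<rparr>) (A\<lparr>carrier := H\<rparr>)"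
  using induced_inj induced_mult by (auto simp: iso_def hom_def bij_betw_def H_def)

lemma subgroup_H: "subgroup H A"
proof -
  interpret h: group_hom "AutoGroup G\<lparr>carrier := admissible_automorphisms\<rparr>" A induced
    using induced_A induced_mult group_A subgroup.subgroup_is_group[OF subgroup_admissible_automorphisms AutoGroup]
    by (auto simp: group_hom_def group_hom_axioms_def hom_def)
  show ?thesis using h.img_is_subgroup by (simp add: H_def)
qed

lemma H_sub_R: "H \<subseteq> R"
proof
  fix g assume "g \<in> H"
  then obtain \<alpha> where a: "\<alpha> \<in> admissible_automorphisms" "g = induced \<alpha>" by (auto simp: H_def)
  note aD = admissible_automorphismsD[OF a(1)]
  have g: "g \<in> carrier A" using induced_A a by simp
  show "g \<in> R"
    unfolding R_def
  proof (rule A.normalizerI[OF S_sub g])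
    fix h assume "h \<in> S"
    then obtain t where t: "t \<in> carrier G" "h = sh t" by (auto simp: S_eq)
    have "g \<otimes>\<^bsub>A\<^esub> h \<otimes>\<^bsub>A\<^esub> inv\<^bsub>A\<^esub> g = sh (\<alpha> t)"
      using induced_twist[OF a(1) t(1)] a(2) t(2) g sh_A[OF aD(4)[OF t(1)]] by (simp add: A.m_assoc)
    then show "g \<otimes>\<^bsub>A\<^esub> h \<otimes>\<^bsub>A\<^esub> inv\<^bsub>A\<^esub> g \<in> S" using aD(4)[OF t(1)] by (simp add: S_eq)
    obtain u where u: "u \<in> carrier G" "\<alpha> u = t" using aD(3) t(1) by (metis bij_betw_imp_surj_on imageE)
    have "g \<otimes>\<^bsub>A\<^esub> sh u = h \<otimes>\<^bsub>A\<^esub> g" using induced_twist[OF a(1) u(1)] a(2) t(2) u(2) by simp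
    then have "inv\<^bsub>A\<^esub> g \<otimes>\<^bsub>A\<^esub> (h \<otimes>\<^bsub>A\<^esub> g) = sh u"
      using g sh_A[OF u(1)] sh_A[OF t(1)] t(2) A.inv_solve_left'[of "sh u" g "h \<otimes>\<^bsub>A\<^esub> g"] by simp
    then have "inv\<^bsub>A\<^esub> g \<otimes>\<^bsub>A\<^esub> h \<otimes>\<^bsub>A\<^esub> g = sh u" using g sh_A[OF t(1)] t(2) by (simp add: A.m_assoc)
    then show "inv\<^bsub>A\<^esub> g \<otimes>\<^bsub>A\<^esub> h \<otimes>\<^bsub>A\<^esub> g \<in> S" using u(1) by (simp add: S_eq)
  qed
qed

lemma S_sub_R: "S \<subseteq> R"
proof
  fix g assume g: "g \<in> S"
  then have ig: "inv\<^bsub>A\<^esub> g \<in> S" by (rule subgroup.m_inv_closed[OF subgroup_S])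
  show "g \<in> R" unfolding R_def
    by (rule A.normalizerI[OF S_sub]) (use g ig S_sub subgroup.m_closed[OF subgroup_S] in auto)
qed

text \<open>
  An element \<open>g\<close> of the normaliser and the map induced by its automorphism twist
  translations in the same way, so they differ by a homeomorphism that commutes with
  translations, which is a translation. A translation by \<open>t\<close> moves \<open>{1}\<close> unless \<open>t = 1\<close>,
  whereas an automorphism fixes \<open>{1}\<close>.
\<close>
theorem normalizer_semidirect: "internal_semidirect (A\<lparr>carrier := R\<rparr>) S H"
  unfolding internal_semidirect_def
proof (intro conjI)
  have gR: "group (A\<lparr>carrier := R\<rparr>)" by (rule subgroup.subgroup_is_group[OF subgroup_R group_A])
  have invR: "inv\<^bsub>A\<lparr>carrier := R\<rparr>\<^esub> g = inv\<^bsub>A\<^esub> g" if "g \<in> R" for g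
    by (rule A.m_inv_consistent[OF subgroup_R that])
  have sR: "subgroup S (A\<lparr>carrier := R\<rparr>)" by (rule A.subgroup_incl[OF subgroup_S subgroup_R S_sub_R])
  show "S \<lhd> A\<lparr>carrier := R\<rparr>"
  proof (rule group.normal_invI[OF gR sR])
    fix g h assume "g \<in> carrier (A\<lparr>carrier := R\<rparr>)" "h \<in> S"
    then show "g \<otimes>\<^bsub>A\<lparr>carrier := R\<rparr>\<^esub> h \<otimes>\<^bsub>A\<lparr>carrier := R\<rparr>\<^esub> inv\<^bsub>A\<lparr>carrier := R\<rparr>\<^esub> g \<in> S"
      using A.normalizer_conj[OF S_sub] invR by (simp add: R_def)
  qed
  show "subgroup H (A\<lparr>carrier := R\<rparr>)" by (rule A.subgroup_incl[OF subgroup_H subgroup_R H_sub_R])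
  show "S \<inter> H = {\<one>\<^bsub>A\<lparr>carrier := R\<rparr>\<^esub>}"
  proof
    show "{\<one>\<^bsub>A\<lparr>carrier := R\<rparr>\<^esub>} \<subseteq> S \<inter> H" using subgroup.one_closed[OF subgroup_S] subgroup.one_closed[OF subgroup_H] by simp
    show "S \<inter> H \<subseteq> {\<one>\<^bsub>A\<lparr>carrier := R\<rparr>\<^esub>}"
    proof
      fix g assume "g \<in> S \<inter> H"
      then obtain t \<alpha> where t: "t \<in> carrier G" "g = sh t" and a: "\<alpha> \<in> admissible_automorphisms" "g = induced \<alpha>"
        by (auto simp: S_eq H_def)
      have "\<alpha> \<one> = \<one>" using admissible_automorphismsD(5)[OF a(1)] is_group by (intro hom_one) auto
      then have "g {\<one>} = {\<one>}" using a(2) singleton_X by (simp add: induced_apply)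
      then have "t = \<one>" using t singleton_X by (simp add: sh_apply r_coset_def)
      then have "g = \<one>\<^bsub>A\<^esub>" using t hom_one[OF sh_hom is_group group_A] by simp
      then show "g \<in> {\<one>\<^bsub>A\<lparr>carrier := R\<rparr>\<^esub>}" by simp
    qed
  qed
  have "S <#>\<^bsub>A\<^esub> H = R"
  proof
    show "S <#>\<^bsub>A\<^esub> H \<subseteq> R"
      using S_sub_R H_sub_R subgroup.m_closed[OF subgroup_R] by (auto simp: set_mult_def)
    show "R \<subseteq> S <#>\<^bsub>A\<^esub> H"
    proof
      fix g assume g: "g \<in> R"
      define \<alpha> where "\<alpha> = conj_aut g"
      have a: "\<alpha> \<in> admissible_automorphisms" unfolding \<alpha>_def by (rule conj_aut_admissible[OF g])
      define h where "h = induced \<alpha>"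
      have h: "h \<in> carrier A" "h \<in> H" using induced_A[OF a] a by (auto simp: h_def H_def)
      have gA: "g \<in> carrier A" by (rule R_A[OF g])
      define k where "k = g \<otimes>\<^bsub>A\<^esub> inv\<^bsub>A\<^esub> h"
      have k: "k \<in> carrier A" using gA h(1) by (simp add: k_def)
      have gk: "g = k \<otimes>\<^bsub>A\<^esub> h" using gA h(1) by (simp add: k_def A.m_assoc)
      have "k \<otimes>\<^bsub>A\<^esub> sh t = sh t \<otimes>\<^bsub>A\<^esub> k" if t: "t \<in> carrier G" for t
      proof -
        obtain u where u: "u \<in> carrier G" "\<alpha> u = t"
          using admissible_automorphismsD(3)[OF a] t by (metis bij_betw_imp_surj_on imageE)
        note sA = sh_A[OF t] sh_A[OF u(1)]
        have "k \<otimes>\<^bsub>A\<^esub> sh t \<otimes>\<^bsub>A\<^esub> h = k \<otimes>\<^bsub>A\<^esub> (h \<otimes>\<^bsub>A\<^esub> sh u)"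
          using induced_twist[OF a u(1)] u(2) k h(1) sA by (simp add: A.m_assoc h_def)
        also have "\<dots> = g \<otimes>\<^bsub>A\<^esub> sh u" using k h(1) sA by (simp add: gk A.m_assoc)
        also have "\<dots> = sh t \<otimes>\<^bsub>A\<^esub> g" using conj_aut_twist[OF g u(1)] u(2) by (simp add: \<alpha>_def)
        also have "\<dots> = sh t \<otimes>\<^bsub>A\<^esub> k \<otimes>\<^bsub>A\<^esub> h" using k h(1) sA by (simp add: gk A.m_assoc)
        finally show ?thesis using k h(1) sA by (simp add: A.right_cancel)
      qed
      then have "k \<in> S" by (rule commuting_homeomorphism_is_shift[OF k])
      then show "g \<in> S <#>\<^bsub>A\<^esub> H" using gk h(2) by (auto simp: set_mult_def)
    qed
  qed
  then show "S <#>\<^bsub>A\<lparr>carrier := R\<rparr>\<^esub> H = carrier (A\<lparr>carrier := R\<rparr>)" by (simp add: set_mult_def)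
qed

text \<open>
  Inversion maps cosets of a subgroup to cosets of the same subgroup.
\<close>
lemma inversion_admissible: "(\<lambda>x\<in>carrier G. inv x) \<in> admissible_automorphisms"
proof -
  let ?n = "\<lambda>x\<in>carrier G. inv x"
  have im: "?n ` U = m_inv G ` U" if "U \<subseteq> carrier G" for U using that by (intro image_cong) auto
  have inv2: "m_inv G ` m_inv G ` U = U" if "U \<subseteq> carrier G" for U
    by (rule image_inverse) (use that in auto)
  have pres: "m_inv G ` U \<in> X" if U: "U \<in> X" for U
  proof (rule admissibleI)
    have Uc: "U \<subseteq> carrier G" by (rule X_carrier[OF U])
    then show "m_inv G ` U \<subseteq> carrier G" by auto
    fix i
    obtain c where c: "c \<in> carrier G" "\<And>u. u \<in> U \<Longrightarrow> \<not> cong i u c"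
      using admissible_misses[of U i] U by blast
    have "\<not> cong i (inv u) (inv c)" if u: "u \<in> U" for u
    proof
      have uc: "u \<in> carrier G" using u Uc by blast
      assume "cong i (inv u) (inv c)"
      then have "inv u \<otimes> c \<in> L i" using c(1) by (simp add: cong_def)
      then have "cong i c u" using uc c(1) by (simp add: cong_def m_comm)
      then show False using c(2)[OF u] cong_sym[OF c(1) uc] by blast
    qed
    then show "\<exists>c\<in>carrier G. \<forall>u\<in>m_inv G ` U. \<not> cong i u c" using c(1) by (intro bexI[of _ "inv c"]) auto
  qed
  have "?n \<in> auto G"
    unfolding auto_def Bij_def
    by (auto simp: hom_def inv_mult intro!: bij_betw_byWitness[of _ "m_inv G"])
  moreover have "?n ` U \<in> X \<longleftrightarrow> U \<in> X" if U: "U \<subseteq> carrier G" for U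
    unfolding im[OF U] using pres[of U] pres[of "m_inv G ` U"] inv2[OF U] by auto
  ultimately show ?thesis by (simp add: admissible_automorphisms_def)
qed

lemma admissible_automorphisms_nontrivial: "admissible_automorphisms \<noteq> {\<one>\<^bsub>AutoGroup G\<^esub>}"
proof
  assume t: "admissible_automorphisms = {\<one>\<^bsub>AutoGroup G\<^esub>}"
  have "(\<lambda>x\<in>carrier G. inv x) = (\<lambda>x\<in>carrier G. x)"
    using inversion_admissible unfolding t by (simp add: AutoGroup_def BijGroup_def)
  then have i: "inv x = x" if "x \<in> carrier G" for x using that by (metis restrict_apply')
  have "x [^] (2::nat) = \<one>" if "x \<in> carrier G" for x
    using i[OF that] that r_inv[OF that] by (simp add: numeral_2_eq_2)
  then have "(\<lambda>x. x [^] (2::nat)) ` carrier G \<subseteq> {\<one>}" by blast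
  then show False using infinite_powers[of 2] by (meson finite.emptyI finite.insertI finite_subset zero_less_numeral)
qed

lemma hereditary_X: "hereditary X"
  unfolding hereditary_def using admissible_subset by blast

end

section \<open>Lattice automorphisms as integer matrices\<close>

text \<open>
  Additive maps between integer vectors commute with integer multiples; build \<open>v\<close> up from
  multiples of the unit vectors, one coordinate at a time.
\<close>
lemma integer_additive_map_eq_matrix:
  fixes f :: "int vec \<Rightarrow> int vec"
  assumes f: "f \<in> hom (monoid_vec TYPE(int) d) (monoid_vec TYPE(int) d)" and v: "v \<in> carrier_vec d"
  shows "f v = mat d d (\<lambda>(i, j). f (unit_vec d j) $ i) *\<^sub>v v"
proof (rule eq_vecI)
  have fc: "f w \<in> carrier_vec d" if "w \<in> carrier_vec d" for w using f that by (auto simp: hom_def monoid_vec_simps)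
  have fa: "f (w + u) = f w + f u" if "w \<in> carrier_vec d" "u \<in> carrier_vec d" for w u
    using f that by (auto simp: hom_def monoid_vec_simps)
  show "dim_vec (f v) = dim_vec (mat d d (\<lambda>(i, j). f (unit_vec d j) $ i) *\<^sub>v v)" using fc[OF v] by simp
  fix i assume "i < dim_vec (mat d d (\<lambda>(i, j). f (unit_vec d j) $ i) *\<^sub>v v)"
  then have i: "i < d" by simp
  have add: "f (w + u) $ i = f w $ i + f u $ i" if "w \<in> carrier_vec d" "u \<in> carrier_vec d" for w u
    using fa[OF that] fc[OF that(2)] i by simp
  have zero: "f (0\<^sub>v d) $ i = 0" using add[of "0\<^sub>v d" "0\<^sub>v d"] by simp
  have nat: "f (int n \<cdot>\<^sub>v w) $ i = int n * f w $ i" if w: "w \<in> carrier_vec d" for n w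
  proof (induction n)
    case 0
    have "int 0 \<cdot>\<^sub>v w = 0\<^sub>v d" using w by (intro eq_vecI) auto
    then show ?case using zero by simp
  next
    case (Suc n)
    have "int (Suc n) \<cdot>\<^sub>v w = w + int n \<cdot>\<^sub>v w" using w by (intro eq_vecI) (auto simp: algebra_simps)
    then show ?case using add[OF w, of "int n \<cdot>\<^sub>v w"] w Suc by (simp add: algebra_simps)
  qed
  have scale: "f (k \<cdot>\<^sub>v w) $ i = k * f w $ i" if w: "w \<in> carrier_vec d" for k w
  proof (cases k)
    case (nonneg n)
    then show ?thesis using nat[OF w] by simp
  next
    case (neg n)
    then have k: "k = - 1 - int n" by simp
    have "int (Suc n) \<cdot>\<^sub>v w + k \<cdot>\<^sub>v w = 0\<^sub>v d" unfolding k using w by (intro eq_vecI) (auto simp: algebra_simps)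
    then have "f (int (Suc n) \<cdot>\<^sub>v w) $ i + f (k \<cdot>\<^sub>v w) $ i = 0"
      using add[of "int (Suc n) \<cdot>\<^sub>v w" "k \<cdot>\<^sub>v w"] zero w by simp
    then have "f (k \<cdot>\<^sub>v w) $ i = - (int (Suc n) * f w $ i)"
      unfolding nat[OF w] by (simp only: eq_neg_iff_add_eq_0 add.commute)
    then show ?thesis by (simp only: neg mult_minus_left)
  qed
  define tr where "tr n = vec d (\<lambda>i. if i < n then v $ i else 0)" for n
  have trunc: "f (tr n) $ i = (\<Sum>j<n. f (unit_vec d j) $ i * v $ j)" if "n \<le> d" for n
    using that
  proof (induction n)
    case 0
    have "tr 0 = 0\<^sub>v d" by (rule eq_vecI) (auto simp: tr_def)
    then show ?case using zero by simp
  next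
    case (Suc n)
    have "tr (Suc n) = tr n + v $ n \<cdot>\<^sub>v unit_vec d n"
      using Suc.prems by (intro eq_vecI) (auto simp: tr_def less_Suc_eq)
    then have "f (tr (Suc n)) $ i = f (tr n) $ i + f (v $ n \<cdot>\<^sub>v unit_vec d n) $ i"
      using add[of "tr n" "v $ n \<cdot>\<^sub>v unit_vec d n"] by (simp add: tr_def)
    then show ?case using Suc by (simp add: scale mult.commute)
  qed
  have "tr d = v" using v by (intro eq_vecI) (auto simp: tr_def)
  then have "f v $ i = (\<Sum>j<d. f (unit_vec d j) $ i * v $ j)" using trunc[of d] by simp
  also have "\<dots> = (mat d d (\<lambda>(i, j). f (unit_vec d j) $ i) *\<^sub>v v) $ i"
    using v i by (simp add: scalar_prod_def atLeast0LessThan)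
  finally show "f v $ i = (mat d d (\<lambda>(i, j). f (unit_vec d j) $ i) *\<^sub>v v) $ i" .
qed

lemma mat_eqI_mult_vec:
  fixes B C :: "int mat"
  assumes "B \<in> carrier_mat d d" "C \<in> carrier_mat d d" "\<And>v. v \<in> carrier_vec d \<Longrightarrow> B *\<^sub>v v = C *\<^sub>v v"
  shows "B = C"
proof (rule eq_matI)
  fix i j assume "i < dim_row C" "j < dim_col C"
  then have ij: "i < d" "j < d" using assms(2) by auto
  have "(B *\<^sub>v unit_vec d j) $ i = (C *\<^sub>v unit_vec d j) $ i" using assms(3)[of "unit_vec d j"] by simp
  then show "B $$ (i, j) = C $$ (i, j)" using assms(1,2) ij by simp
qed (use assms(1,2) in auto)

definition matrix_automorphism :: "nat \<Rightarrow> int mat \<Rightarrow> int vec \<Rightarrow> int vec" where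
  "matrix_automorphism d B = (\<lambda>v\<in>carrier_vec d. B *\<^sub>v v)"

lemma carrier_GL_int:
  "B \<in> carrier (GL_int d) \<longleftrightarrow> B \<in> carrier_mat d d \<and> (\<exists>C\<in>carrier_mat d d. C * B = 1\<^sub>m d \<and> B * C = 1\<^sub>m d)"
  by (auto simp: GL_int_def units_of_carrier Units_def ring_mat_simps)

lemma group_GL_int: "group (GL_int d)"
  unfolding GL_int_def by (rule monoid.units_group[OF ring.is_monoid[OF ring_mat]])

text \<open>
  Surjectivity: the matrices of an automorphism and of its inverse are inverse to each
  other, because a matrix is determined by its action on vectors.
\<close>
lemma matrix_automorphism_iso: "matrix_automorphism d \<in> iso (GL_int d) (AutoGroup (monoid_vec TYPE(int) d))"
proof (rule isoI)
  let ?V = "monoid_vec TYPE(int) d"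
  have auto: "matrix_automorphism d B \<in> auto ?V" if B: "B \<in> carrier (GL_int d)" for B
  proof -
    obtain C where C: "B \<in> carrier_mat d d" "C \<in> carrier_mat d d" "C * B = 1\<^sub>m d" "B * C = 1\<^sub>m d"
      using B by (auto simp: carrier_GL_int)
    have "C *\<^sub>v (B *\<^sub>v v) = v" "B *\<^sub>v (C *\<^sub>v v) = v" if "v \<in> carrier_vec d" for v
      using that C assoc_mult_mat_vec[of C d d B d v] assoc_mult_mat_vec[of B d d C d v] by simp_all
    then have "bij_betw (matrix_automorphism d B) (carrier_vec d) (carrier_vec d)"
      using C by (intro bij_betw_byWitness[of _ "\<lambda>v. C *\<^sub>v v"]) (auto simp: matrix_automorphism_def)
    then show ?thesis
      using C by (auto simp: auto_def Bij_def monoid_vec_simps hom_def matrix_automorphism_def mult_add_distrib_mat_vec[of _ d d])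
  qed
  show "matrix_automorphism d \<in> hom (GL_int d) (AutoGroup ?V)"
  proof (rule homI)
    show "matrix_automorphism d B \<in> carrier (AutoGroup ?V)" if "B \<in> carrier (GL_int d)" for B
      using auto[OF that] by (simp add: AutoGroup_def)
    fix B C assume BC: "B \<in> carrier (GL_int d)" "C \<in> carrier (GL_int d)"
    have "matrix_automorphism d B \<otimes>\<^bsub>AutoGroup ?V\<^esub> matrix_automorphism d C
        = compose (carrier_vec d) (matrix_automorphism d B) (matrix_automorphism d C)"
      using auto[OF BC(1)] auto[OF BC(2)] by (simp add: AutoGroup_def BijGroup_def auto_def monoid_vec_simps)
    also have "\<dots> = matrix_automorphism d (B * C)"
      using BC by (auto simp: carrier_GL_int matrix_automorphism_def compose_def fun_eq_iff)
    finally show "matrix_automorphism d (B \<otimes>\<^bsub>GL_int d\<^esub> C) =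
        matrix_automorphism d B \<otimes>\<^bsub>AutoGroup ?V\<^esub> matrix_automorphism d C"
      by (simp add: GL_int_def units_of_mult ring_mat_simps)
  qed
  show "bij_betw (matrix_automorphism d) (carrier (GL_int d)) (carrier (AutoGroup ?V))"
    unfolding bij_betw_def
  proof
    show "inj_on (matrix_automorphism d) (carrier (GL_int d))"
    proof (rule inj_onI)
      fix B C assume BC: "B \<in> carrier (GL_int d)" "C \<in> carrier (GL_int d)" "matrix_automorphism d B = matrix_automorphism d C"
      show "B = C"
      proof (rule mat_eqI_mult_vec)
        show "B *\<^sub>v v = C *\<^sub>v v" if "v \<in> carrier_vec d" for v
          using fun_cong[OF BC(3), of v] that by (simp add: matrix_automorphism_def)
      qed (use BC in \<open>auto simp: carrier_GL_int\<close>)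
    qed
    show "matrix_automorphism d ` carrier (GL_int d) = carrier (AutoGroup ?V)"
    proof
      show "matrix_automorphism d ` carrier (GL_int d) \<subseteq> carrier (AutoGroup ?V)"
        using auto by (auto simp: AutoGroup_def)
      show "carrier (AutoGroup ?V) \<subseteq> matrix_automorphism d ` carrier (GL_int d)"
      proof
        fix f assume f: "f \<in> carrier (AutoGroup ?V)"
        define mt where "mt g = mat d d (\<lambda>(i, j). g (unit_vec d j) $ i)" for g :: "int vec \<Rightarrow> int vec"
        have mtc: "mt g \<in> carrier_mat d d" for g by (simp add: mt_def)
        let ?g = "\<lambda>v\<in>carrier ?V. inv_into (carrier ?V) f v"
        have V: "group ?V" using comm_group_vec by (rule comm_group.axioms(2))
        have fa: "f \<in> auto ?V" using f by (simp add: AutoGroup_def)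
        then have fh: "f \<in> hom ?V ?V" "f \<in> Bij (carrier ?V)" by (auto simp: auto_def)
        then have gh: "?g \<in> hom ?V ?V" using group.restrict_inv_into_hom[OF V] by blast
        have bij: "bij_betw f (carrier_vec d) (carrier_vec d)" using fh(2) by (simp add: Bij_def monoid_vec_simps)
        have f: "f v = mt f *\<^sub>v v" and g: "?g v = mt ?g *\<^sub>v v" if "v \<in> carrier_vec d" for v
          unfolding mt_def by (rule integer_additive_map_eq_matrix[OF fh(1) that], rule integer_additive_map_eq_matrix[OF gh that])
        have fg: "f (?g v) = v" and gf: "?g (f v) = v" if "v \<in> carrier_vec d" for v
          using that bij bij_betw_inv_into_right[OF bij that] bij_betw_inv_into_left[OF bij that]
          by (auto simp: monoid_vec_simps bij_betw_def)
        have "mt ?g * mt f = 1\<^sub>m d"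
        proof (rule mat_eqI_mult_vec)
          fix v :: "int vec" assume v: "v \<in> carrier_vec d"
          have "(mt ?g * mt f) *\<^sub>v v = mt ?g *\<^sub>v (mt f *\<^sub>v v)" by (rule assoc_mult_mat_vec[OF mtc mtc v])
          also have "\<dots> = ?g (f v)" using f[OF v] g[of "mt f *\<^sub>v v"] mtc[of f] v by simp
          finally show "(mt ?g * mt f) *\<^sub>v v = 1\<^sub>m d *\<^sub>v v" using gf[OF v] v by simp
        qed (auto intro!: mult_carrier_mat[of _ d d] mtc)
        moreover have "mt f * mt ?g = 1\<^sub>m d"
        proof (rule mat_eqI_mult_vec)
          fix v :: "int vec" assume v: "v \<in> carrier_vec d"
          have "(mt f * mt ?g) *\<^sub>v v = mt f *\<^sub>v (mt ?g *\<^sub>v v)" by (rule assoc_mult_mat_vec[OF mtc mtc v])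
          also have "\<dots> = f (?g v)" using g[OF v] f[of "mt ?g *\<^sub>v v"] mtc[of ?g] v by simp
          finally show "(mt f * mt ?g) *\<^sub>v v = 1\<^sub>m d *\<^sub>v v" using fg[OF v] v by simp
        qed (auto intro!: mult_carrier_mat[of _ d d] mtc)
        ultimately have "mt f \<in> carrier (GL_int d)" using mtc by (auto simp: carrier_GL_int)
        moreover have "f = matrix_automorphism d (mt f)"
        proof (rule extensionalityI[of _ "carrier_vec d"])
          show "f \<in> extensional (carrier_vec d)" using fh(2) by (simp add: Bij_def monoid_vec_simps)
        qed (use f in \<open>auto simp: matrix_automorphism_def\<close>)
        ultimately show "f \<in> matrix_automorphism d ` carrier (GL_int d)" by blast
      qed
    qed
  qed
qed

text \<open>
  Conjugation with an isomorphism.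
\<close>
lemma AutoGroup_iso:
  assumes G: "group G" and K: "group K" and iso: "G \<cong> K"
  shows "AutoGroup G \<cong> AutoGroup K"
proof -
  obtain h where h: "h \<in> iso G K" using iso by (auto simp: is_iso_def)
  define h' where "h' = inv_into (carrier G) h"
  have h': "h' \<in> iso K G" unfolding h'_def by (rule group.iso_set_sym[OF G h])
  have bij: "bij_betw h (carrier G) (carrier K)" "bij_betw h' (carrier K) (carrier G)"
    using h h' by (auto simp: iso_def)
  have hc: "h x \<in> carrier K" if "x \<in> carrier G" for x using bij(1) that by (auto simp: bij_betw_def)
  have hc': "h' x \<in> carrier G" if "x \<in> carrier K" for x using bij(2) that by (auto simp: bij_betw_def)
  have hh': "h (h' y) = y" if "y \<in> carrier K" for y unfolding h'_def by (rule bij_betw_inv_into_right[OF bij(1) that])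
  have h'h: "h' (h x) = x" if "x \<in> carrier G" for x unfolding h'_def by (rule bij_betw_inv_into_left[OF bij(1) that])
  define c where "c \<alpha> = (\<lambda>y\<in>carrier K. h (\<alpha> (h' y)))" for \<alpha>
  define c' where "c' \<beta> = (\<lambda>x\<in>carrier G. h' (\<beta> (h x)))" for \<beta>
  have ac: "\<alpha> x \<in> carrier G" if "\<alpha> \<in> auto G" "x \<in> carrier G" for \<alpha> x using that by (auto simp: auto_def hom_def)
  have bc: "\<beta> x \<in> carrier K" if "\<beta> \<in> auto K" "x \<in> carrier K" for \<beta> x using that by (auto simp: auto_def hom_def)
  have c: "c \<alpha> \<in> auto K" if a: "\<alpha> \<in> auto G" for \<alpha>
  proof -
    have "bij_betw (h \<circ> \<alpha> \<circ> h') (carrier K) (carrier K)"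
      using a bij by (intro bij_betw_trans[of _ _ "carrier G"]) (auto simp: auto_def Bij_def)
    then have "bij_betw (c \<alpha>) (carrier K) (carrier K)"
      by (rule bij_betw_cong[THEN iffD1, rotated]) (simp add: c_def)
    moreover have "h \<in> hom G K" "h' \<in> hom K G" "\<alpha> \<in> hom G G" using a h h' by (auto simp: auto_def iso_def)
    then have "c \<alpha> \<in> hom K K"
      using K group.is_monoid[OF K] by (auto simp: hom_def c_def monoid.m_closed Pi_iff)
    ultimately show ?thesis by (simp add: auto_def Bij_def c_def)
  qed
  have c'_mem: "c' \<beta> \<in> auto G" if b: "\<beta> \<in> auto K" for \<beta>
  proof -
    have "bij_betw (h' \<circ> \<beta> \<circ> h) (carrier G) (carrier G)"
      using b bij by (intro bij_betw_trans[of _ _ "carrier K"]) (auto simp: auto_def Bij_def)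
    then have "bij_betw (c' \<beta>) (carrier G) (carrier G)"
      by (rule bij_betw_cong[THEN iffD1, rotated]) (simp add: c'_def)
    moreover have "h \<in> hom G K" "h' \<in> hom K G" "\<beta> \<in> hom K K" using b h h' by (auto simp: auto_def iso_def)
    then have "c' \<beta> \<in> hom G G"
      using G group.is_monoid[OF G] by (auto simp: hom_def c'_def monoid.m_closed Pi_iff)
    ultimately show ?thesis by (simp add: auto_def Bij_def c'_def)
  qed
  have "c \<in> iso (AutoGroup G) (AutoGroup K)"
  proof (rule isoI)
    show "c \<in> hom (AutoGroup G) (AutoGroup K)"
    proof (rule homI)
      fix \<alpha> \<beta> assume "\<alpha> \<in> carrier (AutoGroup G)" "\<beta> \<in> carrier (AutoGroup G)"
      then have ab: "\<alpha> \<in> auto G" "\<beta> \<in> auto G" by (auto simp: AutoGroup_def)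
      have "c (compose (carrier G) \<alpha> \<beta>) = compose (carrier K) (c \<alpha>) (c \<beta>)"
        using ac[OF ab(1)] ac[OF ab(2)] by (auto simp: c_def compose_def hc hc' h'h fun_eq_iff)
      then show "c (\<alpha> \<otimes>\<^bsub>AutoGroup G\<^esub> \<beta>) = c \<alpha> \<otimes>\<^bsub>AutoGroup K\<^esub> c \<beta>"
        using ab c[OF ab(1)] c[OF ab(2)] by (simp add: AutoGroup_def BijGroup_def auto_def)
    qed (use c in \<open>simp add: AutoGroup_def\<close>)
    have "c' (c \<alpha>) = \<alpha>" if a: "\<alpha> \<in> auto G" for \<alpha>
    proof (rule extensionalityI[of _ "carrier G"])
      show "\<alpha> \<in> extensional (carrier G)" using a by (simp add: auto_def Bij_def)
    qed (use ac[OF a] in \<open>auto simp: c_def c'_def hc h'h\<close>)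
    moreover have "c (c' \<beta>) = \<beta>" if b: "\<beta> \<in> auto K" for \<beta>
    proof (rule extensionalityI[of _ "carrier K"])
      show "\<beta> \<in> extensional (carrier K)" using b by (simp add: auto_def Bij_def)
    qed (use bc[OF b] in \<open>auto simp: c_def c'_def hc' hh'\<close>)
    ultimately show "bij_betw c (carrier (AutoGroup G)) (carrier (AutoGroup K))"
      using c c'_mem by (intro bij_betw_byWitness[of _ c']) (auto simp: AutoGroup_def)
  qed
  then show ?thesis by (rule is_isoI)
qed

lemma subgroup_transport:
  assumes G: "group G" and K: "group K" and iso: "G \<cong> K" and P: "subgroup P G" "P \<noteq> {\<one>\<^bsub>G\<^esub>}"
  obtains M where "subgroup M K" "M \<noteq> {\<one>\<^bsub>K\<^esub>}" "G\<lparr>carrier := P\<rparr> \<cong> K\<lparr>carrier := M\<rparr>"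
proof -
  obtain h where h: "h \<in> iso G K" using iso by (auto simp: is_iso_def)
  interpret h: group_hom G K h using G K h by (simp add: group_hom_def group_hom_axioms_def iso_def)
  have inj: "inj_on h (carrier G)" using h by (auto simp: iso_def bij_betw_def)
  have Pc: "P \<subseteq> carrier G" by (rule subgroup.subset[OF P(1)])
  show ?thesis
  proof (rule that[of "h ` P"])
    show "subgroup (h ` P) K" by (rule h.subgroup_img_is_subgroup[OF P(1)])
    obtain p where p: "p \<in> P" "p \<noteq> \<one>\<^bsub>G\<^esub>" using P subgroup.one_closed[OF P(1)] by blast
    have "h p \<noteq> \<one>\<^bsub>K\<^esub>" using inj_onD[OF inj, of p "\<one>\<^bsub>G\<^esub>"] p Pc by auto
    then show "h ` P \<noteq> {\<one>\<^bsub>K\<^esub>}" using p by blast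
    have "h \<in> iso (G\<lparr>carrier := P\<rparr>) (K\<lparr>carrier := h ` P\<rparr>)"
      using Pc inj_on_subset[OF inj Pc] by (auto simp: iso_def hom_def bij_betw_def subset_iff)
    then show "G\<lparr>carrier := P\<rparr> \<cong> K\<lparr>carrier := h ` P\<rparr>" by (rule is_isoI)
  qed
qed

section \<open>The Minkowski lattice\<close>

context coprime_ideal_family begin

text \<open>
  An injective additive map \<open>\<iota>\<close> identifies the lattice with the algebraic integers, and
  cosets with residue classes; the \<open>q\<close>-th powers are the multiples by \<open>q\<close>, infinite in
  number because the characteristic is \<open>0\<close>.
\<close>
lemma sieve_system_image:
  fixes G :: "('v, 'm) monoid_scheme" (structure) and \<iota> :: "'k \<Rightarrow> 'v"
  assumes inj: "inj \<iota>" and carrier: "carrier G = \<iota> ` Collect algebraic_int"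
    and mult: "\<And>x y. algebraic_int x \<Longrightarrow> algebraic_int y \<Longrightarrow> \<iota> x \<otimes> \<iota> y = \<iota> (x + y)" and one: "\<one> = \<iota> 0"
    and proper: "\<And>i. \<bb> i \<noteq> Collect algebraic_int"
  shows "sieve_system G (\<lambda>i. \<iota> ` \<bb> i)"
proof -
  have mem: "\<iota> x \<in> carrier G \<longleftrightarrow> algebraic_int x" for x using inj carrier by (auto dest: injD)
  have G: "comm_group G"
  proof (rule comm_groupI)
    fix x assume "x \<in> carrier G"
    then obtain a where "algebraic_int a" "x = \<iota> a" by (auto simp: carrier)
    then show "\<exists>y\<in>carrier G. y \<otimes> x = \<one>" by (intro bexI[of _ "\<iota> (- a)"]) (auto simp: mult one mem)
  qed (auto simp: carrier one mult algebraic_int_add ac_simps)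
  interpret comm_group G by (rule G)
  have inv: "inv (\<iota> x) = \<iota> (- x)" if "algebraic_int x" for x
    by (rule inv_equality) (use that in \<open>auto simp: mult one mem\<close>)
  have diff: "\<iota> x \<otimes> inv (\<iota> y) = \<iota> (x - y)" if "algebraic_int x" "algebraic_int y" for x y
    using that by (simp add: inv mult)
  have memb: "\<iota> x \<in> \<iota> ` \<bb> i \<longleftrightarrow> x \<in> \<bb> i" for x i using inj by (auto dest: injD)
  have coset: "\<iota> ` \<bb> i #> \<iota> x = \<iota> ` residue_class (\<bb> i) x" if x: "algebraic_int x" for i x
  proof -
    have "residue_class (\<bb> i) x = (\<lambda>h. h + x) ` \<bb> i" by (force simp: residue_class_def image_iff)
    then show ?thesis using integral_idealD[OF ideals] x by (auto simp: r_coset_def mult)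
  qed
  have rcos: "rcosets (\<iota> ` \<bb> i) = (`) \<iota> ` residue_classes (\<bb> i)" for i
    unfolding RCOSETS_def residue_classes_def carrier using coset by auto
  have card_rcos: "card (rcosets (\<iota> ` \<bb> i)) = N i" for i
    unfolding rcos by (rule card_image, rule inj_onI) (simp add: inj_image_eq_iff[OF inj])
  show ?thesis
  proof (intro sieve_system.intro sieve_system_axioms.intro)
    show "comm_group G" by (rule G)
    fix i
    show "subgroup (\<iota> ` \<bb> i) G"
    proof (rule subgroupI)
      show "\<iota> ` \<bb> i \<subseteq> carrier G" using integral_idealD[OF ideals] by (auto simp: carrier)
      show "\<iota> ` \<bb> i \<noteq> {}" using nonzero by auto
      fix a assume "a \<in> \<iota> ` \<bb> i"
      then obtain x where x: "x \<in> \<bb> i" "a = \<iota> x" by blast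
      then show "inv a \<in> \<iota> ` \<bb> i"
        using integral_ideal_uminus[OF ideals x(1)] integral_idealD[OF ideals x(1)] by (simp add: inv memb)
      fix b assume "b \<in> \<iota> ` \<bb> i"
      then obtain y where y: "y \<in> \<bb> i" "b = \<iota> y" by blast
      then show "a \<otimes> b \<in> \<iota> ` \<bb> i"
        using x integral_ideal_add[OF ideals x(1) y(1)] integral_idealD[OF ideals x(1)] integral_idealD[OF ideals y(1)]
        by (simp add: mult memb)
    qed
    show "finite (rcosets (\<iota> ` \<bb> i))" unfolding rcos using finite_residue_classes by simp
    show "\<iota> ` \<bb> i \<noteq> carrier G" unfolding carrier inj_image_eq_iff[OF inj] by (rule proper)
  next
    fix S :: "nat set" and c assume S: "finite S" and c: "\<And>i. i \<in> S \<Longrightarrow> c i \<in> carrier G"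
    have "\<forall>i\<in>S. \<exists>x. algebraic_int x \<and> c i = \<iota> x" using c by (auto simp: carrier)
    from bchoice[OF this] obtain e where e: "\<And>i. i \<in> S \<Longrightarrow> algebraic_int (e i)" "\<And>i. i \<in> S \<Longrightarrow> c i = \<iota> (e i)" by auto
    have "\<exists>t. algebraic_int t \<and> (\<forall>i\<in>S. t - e i \<in> \<bb> i)" by (rule chinese_remainder[OF S e(1)])
    then obtain t where t: "algebraic_int t" "\<forall>i\<in>S. t - e i \<in> \<bb> i" by blast
    then show "\<exists>t\<in>carrier G. \<forall>i\<in>S. t \<otimes> inv c i \<in> \<iota> ` \<bb> i"
      using e by (intro bexI[of _ "\<iota> t"]) (auto simp: diff memb mem)
  next
    fix x assume "x \<in> carrier G" "x \<noteq> \<one>"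
    then obtain a where "x = \<iota> a" "a \<noteq> 0" by (auto simp: carrier one)
    then show "finite {i. x \<in> \<iota> ` \<bb> i}" using finite_ideals_containing[of a] by (simp add: memb)
  next
    fix n show "finite {i. card (rcosets (\<iota> ` \<bb> i)) \<le> n}"
      unfolding card_rcos using finite_N_le[of "real n"] by simp
  next
    fix q :: nat assume q: "q > 0"
    have pow: "\<iota> x [^] q = \<iota> (of_nat q * x)" if x: "algebraic_int x" for x and q :: nat
      by (induction q) (use x in \<open>auto simp: one mult algebraic_int_mult algebra_simps\<close>)
    have "inj (\<lambda>n. \<iota> (of_nat q * of_nat n))"
    proof (rule injI)
      fix a b assume "\<iota> (of_nat q * of_nat a) = \<iota> (of_nat q * of_nat b)"
      then have "of_nat q * of_nat a = (of_nat q * of_nat b :: 'k)" by (rule injD[OF inj])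
      then show "a = b" using q by simp
    qed
    then have "infinite (range (\<lambda>n. \<iota> (of_nat q * of_nat n)))" by (rule range_inj_infinite)
    moreover have "range (\<lambda>n. \<iota> (of_nat q * of_nat n)) \<subseteq> (\<lambda>x. x [^] q) ` carrier G"
    proof safe
      fix n
      have "\<iota> (of_nat q * of_nat n) = \<iota> (of_nat n) [^] q" by (simp add: pow)
      then show "\<iota> (of_nat q * of_nat n) \<in> (\<lambda>x. x [^] q) ` carrier G" by (simp add: mem image_eqI)
    qed
    ultimately show "infinite ((\<lambda>x. x [^] q) ` carrier G)" by (meson finite_subset)
  next
    fix m
    obtain K where K: "\<forall>Y S t\<^sub>0. finite Y \<longrightarrow> Y \<subseteq> Collect algebraic_int \<longrightarrow> card Y \<le> m \<longrightarrow> finite S \<longrightarrow> {..<K} \<subseteq> S \<longrightarrow> algebraic_int t\<^sub>0 \<longrightarrow>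
     (\<exists>t. algebraic_int t \<and> (\<forall>i\<in>S. t - t\<^sub>0 \<in> \<bb> i) \<and> (\<forall>i. i \<notin> S \<longrightarrow> (\<forall>y\<in>Y. t - y \<notin> \<bb> i)))"
      using sieve[of m] ..
    show "\<exists>K. \<forall>Y S t\<^sub>0. finite Y \<longrightarrow> Y \<subseteq> carrier G \<longrightarrow> card Y \<le> m \<longrightarrow> finite S \<longrightarrow> {..<K} \<subseteq> S \<longrightarrow>
      t\<^sub>0 \<in> carrier G \<longrightarrow>
      (\<exists>t\<in>carrier G. (\<forall>i\<in>S. t \<otimes> inv t\<^sub>0 \<in> \<iota> ` \<bb> i) \<and> (\<forall>i. i \<notin> S \<longrightarrow> (\<forall>y\<in>Y. t \<otimes> inv y \<notin> \<iota> ` \<bb> i)))"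
    proof (intro exI[of _ K] allI impI)
      fix Y S t\<^sub>0
      assume Y: "finite Y" "Y \<subseteq> carrier G" "card Y \<le> m" and S: "finite S" "{..<K} \<subseteq> S" and t0: "t\<^sub>0 \<in> carrier G"
      obtain Z where Z: "Z \<subseteq> Collect algebraic_int" "Y = \<iota> ` Z" using Y(2) unfolding carrier by (meson subset_imageE)
      have injZ: "inj_on \<iota> Z" by (rule inj_on_subset[OF inj]) simp
      have Zf: "finite Z" by (rule finite_imageD[OF _ injZ]) (use Y(1) Z(2) in simp)
      have Zm: "card Z \<le> m" using Y(3) unfolding Z(2) card_image[OF injZ] .
      obtain s where s: "algebraic_int s" "t\<^sub>0 = \<iota> s" using t0 by (auto simp: carrier)
      have "\<exists>t. algebraic_int t \<and> (\<forall>i\<in>S. t - s \<in> \<bb> i) \<and> (\<forall>i. i \<notin> S \<longrightarrow> (\<forall>y\<in>Z. t - y \<notin> \<bb> i))"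
        by (rule K[rule_format, OF Zf Z(1) Zm S s(1)])
      then obtain t where t: "algebraic_int t" "\<forall>i\<in>S. t - s \<in> \<bb> i" "\<forall>i. i \<notin> S \<longrightarrow> (\<forall>y\<in>Z. t - y \<notin> \<bb> i)"
        by (elim exE conjE)
      show "\<exists>t\<in>carrier G. (\<forall>i\<in>S. t \<otimes> inv t\<^sub>0 \<in> \<iota> ` \<bb> i) \<and> (\<forall>i. i \<notin> S \<longrightarrow> (\<forall>y\<in>Y. t \<otimes> inv y \<notin> \<iota> ` \<bb> i))"
      proof (intro bexI[of _ "\<iota> t"] conjI ballI allI impI)
        show "\<iota> t \<otimes> inv t\<^sub>0 \<in> \<iota> ` \<bb> i" if "i \<in> S" for i using t s that by (simp add: diff memb)
        fix i y assume i: "i \<notin> S" and "y \<in> Y"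
        then obtain z where z: "z \<in> Z" "y = \<iota> z" using Z(2) by blast
        have "algebraic_int z" using z(1) Z(1) by blast
        then show "\<iota> t \<otimes> inv y \<notin> \<iota> ` \<bb> i"
          unfolding z(2) diff[OF t(1) \<open>algebraic_int z\<close>] memb using t(3) i z(1) by blast
      qed (simp add: mem t(1))
    qed
  qed
qed

end

lemma integral_ideal_of_ideal: "ideal I (ring_of_integers :: 'k::field_char_0 ring) \<Longrightarrow> integral_ideal (I :: 'k set)"
proof -
  assume "ideal I (ring_of_integers :: 'k ring)"
  then interpret ideal I "ring_of_integers :: 'k ring" .
  have sub: "I \<subseteq> Collect algebraic_int" using a_subset by (simp add: ring_of_integers_def)
  have zero: "0 \<in> I" using additive_subgroup.zero_closed[OF is_additive_subgroup] by (simp add: ring_of_integers_def)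
  have mult: "a * x \<in> I" if "algebraic_int a" "x \<in> I" for a x
    using I_l_closed[of x a] that by (simp add: ring_of_integers_def)
  have add: "x + y \<in> I" if "x \<in> I" "y \<in> I" for x y
    using additive_subgroup.a_closed[OF is_additive_subgroup that] by (simp add: ring_of_integers_def)
  have "x - y \<in> I" if "x \<in> I" "y \<in> I" for x y
    using add[OF that(1) mult[of "- 1" y]] that by simp
  then show ?thesis using sub zero mult by (simp add: integral_ideal_def)
qed

lemma absolute_norm_eq: "absolute_norm (I :: 'k::field_char_0 set) = card (residue_classes I)"
proof -
  have "a_r_coset (ring_of_integers :: 'k ring) I x = residue_class I x" for x
    by (force simp: a_r_coset_def' ring_of_integers_def residue_class_def)
  then show ?thesis
    by (simp add: absolute_norm_def A_RCOSETS_def' residue_classes_def) (auto simp: ring_of_integers_def intro!: arg_cong[of _ _ card])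
qed

text \<open>
  That sums and products of algebraic integers are algebraic integers is part of the ring
  axioms.
\<close>
lemma ring_of_algebraic_intsI:
  assumes "ring (ring_of_integers :: 'k::field_char_0 ring)"
  shows "ring_of_algebraic_ints TYPE('k)"
proof -
  interpret ring "ring_of_integers :: 'k ring" by fact
  show ?thesis
    by unfold_locales (use a_closed m_closed in \<open>auto simp: ring_of_integers_def\<close>)
qed

lemma coprime_ideal_familyI:
  fixes \<bb> :: "nat \<Rightarrow> 'k::field_char_0 set"
  assumes nf: "number_field TYPE('k)" and prim: "primitive_ideal_family \<bb>" and erd: "erdos_family \<bb>"
  obtains \<omega> :: "nat \<Rightarrow> 'k" where "coprime_ideal_family (field_degree TYPE('k)) \<omega> \<bb>"
proof -
  have id: "ideal (\<bb> i) ring_of_integers" "\<bb> i \<noteq> {0}" for i using prim by (auto simp: primitive_ideal_family_def)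
  have ring: "ring_of_algebraic_ints TYPE('k)"
    using ring_of_algebraic_intsI ideal.axioms(2)[OF id(1)] by blast
  obtain b :: "nat \<Rightarrow> 'k" where b: "rational_basis (field_degree TYPE('k)) b" "\<And>i. algebraic_int (b i)"
    by (rule number_field_has_integral_rational_basis[OF nf]) blast
  have "algebraic_int_basis (field_degree TYPE('k)) b"
    using b ring by (simp add: algebraic_int_basis_def algebraic_int_basis_axioms_def)
  then obtain \<omega> :: "nat \<Rightarrow> 'k" where w: "rational_basis (field_degree TYPE('k)) \<omega>" "\<And>i. algebraic_int (\<omega> i)"
    "\<And>x. algebraic_int x \<Longrightarrow> \<exists>z. x = (\<Sum>i<field_degree TYPE('k). of_int (z i) * \<omega> i)"
    by (rule algebraic_int_basis.integral_basis_exists) blast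
  interpret w: rational_basis "field_degree TYPE('k)" \<omega> by (rule w(1))
  interpret r: ring_of_algebraic_ints "TYPE('k)" by (rule ring)
  have "integral_basis (field_degree TYPE('k)) \<omega>"
  proof unfold_locales
    fix x :: 'k
    show "algebraic_int x \<longleftrightarrow> (\<forall>i<field_degree TYPE('k). w.coord x i \<in> \<int>)"
    proof
      assume "algebraic_int x"
      then obtain z where z: "x = (\<Sum>i<field_degree TYPE('k). of_int (z i) * \<omega> i)" using w(3) by blast
      have "w.coord x i = of_int (z i)" if "i < field_degree TYPE('k)" for i
        by (rule w.coord_unique[OF _ that]) (simp add: z)
      then show "\<forall>i<field_degree TYPE('k). w.coord x i \<in> \<int>" by simp
    next
      assume "\<forall>i<field_degree TYPE('k). w.coord x i \<in> \<int>"
      then have "\<forall>i<field_degree TYPE('k). \<exists>z. w.coord x i = of_int z" by (auto elim: Ints_cases)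
      then obtain z where z: "\<And>i. i < field_degree TYPE('k) \<Longrightarrow> w.coord x i = of_int (z i)" by metis
      have "x = (\<Sum>i<field_degree TYPE('k). of_int (z i) * \<omega> i)"
        by (subst w.coord_expansion) (simp add: z)
      also have "algebraic_int \<dots>" by (intro r.algebraic_int_sum r.algebraic_int_mult w(2) algebraic_int_of_int)
      finally show "algebraic_int x" .
    qed
  qed
  then have "coprime_ideal_family (field_degree TYPE('k)) \<omega> \<bb>"
    unfolding coprime_ideal_family_def coprime_ideal_family_axioms_def
  proof (intro conjI allI impI)
    fix i show I: "integral_ideal (\<bb> i)" by (rule integral_ideal_of_ideal[OF id(1)])
    show "\<exists>x\<in>\<bb> i. x \<noteq> 0" using id(2)[of i] I by (auto simp: integral_ideal_def)
  next
    fix i j :: nat assume "i \<noteq> j"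
    then have "1 \<in> \<bb> i <+>\<^bsub>ring_of_integers\<^esub> \<bb> j" using erd by (simp add: erdos_family_def ring_of_integers_def)
    then obtain x y where "x \<in> \<bb> i" "y \<in> \<bb> j" "1 = x + y" by (auto simp: set_add_def' ring_of_integers_def)
    then show "\<exists>x\<in>\<bb> i. \<exists>y\<in>\<bb> j. x + y = 1" by metis
  next
    show "summable (\<lambda>i. 1 / real (card (residue_classes (\<bb> i))))"
      using erd by (simp add: erdos_family_def absolute_norm_eq)
  qed
  then show ?thesis by (rule that)
qed

text \<open>
  A single embedding is injective, so it is enough that the family of embeddings is not
  empty. A complex embedding with real values gives one of the \<open>\<rho> i\<close>, any other one agrees
  up to conjugation with one of the \<open>\<sigma> j\<close>.
\<close>
lemma minkowski_inj:
  assumes "\<exists>\<tau> :: 'k::field_char_0 \<Rightarrow> complex. field_hom \<tau>" and emb: "embedding_choice r \<rho> s (\<sigma> :: nat \<Rightarrow> 'k \<Rightarrow> complex)"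
  shows "inj (minkowski r \<rho> s \<sigma>)"
proof -
  obtain \<tau> :: "'k \<Rightarrow> complex" where \<tau>: "field_hom \<tau>" using assms(1) by blast
  interpret \<tau>: field_hom \<tau> by fact
  have inj_hom: "inj f" if "field_hom f" for f :: "'k \<Rightarrow> 'c::field"
  proof -
    interpret f: field_hom f by fact
    show ?thesis by (rule f.inj_f)
  qed
  show ?thesis
  proof (cases "range \<tau> \<subseteq> \<real>")
    case True
    define \<phi> where "\<phi> x = Re (\<tau> x)" for x
    have im: "Im (\<tau> x) = 0" for x using True by (auto simp: complex_is_Real_iff image_subset_iff)
    have "field_hom \<phi>"
      by unfold_locales (simp_all add: \<phi>_def im \<tau>.hom_add \<tau>.hom_mult)
    then have "\<phi> \<in> \<rho> ` {..<r}" using emb by (auto simp: embedding_choice_def real_embeddings_def bij_betw_def)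
    then obtain i where i: "i < r" "\<phi> = \<rho> i" by blast
    show ?thesis
    proof (rule injI)
      fix x y assume "minkowski r \<rho> s \<sigma> x = minkowski r \<rho> s \<sigma> y"
      then have "vec r (\<lambda>i. \<rho> i x) $ i = vec r (\<lambda>i. \<rho> i y) $ i" by (simp add: minkowski_def)
      then have "\<phi> x = \<phi> y" using i by simp
      then show "x = y" using injD[OF inj_hom[OF \<open>field_hom \<phi>\<close>]] by blast
    qed
  next
    case False
    then have "\<tau> \<in> complex_embeddings" using \<tau> by (simp add: complex_embeddings_def)
    then obtain j where j: "j < s" "\<sigma> j \<in> complex_embeddings" using emb unfolding embedding_choice_def by blast
    then have h: "field_hom (\<sigma> j)" by (simp add: complex_embeddings_def)
    show ?thesis
    proof (rule injI)
      fix x y assume "minkowski r \<rho> s \<sigma> x = minkowski r \<rho> s \<sigma> y"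
      then have "vec s (\<lambda>i. \<sigma> i x) $ j = vec s (\<lambda>i. \<sigma> i y) $ j" by (simp add: minkowski_def)
      then have "\<sigma> j x = \<sigma> j y" using j by simp
      then show "x = y" using injD[OF inj_hom[OF h]] by blast
    qed
  qed
qed

lemma
  assumes emb: "embedding_choice r \<rho> s (\<sigma> :: nat \<Rightarrow> 'k::field_char_0 \<Rightarrow> complex)"
  shows minkowski_lattice_mult:
      "minkowski r \<rho> s \<sigma> x \<otimes>\<^bsub>minkowski_lattice r \<rho> s \<sigma>\<^esub> minkowski r \<rho> s \<sigma> y = minkowski r \<rho> s \<sigma> (x + y)"
    and minkowski_lattice_one: "\<one>\<^bsub>minkowski_lattice r \<rho> s \<sigma>\<^esub> = minkowski r \<rho> s \<sigma> 0"
proof -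
  have \<rho>: "field_hom (\<rho> i)" if "i < r" for i
    using emb that by (auto simp: embedding_choice_def bij_betw_def real_embeddings_def)
  have \<sigma>: "field_hom (\<sigma> j)" if "j < s" for j
    using emb that by (auto simp: embedding_choice_def complex_embeddings_def)
  have ra: "\<rho> i (x + y) = \<rho> i x + \<rho> i y" "\<rho> i 0 = 0" if "i < r" for i x y
  proof -
    interpret field_hom "\<rho> i" by (rule \<rho>[OF that])
    show "\<rho> i (x + y) = \<rho> i x + \<rho> i y" "\<rho> i 0 = 0" by (simp_all add: hom_add)
  qed
  have sa: "\<sigma> i (x + y) = \<sigma> i x + \<sigma> i y" "\<sigma> i 0 = 0" if "i < s" for i x y
  proof -
    interpret field_hom "\<sigma> i" by (rule \<sigma>[OF that])
    show "\<sigma> i (x + y) = \<sigma> i x + \<sigma> i y" "\<sigma> i 0 = 0" by (simp_all add: hom_add)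
  qed
  show "minkowski r \<rho> s \<sigma> x \<otimes>\<^bsub>minkowski_lattice r \<rho> s \<sigma>\<^esub> minkowski r \<rho> s \<sigma> y = minkowski r \<rho> s \<sigma> (x + y)"
    by (auto simp: minkowski_lattice_def minkowski_def DirProd_def monoid_vec_simps ra sa intro!: eq_vecI)
  show "\<one>\<^bsub>minkowski_lattice r \<rho> s \<sigma>\<^esub> = minkowski r \<rho> s \<sigma> 0"
    by (auto simp: minkowski_lattice_def minkowski_def DirProd_def monoid_vec_simps ra sa intro!: eq_vecI)
qed

lemma (in integral_basis) lattice_iso_int_vec:
  fixes G :: "('v, 'm) monoid_scheme" (structure) and \<iota> :: "'k \<Rightarrow> 'v"
  assumes inj: "inj \<iota>" and carrier: "carrier G = \<iota> ` Collect algebraic_int"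
    and mult: "\<And>x y. \<iota> x \<otimes> \<iota> y = \<iota> (x + y)"
  shows "monoid_vec TYPE(int) d \<cong> G"
proof -
  let ?e = "\<lambda>v. \<Sum>i<d. of_int (v $ i) * \<omega> i"
  have "(\<lambda>v. \<iota> (?e v)) \<in> iso (monoid_vec TYPE(int) d) G"
  proof (rule isoI)
    have alg: "algebraic_int (?e v)" for v by (simp add: algebraic_int_iff_coord coord_combination)
    show "(\<lambda>v. \<iota> (?e v)) \<in> hom (monoid_vec TYPE(int) d) G"
      by (rule homI) (auto simp: carrier alg monoid_vec_simps mult distrib_right sum.distrib)
    show "bij_betw (\<lambda>v. \<iota> (?e v)) (carrier (monoid_vec TYPE(int) d)) (carrier G)"
      unfolding bij_betw_def monoid_vec_simps
    proof
      show "inj_on (\<lambda>v. \<iota> (?e v)) (carrier_vec d)"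
      proof (rule inj_onI)
        fix u v :: "int vec" assume uv: "u \<in> carrier_vec d" "v \<in> carrier_vec d" "\<iota> (?e u) = \<iota> (?e v)"
        then have e: "?e u = ?e v" using injD[OF inj] by blast
        show "u = v"
        proof (rule eq_vecI)
          fix i assume "i < dim_vec v"
          then have i: "i < d" using uv(2) by simp
          have "coord (?e u) i = coord (?e v) i" using e by simp
          then show "u $ i = v $ i" using i by (simp add: coord_combination)
        qed (use uv in simp)
      qed
      show "(\<lambda>v. \<iota> (?e v)) ` carrier_vec d = carrier G"
      proof
        show "(\<lambda>v. \<iota> (?e v)) ` carrier_vec d \<subseteq> carrier G" using alg by (auto simp: carrier)
        show "carrier G \<subseteq> (\<lambda>v. \<iota> (?e v)) ` carrier_vec d"
        proof
          fix x assume "x \<in> carrier G"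
          then obtain a where a: "algebraic_int a" "x = \<iota> a" by (auto simp: carrier)
          let ?v = "vec d (\<lambda>i. \<lfloor>coord a i\<rfloor>)"
          have "of_int \<lfloor>coord a i\<rfloor> = coord a i" if "i < d" for i
            using a(1) that by (auto simp: algebraic_int_iff_coord elim!: Ints_cases)
          then have c: "coord (?e ?v) i = coord a i" if "i < d" for i
            using coord_combination[OF that, of "\<lambda>j. ?v $ j"] that by simp
          then have "?e ?v = a" using coord_eq_iff by blast
          then have "x = \<iota> (?e ?v)" using a(2) by simp
          then show "x \<in> (\<lambda>v. \<iota> (?e v)) ` carrier_vec d" by (rule image_eqI) simp
        qed
      qed
    qed
  qed
  then show ?thesis by (rule is_isoI)
qed

theorem theorem5p3:
  fixes r s :: nat
    and \<rho> :: "nat \<Rightarrow> 'k::field_char_0 \<Rightarrow> real"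
    and \<sigma> :: "nat \<Rightarrow> 'k \<Rightarrow> complex"
    and \<bb> :: "nat \<Rightarrow> 'k set"
  assumes "number_field TYPE('k)"
    and "embedding_choice r \<rho> s \<sigma>"
    and "primitive_ideal_family \<bb>"
    and "erdos_family \<bb>"
  shows
    "let d = field_degree TYPE('k);
         \<Gamma> = minkowski_lattice r \<rho> s \<sigma>;
         L = (\<lambda>i. minkowski r \<rho> s \<sigma> ` \<bb> i);
         X = free_space \<Gamma> L;
         A = Aut_space \<Gamma> X;
         S = symmetry_group \<Gamma> X;
         R = extended_symmetry_group \<Gamma> X
     in X = admissible_sets \<Gamma> L \<and> hereditary X \<and>
        S = shift_group \<Gamma> X \<and>
        shift_map \<Gamma> X \<in> iso \<Gamma> (A\<lparr>carrier := S\<rparr>) \<and>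
        \<Gamma> \<cong> monoid_vec TYPE(int) d \<and>
        (\<exists>H M. internal_semidirect (A\<lparr>carrier := R\<rparr>) S H \<and>
               subgroup M (GL_int d) \<and> M \<noteq> {\<one>\<^bsub>GL_int d\<^esub>} \<and>
               A\<lparr>carrier := H\<rparr> \<cong> GL_int d\<lparr>carrier := M\<rparr>)"
proof -
  let ?d = "field_degree TYPE('k)"
  let ?\<Gamma> = "minkowski_lattice r \<rho> s \<sigma>"
  let ?L = "\<lambda>i. minkowski r \<rho> s \<sigma> ` \<bb> i"
  let ?V = "monoid_vec TYPE(int) ?d"
  obtain \<omega> :: "nat \<Rightarrow> 'k" where "coprime_ideal_family ?d \<omega> \<bb>"
    by (rule coprime_ideal_familyI[OF assms(1,3,4)])
  then interpret F: coprime_ideal_family ?d \<omega> \<bb> .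
  have inj: "inj (minkowski r \<rho> s \<sigma>)" by (rule minkowski_inj[OF F.complex_embedding_exists assms(2)])
  have carrier: "carrier ?\<Gamma> = minkowski r \<rho> s \<sigma> ` Collect algebraic_int"
    by (simp add: minkowski_lattice_def ring_of_integers_def)
  have "\<bb> i \<noteq> Collect algebraic_int" for i
    using assms(3) by (simp add: primitive_ideal_family_def ring_of_integers_def)
  then have "sieve_system ?\<Gamma> ?L"
    by (intro F.sieve_system_image inj carrier minkowski_lattice_mult[OF assms(2)] minkowski_lattice_one[OF assms(2)])
  then interpret \<Gamma>: sieve_system ?\<Gamma> ?L .
  have groups: "group ?V" by (rule comm_group.axioms(2)[OF comm_group_vec])
  have iso: "?\<Gamma> \<cong> ?V"
    by (rule group.iso_sym[OF groups F.lattice_iso_int_vec[OF inj carrier minkowski_lattice_mult[OF assms(2)]]])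
  have "AutoGroup ?\<Gamma> \<cong> AutoGroup ?V" by (rule AutoGroup_iso[OF \<Gamma>.is_group groups iso])
  also have "AutoGroup ?V \<cong> GL_int ?d"
    by (rule group.iso_sym[OF group_GL_int is_isoI[OF matrix_automorphism_iso]])
  finally have aut: "AutoGroup ?\<Gamma> \<cong> GL_int ?d" .
  obtain M where M: "subgroup M (GL_int ?d)" "M \<noteq> {\<one>\<^bsub>GL_int ?d\<^esub>}"
    "AutoGroup ?\<Gamma>\<lparr>carrier := \<Gamma>.admissible_automorphisms\<rparr> \<cong> GL_int ?d\<lparr>carrier := M\<rparr>"
    by (rule subgroup_transport[OF \<Gamma>.AutoGroup group_GL_int aut
          \<Gamma>.subgroup_admissible_automorphisms \<Gamma>.admissible_automorphisms_nontrivial])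
  have "AutoGroup ?\<Gamma>\<lparr>carrier := \<Gamma>.admissible_automorphisms\<rparr> \<cong> \<Gamma>.A\<lparr>carrier := \<Gamma>.H\<rparr>"
    by (rule is_isoI[OF \<Gamma>.induced_iso])
  then have "\<Gamma>.A\<lparr>carrier := \<Gamma>.H\<rparr> \<cong> AutoGroup ?\<Gamma>\<lparr>carrier := \<Gamma>.admissible_automorphisms\<rparr>"
    by (rule group.iso_sym[OF subgroup.subgroup_is_group[OF \<Gamma>.subgroup_admissible_automorphisms \<Gamma>.AutoGroup]])
  then have HM: "\<Gamma>.A\<lparr>carrier := \<Gamma>.H\<rparr> \<cong> GL_int ?d\<lparr>carrier := M\<rparr>" by (rule iso_trans[OF _ M(3)])
  have X: "free_space ?\<Gamma> ?L = \<Gamma>.X" by (rule \<Gamma>.free_space_eq_admissible)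
  have S: "symmetry_group ?\<Gamma> \<Gamma>.X = \<Gamma>.S" "shift_group ?\<Gamma> \<Gamma>.X = \<Gamma>.S"
    using \<Gamma>.centralizer_eq_shifts by (simp_all add: symmetry_group_def \<Gamma>.A_def \<Gamma>.S_def)
  have R: "extended_symmetry_group ?\<Gamma> \<Gamma>.X = \<Gamma>.R"
    by (simp add: extended_symmetry_group_def \<Gamma>.R_def \<Gamma>.A_def \<Gamma>.S_def)
  have A: "Aut_space ?\<Gamma> \<Gamma>.X = \<Gamma>.A" by (simp add: \<Gamma>.A_def)
  have sh: "shift_map ?\<Gamma> \<Gamma>.X \<in> iso ?\<Gamma> (\<Gamma>.A\<lparr>carrier := \<Gamma>.S\<rparr>)"
    using \<Gamma>.sh_inj \<Gamma>.sh_mult by (auto simp: iso_def hom_def bij_betw_def \<Gamma>.S_eq)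
  show ?thesis
    unfolding Let_def X S R A
    using \<Gamma>.hereditary_X sh iso \<Gamma>.normalizer_semidirect M(1,2) HM by blast
qed

end
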